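(* Let $\tilde\mu(d\xi)=\frac{1}{2\sqrt{\pi}}\,\xi^{-3/2}\,d\xi$ on $(0,\infty)$, and let $\tilde X$ be the càdlàg Feller process with state space $[0,\infty]$, deterministic starting point $\tilde X_0\in(0,\infty)$, and generator $$\tilde{\mathcal{A}}f(x)=-x f'(x)+x\int_0^\infty\bigl(f(x+\xi)-f(x)\bigr)\,\tilde\mu(d\xi),\qquad f\in C_c^\infty(\mathbb{R}_{\ge 0}).$$ Let $\tau$ be the explosion time of $\tilde X$ (the time at which $\tilde X$ reaches $+\infty$), let $$M_t=\exp\bigl(-(\tilde X_t-\tilde X_0)\bigr),\qquad t\ge 0,$$ and let $\mathbb{Q}$ be the measure, absolutely continuous with respect to $\mathbb{P}$, given by $$\left.\frac{d\mathbb{Q}}{d\mathbb{P}}\right|_{\mathcal{F}_t}=M_t,\qquad t\ge 0.$$ Then the process $$L_t=\frac{1}{M_t}\mathbf{1}_{\{t<\tau\}}$$ is a strict local martingale under $\mathbb{Q}$.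
   Context: A filtered probability space $(\Omega,\mathcal{F},(\mathcal{F}_t)_{t\ge 0},\mathbb{P})$ satisfying the usual conditions is given; $\tilde X$ is adapted to this filtration and is a Feller (Markov) process with respect to it under $\mathbb{P}$. $C_c^\infty(\mathbb{R}_{\ge 0})$ is a core of $\tilde{\mathcal{A}}$. The process $\tilde X$ is a non-conservative affine process: it explodes to $+\infty$, where it stays afterwards, at a predictable stopping time $\tau$ that is finite with positive $\mathbb{P}$-probability, and $\tau$ is announced by the hitting times $\tau_n=\inf\{t\ge 0:\tilde X_t\ge n\}$. With the convention $e^{-\infty}=0$, $M$ reaches zero exactly at $\tau$ and remains zero afterwards; $L_t$ is understood to be $0$ for $t\ge\tau$. The process $M$ is a bounded $\mathbb{P}$-martingale with $M_0=1$, so that $\mathbb{Q}$ is a well-defined probability measure. A strict local martingale is a local martingale that is not a true martingale. *)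

theory Defs
  imports "HOL-Probability.Probability"
begin

text \<open>
  Time is the half-line of nonnegative reals: filtrations and processes are indexed by
  \<^typ>\<open>real\<close>, and only indices \<open>t \<ge> 0\<close> are ever constrained or used. Random times may be
  infinite and take values in \<^typ>\<open>ennreal\<close>, which is also the state space \<open>[0, \<infinity>]\<close>.
\<close>

definition usual_filtration :: "'a measure \<Rightarrow> (real \<Rightarrow> 'a measure) \<Rightarrow> bool" where
  "usual_filtration P F \<longleftrightarrow>
     (\<forall>t\<ge>0. subalgebra P (F t)) \<and>
     (\<forall>s t. 0 \<le> s \<longrightarrow> s \<le> t \<longrightarrow> sets (F s) \<subseteq> sets (F t)) \<and>
     complete_measure P \<and>
     null_sets P \<subseteq> sets (F 0) \<and>
     (\<forall>t\<ge>0. sets (F t) = (\<Inter>s\<in>{t<..}. sets (F s)))"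

definition adapted :: "(real \<Rightarrow> 'a measure) \<Rightarrow> (real \<Rightarrow> 'a \<Rightarrow> 'b::topological_space) \<Rightarrow> bool" where
  "adapted F Y \<longleftrightarrow> (\<forall>t\<ge>0. Y t \<in> borel_measurable (F t))"

definition cadlag :: "(real \<Rightarrow> 'b::topological_space) \<Rightarrow> bool" where
  "cadlag y \<longleftrightarrow>
     (\<forall>t\<ge>0. (y \<longlongrightarrow> y t) (at_right t)) \<and> (\<forall>t>0. \<exists>l. (y \<longlongrightarrow> l) (at_left t))"

text \<open>
  The library's \<^const>\<open>stopping_time\<close> takes values in the index type of the filtration, hence
  cannot be infinite when that type is \<^typ>\<open>real\<close>.
\<close>

definition ext_stopping_time :: "(real \<Rightarrow> 'a measure) \<Rightarrow> ('a \<Rightarrow> ennreal) \<Rightarrow> bool" where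
  "ext_stopping_time F T \<longleftrightarrow> (\<forall>t\<ge>0. Measurable.pred (F t) (\<lambda>\<omega>. T \<omega> \<le> ennreal t))"

definition stopped :: "(real \<Rightarrow> 'a \<Rightarrow> 'b) \<Rightarrow> ('a \<Rightarrow> ennreal) \<Rightarrow> real \<Rightarrow> 'a \<Rightarrow> 'b" where
  "stopped Y T t \<omega> = Y (enn2real (min (ennreal t) (T \<omega>))) \<omega>"

definition martingale :: "'a measure \<Rightarrow> (real \<Rightarrow> 'a measure) \<Rightarrow> (real \<Rightarrow> 'a \<Rightarrow> real) \<Rightarrow> bool" where
  "martingale N F Y \<longleftrightarrow>
     adapted F Y \<and>
     (\<forall>t\<ge>0. integrable N (Y t)) \<and>
     (\<forall>s t. 0 \<le> s \<longrightarrow> s \<le> t \<longrightarrow> (AE \<omega> in N. real_cond_exp N (F s) (Y t) \<omega> = Y s \<omega>))"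

definition local_martingale :: "'a measure \<Rightarrow> (real \<Rightarrow> 'a measure) \<Rightarrow> (real \<Rightarrow> 'a \<Rightarrow> real) \<Rightarrow> bool" where
  "local_martingale N F Y \<longleftrightarrow>
     adapted F Y \<and>
     (AE \<omega> in N. cadlag (\<lambda>t. Y t \<omega>)) \<and>
     (\<exists>T. (\<forall>n::nat. ext_stopping_time F (T n)) \<and>
          (AE \<omega> in N. incseq (\<lambda>n. T n \<omega>)) \<and>
          (AE \<omega> in N. (\<lambda>n. T n \<omega>) \<longlonglongrightarrow> \<infinity>) \<and>
          (\<forall>n. martingale N F (stopped Y (T n))))"

definition strict_local_martingale ::
    "'a measure \<Rightarrow> (real \<Rightarrow> 'a measure) \<Rightarrow> (real \<Rightarrow> 'a \<Rightarrow> real) \<Rightarrow> bool" where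
  "strict_local_martingale N F Y \<longleftrightarrow> local_martingale N F Y \<and> \<not> martingale N F Y"

text \<open>
  \<open>C\<^sub>0([0, \<infinity>))\<close> is represented by the continuous functions on \<open>[0, \<infinity>]\<close> that vanish at \<open>\<infinity>\<close>, with
  the supremum norm inherited from the type of bounded continuous functions. Semigroups on it are
  sub-Markovian; mass lost from \<open>[0, \<infinity>)\<close> sits in the absorbing state \<open>\<infinity>\<close>.
\<close>

definition C0 :: "(ennreal \<Rightarrow>\<^sub>C real) set" where
  "C0 = {f. apply_bcontfun f \<infinity> = 0}"

definition feller_semigroup :: "(real \<Rightarrow> (ennreal \<Rightarrow>\<^sub>C real) \<Rightarrow> (ennreal \<Rightarrow>\<^sub>C real)) \<Rightarrow> bool" where
  "feller_semigroup S \<longleftrightarrow>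
     (\<forall>t\<ge>0. \<forall>f\<in>C0. S t f \<in> C0) \<and>
     (\<forall>t\<ge>0. \<forall>f\<in>C0. \<forall>g\<in>C0. S t (f + g) = S t f + S t g) \<and>
     (\<forall>t\<ge>0. \<forall>c. \<forall>f\<in>C0. S t (c *\<^sub>R f) = c *\<^sub>R S t f) \<and>
     (\<forall>t\<ge>0. \<forall>f\<in>C0. (\<forall>x. 0 \<le> apply_bcontfun f x) \<longrightarrow> (\<forall>x. 0 \<le> apply_bcontfun (S t f) x)) \<and>
     (\<forall>t\<ge>0. \<forall>f\<in>C0. norm (S t f) \<le> norm f) \<and>
     (\<forall>f\<in>C0. S 0 f = f) \<and>
     (\<forall>s\<ge>0. \<forall>t\<ge>0. \<forall>f\<in>C0. S (s + t) f = S s (S t f)) \<and>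
     (\<forall>f\<in>C0. ((\<lambda>t. S t f) \<longlongrightarrow> f) (at_right 0))"

text \<open>
  The generator as a graph: \<open>(f, g) \<in> generator S\<close> says that \<open>f\<close> is in the domain and is mapped
  to \<open>g\<close>. A core is a subset of the domain, restricted to which the graph is dense.
\<close>

definition generator ::
    "(real \<Rightarrow> (ennreal \<Rightarrow>\<^sub>C real) \<Rightarrow> (ennreal \<Rightarrow>\<^sub>C real)) \<Rightarrow>
     ((ennreal \<Rightarrow>\<^sub>C real) \<times> (ennreal \<Rightarrow>\<^sub>C real)) set" where
  "generator S = {(f, g). f \<in> C0 \<and> ((\<lambda>t. (S t f - f) /\<^sub>R t) \<longlongrightarrow> g) (at_right 0)}"

definition is_core ::
    "(real \<Rightarrow> (ennreal \<Rightarrow>\<^sub>C real) \<Rightarrow> (ennreal \<Rightarrow>\<^sub>C real)) \<Rightarrow> (ennreal \<Rightarrow>\<^sub>C real) set \<Rightarrow> bool" where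
  "is_core S D \<longleftrightarrow>
     D \<subseteq> Domain (generator S) \<and> generator S \<subseteq> closure (generator S \<inter> (D \<times> UNIV))"

text \<open>
  The Markov property is relative to the given filtration. As \<open>f \<infinity> = 0\<close> for \<open>f \<in> C0\<close>, it forces
  the process to stay almost surely at \<open>\<infinity>\<close> once it is there.
\<close>

definition cadlag_feller_process ::
    "'a measure \<Rightarrow> (real \<Rightarrow> 'a measure) \<Rightarrow> (real \<Rightarrow> (ennreal \<Rightarrow>\<^sub>C real) \<Rightarrow> (ennreal \<Rightarrow>\<^sub>C real)) \<Rightarrow>
     (real \<Rightarrow> 'a \<Rightarrow> ennreal) \<Rightarrow> bool" where
  "cadlag_feller_process P F S X \<longleftrightarrow>
     feller_semigroup S \<and>
     adapted F X \<and>
     (\<forall>\<omega>\<in>space P. cadlag (\<lambda>t. X t \<omega>)) \<and>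
     (\<forall>s\<ge>0. \<forall>t\<ge>0. \<forall>f\<in>C0. AE \<omega> in P.
        real_cond_exp P (F s) (\<lambda>\<omega>'. apply_bcontfun f (X (s + t) \<omega>')) \<omega>
          = apply_bcontfun (S t f) (X s \<omega>))"

definition half_line_fun :: "(ennreal \<Rightarrow>\<^sub>C real) \<Rightarrow> real \<Rightarrow> real" where
  "half_line_fun f x = apply_bcontfun f (ennreal x)"

text \<open>
  Smoothness on the closed half-line, with one-sided derivatives at \<open>0\<close>: \<open>D n\<close> is the \<open>n\<close>-th
  derivative. The support is compact in \<open>[0, \<infinity>)\<close>, but may contain \<open>0\<close>.
\<close>

definition Cc_infty :: "(ennreal \<Rightarrow>\<^sub>C real) set" where
  "Cc_infty = {f \<in> C0.
     (\<exists>D :: nat \<Rightarrow> real \<Rightarrow> real.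
        (\<forall>x\<ge>0. D 0 x = half_line_fun f x) \<and>
        (\<forall>n. \<forall>x\<ge>0. (D n has_real_derivative D (Suc n) x) (at x within {0..}))) \<and>
     (\<exists>K. \<forall>x\<ge>K. half_line_fun f x = 0)}"

definition mu_tilde :: "real measure" where
  "mu_tilde = density lborel
     (\<lambda>\<xi>. ennreal (indicator {0<..} \<xi> * (1 / (2 * sqrt pi) * \<xi> powr (- 3 / 2))))"

definition A_tilde :: "(ennreal \<Rightarrow>\<^sub>C real) \<Rightarrow> real \<Rightarrow> real" where
  "A_tilde f x =
     - x * vector_derivative (half_line_fun f) (at x within {0..})
     + x * (\<integral>\<xi>. (half_line_fun f (x + \<xi>) - half_line_fun f x) \<partial>mu_tilde)"

definition explosion_time :: "(real \<Rightarrow> 'a \<Rightarrow> ennreal) \<Rightarrow> 'a \<Rightarrow> ennreal" where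
  "explosion_time X \<omega> = Inf {ennreal t |t. 0 \<le> t \<and> X t \<omega> = \<infinity>}"

text \<open>\<open>exp (- (X\<^sub>t - X\<^sub>0))\<close> with \<open>exp (- \<infinity>) = 0\<close>, for finite \<open>X\<^sub>0\<close>.\<close>

definition M_proc :: "(real \<Rightarrow> 'a \<Rightarrow> ennreal) \<Rightarrow> real \<Rightarrow> 'a \<Rightarrow> real" where
  "M_proc X t \<omega> =
     (if X t \<omega> = \<infinity> then 0 else exp (- (enn2real (X t \<omega>) - enn2real (X 0 \<omega>))))"

definition L_proc :: "(real \<Rightarrow> 'a \<Rightarrow> ennreal) \<Rightarrow> real \<Rightarrow> 'a \<Rightarrow> real" where
  "L_proc X t \<omega> = (if ennreal t < explosion_time X \<omega> then 1 / M_proc X t \<omega> else 0)"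

end

theory Submission
  imports Defs
begin

text \<open>
  The state equation of this affine process is solved by exponentials: the generator maps
  \<open>e\<^sub>v(x) = exp (- v x)\<close> to \<open>(v - sqrt v) x e\<^sub>v(x)\<close>, because the Levy measure has Laplace exponent
  \<open>sqrt v\<close>. Hence \<open>e\<^bsub>c(s)\<^esub>\<close> moves along the semigroup like a time shift of the parameter whenever
  \<open>c' = sqrt c - c\<close>. As the square root is not Lipschitz at \<open>0\<close>, this equation has, besides \<open>c = 0\<close>,
  the solution \<open>c(t) = (1 - exp (- t / 2))\<^sup>2\<close> starting from \<open>0\<close>, and the semigroup follows it:
  \<open>S\<^sub>t e\<^bsub>c(\<epsilon>)\<^esub> = e\<^bsub>c(t + \<epsilon>)\<^esub>\<close> (lemma \<open>feller_semigroup_exp_flow\<close>). Letting \<open>\<epsilon>\<close> tend to \<open>0\<close>, the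
  probability of still being finite after time \<open>t\<close> is \<open>exp (- c(t) x)\<close> from the state \<open>x\<close>. Everything
  about the explosion is read off from this formula.

  \<^item> Since \<open>c(1) > 0\<close>, the process explodes before time \<open>1\<close> with positive probability. As
    \<open>M\<^sub>t L\<^sub>t\<close> is at most the indicator of \<open>X\<^sub>t < \<infinity>\<close>, the \<open>Q\<close>-expectation of \<open>L\<^sub>1\<close> is then smaller than
    \<open>1 = L\<^sub>0\<close>, and \<open>L\<close> is not a martingale (\<open>L_not_martingale\<close>).

  \<^item> Since \<open>c(t)\<close> is of order \<open>t\<^sup>2\<close>, a jump from \<open>[0, n]\<close> to \<open>\<infinity>\<close> within one of \<open>N\<close> time steps of length
    \<open>1 / N\<close> has probability of order \<open>1 / N\<close>. So the process reaches \<open>\<infinity>\<close> without jumping there, and is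
    \<open>P\<close>-almost surely finite when it first exceeds \<open>n\<close> (\<open>no_jump_to_infinity\<close>).

  Under \<open>Q\<close> the process does not explode: where \<open>X\<close> exceeds \<open>n\<close>, the density \<open>M\<close> is at most
  \<open>exp (x\<^sub>0 - n)\<close>, and a maximal inequality follows (\<open>Q_maximal_inequality\<close>). The first-passage times
  \<open>\<sigma>\<^sub>n\<close> of the levels \<open>n\<close> therefore increase to \<open>\<infinity>\<close>, and they localise \<open>L\<close>: for \<open>s < t\<close> and an event
  \<open>A\<close> at time \<open>s\<close> with \<open>s < \<sigma>\<^sub>n\<close> on \<open>A\<close>, changing the measure at time \<open>min t \<sigma>\<^sub>n\<close> turns the integral of the
  stopped process over \<open>A\<close> into the \<open>P\<close>-probability that \<open>A\<close> occurs and \<open>X\<close> is finite at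
  \<open>min t \<sigma>\<^sub>n\<close>, which is \<open>P(A)\<close> by the absence of jumps to \<open>\<infinity>\<close> (\<open>stopped_L_martingale\<close>).
\<close>

section \<open>Continuous functions on the half-line that vanish at infinity\<close>

lemma times_exp_le:
  fixes a x :: real
  assumes "0 < a" "0 \<le> x"
  shows "x * exp (- (a * x)) \<le> 1 / a"
proof -
  have "a * x \<le> exp (a * x)" using exp_ge_add_one_self[of "a * x"] by linarith
  then show ?thesis using assms by (simp add: exp_minus field_simps)
qed

lemma power2_times_exp_le:
  fixes a x :: real
  assumes "0 < a" "0 \<le> x"
  shows "x\<^sup>2 * exp (- (a * x)) \<le> 2 / a\<^sup>2"
proof -
  have "(a * x)\<^sup>2 / 2 \<le> exp (a * x)"
    using exp_lower_Taylor_quadratic[of "a * x"] mult_nonneg_nonneg[of a x] assms by linarith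
  then show ?thesis using assms by (simp add: exp_minus field_simps power_mult_distrib)
qed

text \<open>
  \<^const>\<open>Bcontfun\<close> has an unspecified value outside its domain, so each use carries the proof that
  \<open>h\<close> is continuous on the half-line and tends to \<open>0\<close>.
\<close>

definition extend_to_infinity :: "(real \<Rightarrow> real) \<Rightarrow> (ennreal \<Rightarrow>\<^sub>C real)" where
  "extend_to_infinity h = Bcontfun (\<lambda>x. if x = \<infinity> then 0 else h (enn2real x))"

lemma continuous_extend_to_infinity:
  fixes h :: "real \<Rightarrow> real"
  assumes cont: "continuous_on {0..} h" and lim: "(h \<longlongrightarrow> 0) at_top"
  shows "continuous_on UNIV (\<lambda>x::ennreal. if x = \<infinity> then 0 else h (enn2real x))"
    (is "continuous_on UNIV ?g")
proof -
  have "isCont ?g x" for x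
  proof (cases "x = \<infinity>")
    case True
    have "(?g \<longlongrightarrow> 0) (nhds \<infinity>)"
    proof (rule tendstoI)
      fix e :: real assume e: "0 < e"
      have "eventually (\<lambda>r. dist (h r) 0 < e) at_top" using lim e by (rule tendstoD)
      then obtain N where N: "\<And>r. N \<le> r \<Longrightarrow> dist (h r) 0 < e"
        by (auto simp: eventually_at_top_linorder)
      have "eventually (\<lambda>y::ennreal. ennreal N < y) (nhds \<infinity>)"
        by (rule eventually_nhds_in_open[of "{ennreal N<..}", simplified]) auto
      then show "eventually (\<lambda>y. dist (?g y) 0 < e) (nhds \<infinity>)"
      proof eventually_elim
        case (elim y)
        show ?case
        proof (cases y)
          case (real r)
          then show ?thesis using elim N[of r] e by (simp add: ennreal_less_iff) (metis ennreal_le_iff less_imp_le not_le)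
        qed (use e in auto)
      qed
    qed
    then show ?thesis using True by (simp add: isCont_def tendsto_nhds_iff)
  next
    case False
    then obtain r where r: "x = ennreal r" "0 \<le> r" by (cases x) auto
    have *: "((\<lambda>y. enn2real y) \<longlongrightarrow> r) (at x)"
      using tendsto_enn2real[of "\<lambda>y. y" r "at x"] r by simp
    have "(h \<longlongrightarrow> h r) (at r within {0..})"
      using cont r by (auto simp: continuous_on_def)
    moreover have "filterlim enn2real (at r within {0..}) (at x)"
    proof -
      have "eventually (\<lambda>y. enn2real y \<in> {0..} - {r}) (at x)"
      proof -
        have "eventually (\<lambda>y::ennreal. y < \<infinity>) (at x)"
          using False by (intro order_tendstoD(2)[OF tendsto_ident_at]) (auto simp: less_top)
        moreover have "eventually (\<lambda>y. y \<noteq> x) (at x)" by (simp add: eventually_at_filter)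
        ultimately show ?thesis
          by eventually_elim (use r in \<open>auto simp: less_top\<close>)
      qed
      then show ?thesis using * by (simp add: filterlim_at eventually_conj_iff)
    qed
    ultimately have "((\<lambda>y. h (enn2real y)) \<longlongrightarrow> h r) (at x)"
      by (rule filterlim_compose)
    moreover have "eventually (\<lambda>y. h (enn2real y) = ?g y) (at x)"
    proof -
      have "eventually (\<lambda>y::ennreal. y < \<infinity>) (at x)"
        using False by (intro order_tendstoD(2)[OF tendsto_ident_at]) (auto simp: less_top)
      then show ?thesis by eventually_elim auto
    qed
    ultimately have "(?g \<longlongrightarrow> h r) (at x)" by (rule Lim_transform_eventually)
    then show ?thesis using r by (simp add: isCont_def)
  qed
  then show ?thesis by (simp add: continuous_on_eq_continuous_at)
qed

lemma extend_to_infinity_apply: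
  assumes "continuous_on {0..} h" "(h \<longlongrightarrow> 0) at_top"
  shows "apply_bcontfun (extend_to_infinity h) = (\<lambda>x. if x = \<infinity> then 0 else h (enn2real x))"
proof -
  have "compact (UNIV :: ennreal set)" by (rule compact_UNIV)
  then have "bounded (range (\<lambda>x::ennreal. if x = \<infinity> then 0 else h (enn2real x)))"
    using compact_continuous_image[OF continuous_extend_to_infinity[OF assms]] compact_imp_bounded by blast
  then have "(\<lambda>x::ennreal. if x = \<infinity> then 0 else h (enn2real x)) \<in> bcontfun"
    using continuous_extend_to_infinity[OF assms] by (simp add: bcontfun_def)
  then show ?thesis unfolding extend_to_infinity_def by (rule Bcontfun_inverse)
qed

lemma extend_to_infinity_in_C0:
  assumes "continuous_on {0..} h" "(h \<longlongrightarrow> 0) at_top"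
  shows "extend_to_infinity h \<in> C0"
  by (simp add: C0_def extend_to_infinity_apply[OF assms])

lemma half_line_fun_extend:
  assumes "continuous_on {0..} h" "(h \<longlongrightarrow> 0) at_top" "0 \<le> x"
  shows "half_line_fun (extend_to_infinity h) x = h x"
  using assms(3) by (simp add: half_line_fun_def extend_to_infinity_apply[OF assms(1,2)])

lemma C0_add: "f \<in> C0 \<Longrightarrow> g \<in> C0 \<Longrightarrow> f + g \<in> C0"
  and C0_diff: "f \<in> C0 \<Longrightarrow> g \<in> C0 \<Longrightarrow> f - g \<in> C0"
  and C0_scaleR: "f \<in> C0 \<Longrightarrow> c *\<^sub>R f \<in> C0"
  and C0_0: "0 \<in> C0"
  by (auto simp: C0_def)

lemma C0_limit:
  assumes "\<forall>\<^sub>F x in A. f x \<in> C0" "(f \<longlongrightarrow> g) A" "A \<noteq> bot"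
  shows "g \<in> C0"
proof -
  have "((\<lambda>x. apply_bcontfun (f x) \<infinity>) \<longlongrightarrow> apply_bcontfun g \<infinity>) A"
    using tendsto_bcontfun_uniform_limit[OF assms(2)] by (rule tendsto_uniform_limitI) simp
  moreover have "((\<lambda>x. apply_bcontfun (f x) \<infinity>) \<longlongrightarrow> 0) A"
    using assms(1) by (intro tendsto_eventually) (auto simp: C0_def elim: eventually_mono)
  ultimately show ?thesis using tendsto_unique[OF assms(3)] by (auto simp: C0_def)
qed

lemma norm_C0_le:
  assumes "f \<in> C0" "0 \<le> B" "\<And>x. 0 \<le> x \<Longrightarrow> \<bar>half_line_fun f x\<bar> \<le> B"
  shows "norm f \<le> B"
proof (rule norm_bound)
  fix x show "norm (apply_bcontfun f x) \<le> B"
    using assms by (cases x) (auto simp: C0_def half_line_fun_def infinity_ennreal_def)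
qed

lemma half_line_fun_diff: "half_line_fun (f - g) x = half_line_fun f x - half_line_fun g x"
  by (simp add: half_line_fun_def)

lemma half_line_fun_measurable [measurable]: "half_line_fun f \<in> borel_measurable borel"
proof -
  have "continuous_on UNIV (\<lambda>x. apply_bcontfun f (ennreal x))"
    by (rule continuous_on_compose2[OF continuous_on_apply_bcontfun[of UNIV]])
       (auto intro!: continuous_on_ennreal continuous_intros)
  then show ?thesis unfolding half_line_fun_def by (rule borel_measurable_continuous_onI)
qed

section \<open>The Laplace exponent of the Levy measure\<close>

lemma mu_tilde_nn_integral:
  assumes [measurable]: "f \<in> borel_measurable borel"
  shows "(\<integral>\<^sup>+\<xi>. f \<xi> \<partial>mu_tilde) =
    (\<integral>\<^sup>+\<xi>. ennreal (indicator {0<..} \<xi> * (1 / (2 * sqrt pi) * \<xi> powr (- 3 / 2))) * f \<xi> \<partial>lborel)"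
  unfolding mu_tilde_def by (subst nn_integral_density) auto

lemma sets_mu_tilde [measurable_cong, simp]: "sets mu_tilde = sets borel"
  by (simp add: mu_tilde_def)

lemma AE_mu_tilde_pos: "AE \<xi> in mu_tilde. 0 < \<xi>"
  unfolding mu_tilde_def by (subst AE_density) (auto simp: indicator_def)

text \<open>
  The case \<open>v = 1\<close> is the integral for \<open>Gamma (1 / 2)\<close>; the general one follows by scaling.
\<close>

lemma nn_integral_exp_powr_half:
  fixes v :: real
  assumes v: "0 < v"
  shows "(\<integral>\<^sup>+\<xi>. ennreal (indicator {0<..} \<xi> * (\<xi> powr (- 1 / 2) * exp (- (v * \<xi>)))) \<partial>lborel)
    = ennreal (sqrt pi / sqrt v)"
proof -
  let ?g = "\<lambda>t::real. ennreal (indicator {0<..} t * (t powr (- 1 / 2) * exp (- t)))"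
  have g: "(\<integral>\<^sup>+t. ?g t \<partial>lborel) = ennreal (sqrt pi)"
  proof -
    have "(\<integral>\<^sup>+t. ?g t \<partial>lborel) =
       (\<integral>\<^sup>+t. ennreal (indicator {0..} t * t powr (1/2 - 1) / exp t) \<partial>lborel)"
      by (intro nn_integral_cong) (auto simp: indicator_def exp_minus field_simps)
    also have "\<dots> = ennreal (Gamma (1/2))" using Gamma_conv_nn_integral_real[of "1/2"] by simp
    finally show ?thesis by (simp add: Gamma_one_half_real)
  qed
  have "ennreal (sqrt pi) = ennreal v * (\<integral>\<^sup>+\<xi>. ?g (v * \<xi>) \<partial>lborel)"
    using nn_integral_real_affine[of ?g v 0] v unfolding g[symmetric] by simp
  also have "(\<integral>\<^sup>+\<xi>. ?g (v * \<xi>) \<partial>lborel) =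
     (\<integral>\<^sup>+\<xi>. ennreal (1 / sqrt v) * ennreal (indicator {0<..} \<xi> * (\<xi> powr (- 1 / 2) * exp (- (v * \<xi>)))) \<partial>lborel)"
    using v by (intro nn_integral_cong)
      (auto simp: indicator_def zero_less_mult_iff powr_mult ennreal_mult'[symmetric] powr_minus powr_half_sqrt field_simps)
  also have "\<dots> = ennreal (1 / sqrt v) * (\<integral>\<^sup>+\<xi>. ennreal (indicator {0<..} \<xi> * (\<xi> powr (- 1 / 2) * exp (- (v * \<xi>)))) \<partial>lborel)"
    by (rule nn_integral_cmult) measurable
  finally have eq: "ennreal (sqrt pi) = ennreal (sqrt v) *
      (\<integral>\<^sup>+\<xi>. ennreal (indicator {0<..} \<xi> * (\<xi> powr (- 1 / 2) * exp (- (v * \<xi>)))) \<partial>lborel)"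
    using v by (simp add: mult.assoc[symmetric] ennreal_mult'[symmetric] real_div_sqrt)
  have "ennreal (1 / sqrt v) * ennreal (sqrt pi) =
      (\<integral>\<^sup>+\<xi>. ennreal (indicator {0<..} \<xi> * (\<xi> powr (- 1 / 2) * exp (- (v * \<xi>)))) \<partial>lborel)"
    unfolding eq using v by (simp add: mult.assoc[symmetric] ennreal_mult'[symmetric])
  then show ?thesis using v by (simp add: ennreal_mult'[symmetric])
qed

text \<open>
  Write \<open>1 - exp (- u \<xi>)\<close> as the integral of \<open>\<xi> exp (- v \<xi>)\<close> over \<open>v \<in> [0, u]\<close> and integrate in
  \<open>\<xi>\<close> first: the factor \<open>\<xi>\<close> turns the exponent \<open>- 3 / 2\<close> into \<open>- 1 / 2\<close>, and what remains to be
  integrated is \<open>1 / (2 sqrt v)\<close>.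
\<close>

lemma nn_integral_Laplace_exponent:
  fixes u :: real
  assumes u: "0 < u"
  shows "(\<integral>\<^sup>+\<xi>. ennreal (1 - exp (- (u * \<xi>))) \<partial>mu_tilde) = ennreal (sqrt u)"
proof -
  define k :: "real \<Rightarrow> real \<Rightarrow> ennreal" where
    "k \<xi> v = ennreal (1 / (2 * sqrt pi)) * ennreal (indicator {0<..} \<xi> * (\<xi> powr (- 1 / 2) * exp (- (v * \<xi>)))) * indicator {0..u} v"
    for \<xi> v
  have [measurable]: "(\<lambda>(\<xi>, v). k \<xi> v) \<in> borel_measurable (borel \<Otimes>\<^sub>M borel)"
    unfolding k_def by measurable
  have inner: "(\<integral>\<^sup>+v. k \<xi> v \<partial>lborel) =
     ennreal (indicator {0<..} \<xi> * (1 / (2 * sqrt pi) * \<xi> powr (- 3 / 2))) * ennreal (1 - exp (- (u * \<xi>)))" for \<xi>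
  proof (cases "0 < \<xi>")
    case True
    have "((\<lambda>v. - exp (- (v * \<xi>)) / \<xi>) has_real_derivative exp (- (v * \<xi>))) (at v)" for v
      using True by (auto intro!: derivative_eq_intros)
    then have "(\<integral>\<^sup>+v. ennreal (exp (- (v * \<xi>))) * indicator {0..u} v \<partial>lborel)
       = ennreal (- exp (- (u * \<xi>)) / \<xi> - (- exp (- (0 * \<xi>)) / \<xi>))"
      using u by (intro nn_integral_FTC_Icc) auto
    moreover have "(\<integral>\<^sup>+v. k \<xi> v \<partial>lborel) = ennreal (1 / (2 * sqrt pi) * \<xi> powr (- 1 / 2)) *
       (\<integral>\<^sup>+v. ennreal (exp (- (v * \<xi>))) * indicator {0..u} v \<partial>lborel)"
      using True by (subst nn_integral_cmult[symmetric])
        (auto simp: k_def ennreal_mult'[symmetric] mult.assoc[symmetric] intro!: nn_integral_cong)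
    ultimately have "(\<integral>\<^sup>+v. k \<xi> v \<partial>lborel)
        = ennreal (1 / (2 * sqrt pi) * \<xi> powr (- 1 / 2) * (- exp (- (u * \<xi>)) / \<xi> - (- exp (- (0 * \<xi>)) / \<xi>)))"
      by (subst ennreal_mult') simp_all
    moreover have "\<xi> powr (- 3 / 2) = \<xi> powr (- 1 / 2) / \<xi>"
      using True powr_diff[of \<xi> "-1/2" 1] by simp
    moreover have "1 / (2 * sqrt pi) * \<xi> powr (- 1 / 2) * (- exp (- (u * \<xi>)) / \<xi> - (- exp (- (0 * \<xi>)) / \<xi>))
        = 1 / (2 * sqrt pi) * (\<xi> powr (- 1 / 2) / \<xi>) * (1 - exp (- (u * \<xi>)))"
      using True by (simp add: field_simps)
    ultimately show ?thesis using True by (subst ennreal_mult'[symmetric]) simp_all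
  qed (simp add: k_def)
  have outer: "(\<integral>\<^sup>+\<xi>. k \<xi> v \<partial>lborel) = ennreal (1 / (2 * sqrt v)) * indicator {0..u} v" if "v \<noteq> 0" for v
  proof (cases "v \<in> {0..u}")
    case True
    then have "0 < v" using that by auto
    have "(\<integral>\<^sup>+\<xi>. k \<xi> v \<partial>lborel)
        = ennreal (1 / (2 * sqrt pi)) * ennreal (sqrt pi / sqrt v) * indicator {0..u} v"
      unfolding k_def nn_integral_exp_powr_half[OF \<open>0 < v\<close>, symmetric]
      by (subst nn_integral_multc, measurable, subst nn_integral_cmult) auto
    also have "ennreal (1 / (2 * sqrt pi)) * ennreal (sqrt pi / sqrt v) = ennreal (1 / (2 * sqrt v))"
      using \<open>0 < v\<close> by (subst ennreal_mult'[symmetric]) auto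
    finally show ?thesis .
  qed (simp add: k_def)
  have "(\<integral>\<^sup>+\<xi>. ennreal (1 - exp (- (u * \<xi>))) \<partial>mu_tilde) = (\<integral>\<^sup>+\<xi>. (\<integral>\<^sup>+v. k \<xi> v \<partial>lborel) \<partial>lborel)"
    unfolding inner by (rule mu_tilde_nn_integral) measurable
  also have "\<dots> = (\<integral>\<^sup>+v. (\<integral>\<^sup>+\<xi>. k \<xi> v \<partial>lborel) \<partial>lborel)"
    by (rule lborel_pair.Fubini'[symmetric]) measurable
  also have "\<dots> = (\<integral>\<^sup>+v. ennreal (1 / (2 * sqrt v)) * indicator {0..u} v \<partial>lborel)"
    using AE_lborel_singleton[of 0] by (intro nn_integral_cong_AE) (auto elim!: eventually_mono simp: outer)
  also have "\<dots> = ennreal (sqrt u)"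
  proof -
    have "((\<lambda>v. 1 / (2 * sqrt v)) has_integral (sqrt u - sqrt 0)) {0..u}"
      using u by (intro fundamental_theorem_of_calculus_interior)
        (auto intro!: continuous_intros derivative_eq_intros simp: has_real_derivative_iff_has_vector_derivative[symmetric] field_simps)
    then have "((\<lambda>v. 1 / (2 * sqrt v)) has_integral (sqrt u)) {0..u}" by simp
    then have "(\<integral>\<^sup>+v. ennreal (indicator {0..u} v * (1 / (2 * sqrt v))) \<partial>lborel) = ennreal (sqrt u)"
      by (intro nn_integral_has_integral_lebesgue) auto
    then show ?thesis by (simp add: indicator_mult_ennreal mult.commute) 
  qed
  finally show ?thesis .
qed

lemma integrable_Laplace_exponent:
  fixes u :: real
  assumes u: "0 < u"
  shows "integrable mu_tilde (\<lambda>\<xi>. 1 - exp (- (u * \<xi>)))"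
    and "(\<integral>\<xi>. (1 - exp (- (u * \<xi>))) \<partial>mu_tilde) = sqrt u"
proof -
  have nn: "AE \<xi> in mu_tilde. 0 \<le> 1 - exp (- (u * \<xi>))"
    using AE_mu_tilde_pos by eventually_elim (use u in auto)
  show "integrable mu_tilde (\<lambda>\<xi>. 1 - exp (- (u * \<xi>)))"
    using nn nn_integral_Laplace_exponent[OF u] by (intro integrableI_nonneg) auto
  show "(\<integral>\<xi>. (1 - exp (- (u * \<xi>))) \<partial>mu_tilde) = sqrt u"
    using nn nn_integral_Laplace_exponent[OF u] u by (subst integral_eq_nn_integral) auto
qed

section \<open>Smooth cutoffs of exponentials\<close>

text \<open>
  The functions of this form contain \<open>exp (- 1 / y)\<close>, extended by \<open>0\<close>, and are closed under
  differentiation; this is what makes \<open>exp (- 1 / y)\<close> smooth at \<open>0\<close>.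
\<close>

definition flat_poly :: "real poly \<Rightarrow> real \<Rightarrow> real" where
  "flat_poly p y = (if y \<le> 0 then 0 else poly p (1 / y) * exp (- (1 / y)))"

lemma poly_times_exp_decay: "((\<lambda>z::real. poly p z * exp (- z)) \<longlongrightarrow> 0) at_top"
proof -
  have "((\<lambda>z. \<Sum>i\<le>degree p. coeff p i * (z ^ i / exp z)) \<longlongrightarrow> (\<Sum>i\<le>degree p. coeff p i * 0)) at_top"
    by (intro tendsto_intros tendsto_power_div_exp_0)
  then show ?thesis by (simp add: poly_altdef exp_minus sum_distrib_right divide_inverse mult.assoc)
qed

lemma flat_poly_derivative:
  "(flat_poly p has_real_derivative flat_poly ([:0, 0, 1:] * (p - pderiv p)) y) (at y)"
proof -
  consider "y < 0" | "y = 0" | "0 < y" by linarith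
  then show ?thesis
  proof cases
    case 1
    have "((\<lambda>_. 0) has_real_derivative 0) (at y)" by simp
    moreover have "eventually (\<lambda>y. flat_poly p y = 0) (nhds y)"
      using eventually_nhds_in_open[of "{..<0}" y] 1
      by (auto simp: flat_poly_def elim!: eventually_mono)
    ultimately have "(flat_poly p has_real_derivative 0) (at y)"
      by (subst DERIV_cong_ev[OF refl _ refl]) auto
    then show ?thesis using 1 by (simp add: flat_poly_def)
  next
    case 2
    have *: "((\<lambda>h. poly ([:0, 1:] * p) (1 / h) * exp (- (1 / h))) \<longlongrightarrow> 0) (at_right 0)"
      using filterlim_compose[OF poly_times_exp_decay[of "[:0, 1:] * p"] filterlim_inverse_at_top_right]
      by (simp add: inverse_eq_divide)
    have "((\<lambda>h. flat_poly p h / h) \<longlongrightarrow> 0) (at_right 0)"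
      by (rule Lim_transform_eventually[OF *])
         (auto simp: eventually_at_filter flat_poly_def field_simps)
    moreover have "((\<lambda>h. flat_poly p h / h) \<longlongrightarrow> 0) (at_left 0)"
      by (rule tendsto_eventually) (auto simp: eventually_at_filter flat_poly_def)
    ultimately have "((\<lambda>h. flat_poly p h / h) \<longlongrightarrow> 0) (at 0)"
      by (simp add: filterlim_at_split)
    then show ?thesis using 2 by (simp add: DERIV_def flat_poly_def)
  next
    case 3
    have "((\<lambda>y. poly p (1 / y) * exp (- (1 / y))) has_real_derivative
        poly ([:0, 0, 1:] * (p - pderiv p)) (1 / y) * exp (- (1 / y))) (at y)"
    proof -
      have inv: "((\<lambda>y. 1 / y) has_real_derivative - ((1 / y) * (1 / y))) (at y)"
        using 3 by (auto intro!: derivative_eq_intros)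
      have "((\<lambda>y. poly p (1 / y)) has_real_derivative poly (pderiv p) (1 / y) * (- ((1 / y) * (1 / y)))) (at y)"
        by (rule DERIV_chain2[OF poly_DERIV inv])
      moreover have "((\<lambda>y. exp (- (1 / y))) has_real_derivative exp (- (1 / y)) * (- (- ((1 / y) * (1 / y))))) (at y)"
        by (rule DERIV_chain2[OF DERIV_exp DERIV_minus[OF inv]])
      ultimately have "((\<lambda>y. poly p (1 / y) * exp (- (1 / y))) has_real_derivative
          poly (pderiv p) (1 / y) * (- ((1 / y) * (1 / y))) * exp (- (1 / y))
          + exp (- (1 / y)) * (- (- ((1 / y) * (1 / y)))) * poly p (1 / y)) (at y)"
        by (rule DERIV_mult)
      then show ?thesis by (simp add: algebra_simps)
    qed
    moreover have "eventually (\<lambda>y. flat_poly p y = poly p (1 / y) * exp (- (1 / y))) (nhds y)"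
      using eventually_nhds_in_open[of "{0<..}" y] 3
      by (auto simp: flat_poly_def elim!: eventually_mono)
    ultimately have "(flat_poly p has_real_derivative
        poly ([:0, 0, 1:] * (p - pderiv p)) (1 / y) * exp (- (1 / y))) (at y)"
      by (subst DERIV_cong_ev[OF refl _ refl]) auto
    then show ?thesis using 3 by (simp add: flat_poly_def)
  qed
qed

lemma flat_poly_diff: "flat_poly (p - q) y = flat_poly p y - flat_poly q y"
  and flat_poly_smult: "flat_poly (smult c p) y = c * flat_poly p y"
  by (auto simp: flat_poly_def algebra_simps)

text \<open>
  For the constant polynomial \<open>p = [:exp 1:]\<close> this is \<open>exp (- v x)\<close> multiplied by a smooth cutoff that
  equals \<open>1\<close> at \<open>x = 0\<close> and vanishes for \<open>x \<ge> k\<close>. General \<open>p\<close> account for all derivatives.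
\<close>

definition damped_flat :: "real \<Rightarrow> real \<Rightarrow> real poly \<Rightarrow> real \<Rightarrow> real" where
  "damped_flat v k p x = exp (- (v * x)) * flat_poly p (1 - x / k)"

lemma damped_flat_derivative:
  assumes "k \<noteq> 0"
  shows "(damped_flat v k p has_real_derivative
    damped_flat v k (smult (- v) p - smult (1 / k) ([:0, 0, 1:] * (p - pderiv p))) x) (at x)"
proof -
  have "((\<lambda>x. exp (- (v * x)) * flat_poly p (1 - x / k)) has_real_derivative
     exp (- (v * x)) * (- v) * flat_poly p (1 - x / k)
     + exp (- (v * x)) * (flat_poly ([:0, 0, 1:] * (p - pderiv p)) (1 - x / k) * (- (1 / k)))) (at x)"
  proof -
    have "((\<lambda>x. 1 - x / k) has_real_derivative - (1 / k)) (at x)"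
      using assms by (auto intro!: derivative_eq_intros)
    from DERIV_chain2[OF flat_poly_derivative this]
    have 1: "((\<lambda>x. flat_poly p (1 - x / k)) has_real_derivative
       flat_poly ([:0, 0, 1:] * (p - pderiv p)) (1 - x / k) * (- (1 / k))) (at x)" .
    have 2: "((\<lambda>x. exp (- (v * x))) has_real_derivative exp (- (v * x)) * (- v)) (at x)"
      by (auto intro!: derivative_eq_intros)
    from DERIV_mult[OF 2 1] show ?thesis by (simp add: algebra_simps)
  qed
  then show ?thesis unfolding damped_flat_def flat_poly_diff flat_poly_smult
    by (rule DERIV_cong) (simp add: algebra_simps)
qed

lemma damped_flat_eq_0: "0 < k \<Longrightarrow> k \<le> x \<Longrightarrow> damped_flat v k p x = 0"
  by (simp add: damped_flat_def flat_poly_def)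

lemma damped_flat_vanishes: 
  assumes "0 < k"
  shows "(damped_flat v k p \<longlongrightarrow> 0) at_top"
  using assms by (intro tendsto_eventually eventually_at_top_linorderI[of k]) (simp add: damped_flat_eq_0)

lemma damped_flat_continuous: 
  assumes "0 < k"
  shows "continuous_on A (damped_flat v k p)"
  using assms by (intro continuous_at_imp_continuous_on ballI DERIV_isCont[OF damped_flat_derivative]) auto

lemma damped_flat_Cc_infty:
  assumes k: "0 < k"
  shows "extend_to_infinity (damped_flat v k p) \<in> Cc_infty"
proof -
  let ?f = "extend_to_infinity (damped_flat v k p)"
  let ?T = "\<lambda>p. smult (- v) p - smult (1 / k) ([:0, 0, 1:] * (p - pderiv p))"
  note hl = half_line_fun_extend[OF damped_flat_continuous damped_flat_vanishes, OF k k]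
  have "(damped_flat v k ((?T ^^ n) p) has_real_derivative damped_flat v k ((?T ^^ Suc n) p) x) (at x within {0..})"
    for n x
    using has_field_derivative_at_within[OF damped_flat_derivative[of k v "(?T ^^ n) p" x]] k by simp
  then have "\<exists>D :: nat \<Rightarrow> real \<Rightarrow> real. (\<forall>x\<ge>0. D 0 x = half_line_fun ?f x) \<and>
      (\<forall>n. \<forall>x\<ge>0. (D n has_real_derivative D (Suc n) x) (at x within {0..}))"
    by (intro exI[of _ "\<lambda>n. damped_flat v k ((?T ^^ n) p)"]) (simp add: hl)
  moreover have "\<exists>K. \<forall>x\<ge>K. half_line_fun ?f x = 0"
    using k by (intro exI[of _ k]) (auto simp: hl damped_flat_eq_0)
  ultimately show ?thesis
    by (simp add: Cc_infty_def extend_to_infinity_in_C0 damped_flat_continuous damped_flat_vanishes k)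
qed

lemma flat_poly_cutoff_derivative_bound:
  "\<bar>flat_poly ([:0, 0, 1:] * ([:exp 1:] - pderiv [:exp 1:])) y\<bar> \<le> 6"
proof (cases "y \<le> 0")
  case False
  then have "(1 / y)\<^sup>2 * exp (- (1 * (1 / y))) \<le> 2 / 1\<^sup>2" by (intro power2_times_exp_le) auto
  then have "exp 1 * ((1 / y)\<^sup>2 * exp (- (1 / y))) \<le> 3 * 2"
    using exp_le by (intro mult_mono) auto
  then show ?thesis using False by (simp add: flat_poly_def pderiv_pCons power2_eq_square abs_mult mult_ac)
qed (simp add: flat_poly_def)

lemma flat_poly_cutoff_near_1:
  assumes "0 < k" "0 \<le> x"
  shows "\<bar>flat_poly [:exp 1:] (1 - x / k) - 1\<bar> \<le> 6 * (x / k)"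
proof -
  have "norm (flat_poly [:exp 1:] (1 - x / k) - flat_poly [:exp 1:] 1) \<le> 6 * norm ((1 - x / k) - 1)"
    by (rule field_differentiable_bound[where S = UNIV, OF _ flat_poly_derivative])
       (use flat_poly_cutoff_derivative_bound in auto)
  moreover have "flat_poly [:exp 1:] 1 = 1" by (simp add: flat_poly_def exp_minus)
  ultimately show ?thesis using assms by simp
qed

text \<open>
  Both \<open>\<xi>\<close> (by the mean value theorem) and \<open>2\<close> bound the increment relative to the weight, and
  \<open>min \<xi> 2 \<le> 3 (1 - exp (- \<xi>))\<close>. The right-hand side is chosen because its integral over \<open>\<xi>\<close> is the
  Laplace exponent at \<open>1\<close>.
\<close>

lemma increment_bound_exp_weight:
  fixes h h' :: "real \<Rightarrow> real"
  assumes deriv: "\<And>y. 0 \<le> y \<Longrightarrow> (h has_real_derivative h' y) (at y)"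
    and h: "\<And>y. 0 \<le> y \<Longrightarrow> \<bar>h y\<bar> \<le> e * exp (- (a * y))"
    and h': "\<And>y. 0 \<le> y \<Longrightarrow> \<bar>h' y\<bar> \<le> e * exp (- (a * y))"
    and e: "0 \<le> e" and a: "0 < a" and x: "0 \<le> x" and \<xi>: "0 < \<xi>"
  shows "\<bar>h (x + \<xi>) - h x\<bar> \<le> e * exp (- (a * x)) * (3 * (1 - exp (- \<xi>)))"
proof -
  let ?c = "e * exp (- (a * x))"
  have mono: "e * exp (- (a * y)) \<le> ?c" if "x \<le> y" for y
    using that e a by (intro mult_left_mono) auto
  have 1: "\<bar>h (x + \<xi>) - h x\<bar> \<le> ?c * \<xi>"
  proof -
    have "norm (h (x + \<xi>) - h x) \<le> ?c * norm ((x + \<xi>) - x)"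
    proof (rule field_differentiable_bound[where S = "{x..}"])
      show "(h has_real_derivative h' y) (at y within {x..})" if "y \<in> {x..}" for y
        using that x by (intro has_field_derivative_at_within[OF deriv]) auto
      show "norm (h' y) \<le> ?c" if "y \<in> {x..}" for y
        using h'[of y] mono[of y] that x by auto
    qed (use \<xi> in auto)
    then show ?thesis using \<xi> by simp
  qed
  have 2: "\<bar>h (x + \<xi>) - h x\<bar> \<le> ?c * 2"
    using h[of "x + \<xi>"] h[of x] mono[of "x + \<xi>"] x \<xi> by auto
  have "\<bar>h (x + \<xi>) - h x\<bar> \<le> ?c * min \<xi> 2" using 1 2 by (auto simp: min_def)
  also have "\<dots> \<le> ?c * (3 * (1 - exp (- \<xi>)))"
  proof (intro mult_left_mono)
    have "exp (- \<xi>) \<le> 1 / (1 + \<xi>)"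
      using exp_ge_add_one_self[of \<xi>] \<xi> by (simp add: exp_minus field_simps)
    then have "3 * (\<xi> / (1 + \<xi>)) \<le> 3 * (1 - exp (- \<xi>))" using \<xi> by (simp add: field_simps)
    moreover have "min \<xi> 2 \<le> 3 * (\<xi> / (1 + \<xi>))"
    proof (cases "\<xi> \<le> 2")
      case True
      then have "\<xi> * \<xi> \<le> 2 * \<xi>" using \<xi> by (intro mult_right_mono) auto
      then show ?thesis using True \<xi> by (simp add: field_simps)
    qed (use \<xi> in \<open>simp add: field_simps\<close>)
    ultimately show "min \<xi> 2 \<le> 3 * (1 - exp (- \<xi>))" by linarith
  qed (use e in auto)
  finally show ?thesis .
qed

text \<open>
  The generator has unbounded coefficients, so a uniform bound on \<open>h\<close> and \<open>h'\<close> does not control it. An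
  exponentially weighted bound does, as \<open>x exp (- a x)\<close> stays below \<open>1 / a\<close>.
\<close>

lemma generator_expression_bound:
  fixes h h' :: "real \<Rightarrow> real"
  assumes deriv: "\<And>y. 0 \<le> y \<Longrightarrow> (h has_real_derivative h' y) (at y)"
    and h: "\<And>y. 0 \<le> y \<Longrightarrow> \<bar>h y\<bar> \<le> e * exp (- (a * y))"
    and h': "\<And>y. 0 \<le> y \<Longrightarrow> \<bar>h' y\<bar> \<le> e * exp (- (a * y))"
    and e: "0 \<le> e" and a: "0 < a" and x: "0 \<le> x"
    and meas [measurable]: "h \<in> borel_measurable borel"
  shows "integrable mu_tilde (\<lambda>\<xi>. h (x + \<xi>) - h x)"
    and "\<bar>- x * h' x + x * (\<integral>\<xi>. (h (x + \<xi>) - h x) \<partial>mu_tilde)\<bar> \<le> 4 * e / a"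
proof -
  let ?c = "e * exp (- (a * x))"
  have int: "integrable mu_tilde (\<lambda>\<xi>. ?c * (3 * (1 - exp (- \<xi>))))"
    using integrable_Laplace_exponent(1)[of 1] by (intro integrable_mult_right) auto
  have ae: "AE \<xi> in mu_tilde. norm (h (x + \<xi>) - h x) \<le> ?c * (3 * (1 - exp (- \<xi>)))"
    using AE_mu_tilde_pos
    by eventually_elim (use increment_bound_exp_weight[OF deriv h h' e a x] in auto)
  show 1: "integrable mu_tilde (\<lambda>\<xi>. h (x + \<xi>) - h x)"
    by (rule Bochner_Integration.integrable_bound[OF int])
       (use ae in \<open>auto elim!: eventually_mono\<close>)
  have "\<bar>\<integral>\<xi>. (h (x + \<xi>) - h x) \<partial>mu_tilde\<bar> \<le> (\<integral>\<xi>. ?c * (3 * (1 - exp (- \<xi>))) \<partial>mu_tilde)"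
  proof (rule order_trans)
    show "\<bar>\<integral>\<xi>. (h (x + \<xi>) - h x) \<partial>mu_tilde\<bar> \<le> (\<integral>\<xi>. \<bar>h (x + \<xi>) - h x\<bar> \<partial>mu_tilde)"
      using integral_norm_bound[of mu_tilde "\<lambda>\<xi>. h (x + \<xi>) - h x"] by simp
    show "(\<integral>\<xi>. \<bar>h (x + \<xi>) - h x\<bar> \<partial>mu_tilde) \<le> (\<integral>\<xi>. ?c * (3 * (1 - exp (- \<xi>))) \<partial>mu_tilde)"
      using 1 int ae by (intro integral_mono_AE) auto
  qed
  also have "\<dots> = ?c * 3" using integrable_Laplace_exponent(2)[of 1] by (simp only: integral_mult_right_zero) simp
  finally have I: "\<bar>\<integral>\<xi>. (h (x + \<xi>) - h x) \<partial>mu_tilde\<bar> \<le> ?c * 3" .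
  have "\<bar>- x * h' x + x * (\<integral>\<xi>. (h (x + \<xi>) - h x) \<partial>mu_tilde)\<bar>
      \<le> x * \<bar>h' x\<bar> + x * \<bar>\<integral>\<xi>. (h (x + \<xi>) - h x) \<partial>mu_tilde\<bar>"
    using abs_triangle_ineq[of "- x * h' x" "x * (\<integral>\<xi>. (h (x + \<xi>) - h x) \<partial>mu_tilde)"] x
    by (simp add: abs_mult)
  also have "\<dots> \<le> x * ?c + x * (?c * 3)"
    using h'[OF x] I x by (intro add_mono mult_left_mono) auto
  also have "\<dots> = 4 * e * (x * exp (- (a * x)))" by simp
  also have "\<dots> \<le> 4 * e * (1 / a)"
    using times_exp_le[OF a x] e by (intro mult_left_mono) auto
  finally show "\<bar>- x * h' x + x * (\<integral>\<xi>. (h (x + \<xi>) - h x) \<partial>mu_tilde)\<bar> \<le> 4 * e / a" by simp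
qed

definition exp_fun :: "real \<Rightarrow> (ennreal \<Rightarrow>\<^sub>C real)" where
  "exp_fun v = extend_to_infinity (\<lambda>x. exp (- (v * x)))"

text \<open>
  The image of \<^term>\<open>exp_fun v\<close> under the generator: the drift contributes \<open>v x exp (- v x)\<close>, the
  jumps contribute \<open>- sqrt v\<close> times \<open>x exp (- v x)\<close>.
\<close>

definition gen_exp_fun :: "real \<Rightarrow> (ennreal \<Rightarrow>\<^sub>C real)" where
  "gen_exp_fun v = extend_to_infinity (\<lambda>x. x * exp (- (v * x)) * (v - sqrt v))"

lemma exp_decay: "0 < v \<Longrightarrow> ((\<lambda>x::real. exp (- (v * x))) \<longlongrightarrow> 0) at_top"
  using filterlim_compose[OF poly_times_exp_decay[of "[:1:]"] filterlim_tendsto_pos_mult_at_top[OF tendsto_const _ filterlim_ident, of v]]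
  by simp

lemma gen_exp_decay:
  assumes "0 < v"
  shows "((\<lambda>x::real. x * exp (- (v * x)) * (v - sqrt v)) \<longlongrightarrow> 0) at_top"
proof -
  have "((\<lambda>x. poly [:0, 1:] (v * x) * exp (- (v * x))) \<longlongrightarrow> 0) at_top"
    using filterlim_compose[OF poly_times_exp_decay[of "[:0, 1:]"]
        filterlim_tendsto_pos_mult_at_top[OF tendsto_const _ filterlim_ident, of v]] assms by simp
  from tendsto_mult_right[OF this, of "(v - sqrt v) / v"] show ?thesis
    using assms by (simp add: mult.assoc)
qed

lemma exp_fun_C0: "0 < v \<Longrightarrow> exp_fun v \<in> C0"
  and gen_exp_fun_C0: "0 < v \<Longrightarrow> gen_exp_fun v \<in> C0"
  unfolding exp_fun_def gen_exp_fun_def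
  by (intro extend_to_infinity_in_C0 exp_decay gen_exp_decay continuous_intros; assumption)+

lemma half_line_exp_fun: "0 < v \<Longrightarrow> 0 \<le> x \<Longrightarrow> half_line_fun (exp_fun v) x = exp (- (v * x))"
  unfolding exp_fun_def
  by (rule half_line_fun_extend) (auto intro!: exp_decay continuous_intros)

lemma half_line_gen_exp_fun:
  "0 < v \<Longrightarrow> 0 \<le> x \<Longrightarrow> half_line_fun (gen_exp_fun v) x = x * exp (- (v * x)) * (v - sqrt v)"
  unfolding gen_exp_fun_def
  by (rule half_line_fun_extend) (auto intro!: gen_exp_decay continuous_intros)

text \<open>
  The cutoff differs from \<open>1\<close> by \<open>O(x / k)\<close> and its derivative is \<open>O(1 / k)\<close>. Giving up half of the
  exponential rate absorbs the factor \<open>x\<close>, so the error made by the cutoff is \<open>O(1 / k)\<close> together with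
  its derivative in the norm with weight \<open>exp (- v x / 2)\<close>, and the generator sees only this norm.
\<close>

lemma A_tilde_cutoff_bound:
  assumes v: "0 < v" and k: "0 < k" and x: "0 \<le> x"
  defines "h \<equiv> \<lambda>x. damped_flat v k [:exp 1:] x - exp (- (v * x))"
  shows "\<bar>h x\<bar> \<le> (12 / v + 18) / k"
    and "\<bar>A_tilde (extend_to_infinity (damped_flat v k [:exp 1:])) x - x * exp (- (v * x)) * (v - sqrt v)\<bar>
      \<le> 8 / v * ((12 / v + 18) / k)"
proof -
  let ?e = "(12 / v + 18) / k"
  let ?p = "[:exp 1:] :: real poly"
  let ?f = "damped_flat v k ?p"
  let ?Tp = "smult (- v) ?p - smult (1 / k) ([:0, 0, 1:] * (?p - pderiv ?p))"
  define f' where "f' = damped_flat v k ?Tp"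
  define h' where "h' y = f' y + v * exp (- (v * y))" for y
  note hl = half_line_fun_extend[OF damped_flat_continuous damped_flat_vanishes, OF k k]
  have f': "(?f has_real_derivative f' y) (at y)" for y
    unfolding f'_def using k by (intro damped_flat_derivative) auto
  have h': "(h has_real_derivative h' y) (at y)" for y
    unfolding h_def h'_def by (auto intro!: derivative_eq_intros f')
  have split: "exp (- (v * y)) = exp (- (v / 2 * y)) * exp (- (v / 2 * y))" for y
    by (simp add: exp_add[symmetric])
  have weight: "y * exp (- (v * y)) \<le> 2 / v * exp (- (v / 2 * y))" if "0 \<le> y" for y
  proof -
    have "y * exp (- (v / 2 * y)) \<le> 1 / (v / 2)"
      using v that by (intro times_exp_le) auto
    then have "y * exp (- (v / 2 * y)) * exp (- (v / 2 * y)) \<le> 2 / v * exp (- (v / 2 * y))"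
      by (intro mult_right_mono) auto
    then show ?thesis by (simp add: split mult.assoc)
  qed
  have weight0: "exp (- (v * y)) \<le> exp (- (v / 2 * y))" if "0 \<le> y" for y
    using v that by simp
  have hb: "\<bar>h y\<bar> \<le> ?e * exp (- (v / 2 * y))" if y: "0 \<le> y" for y
  proof -
    have "h y = exp (- (v * y)) * (flat_poly ?p (1 - y / k) - 1)"
      by (simp add: h_def damped_flat_def algebra_simps)
    then have "\<bar>h y\<bar> = exp (- (v * y)) * \<bar>flat_poly ?p (1 - y / k) - 1\<bar>" by (simp add: abs_mult)
    also have "\<dots> \<le> exp (- (v * y)) * (6 * (y / k))"
      using flat_poly_cutoff_near_1[OF k y] by (intro mult_left_mono) auto
    also have "\<dots> = 6 / k * (y * exp (- (v * y)))" by simp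
    also have "\<dots> \<le> 6 / k * (2 / v * exp (- (v / 2 * y)))"
      using weight[OF y] k by (intro mult_left_mono) auto
    also have "\<dots> = (12 / v / k) * exp (- (v / 2 * y))" by simp
    also have "\<dots> \<le> ?e * exp (- (v / 2 * y))"
      using k by (intro mult_right_mono) (auto simp: field_simps)
    finally show ?thesis .
  qed
  have hb': "\<bar>h' y\<bar> \<le> ?e * exp (- (v / 2 * y))" if y: "0 \<le> y" for y
  proof -
    let ?q = "flat_poly ([:0, 0, 1:] * (?p - pderiv ?p)) (1 - y / k)"
    have "h' y = - (exp (- (v * y)) * (v * (flat_poly ?p (1 - y / k) - 1) + ?q / k))"
      unfolding h'_def f'_def damped_flat_def flat_poly_diff flat_poly_smult by (simp add: algebra_simps)
    then have "\<bar>h' y\<bar> = exp (- (v * y)) * \<bar>v * (flat_poly ?p (1 - y / k) - 1) + ?q / k\<bar>"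
      by (simp add: abs_mult)
    also have "\<dots> \<le> exp (- (v * y)) * (v * (6 * (y / k)) + 6 / k)"
    proof (intro mult_left_mono order_trans[OF abs_triangle_ineq] add_mono)
      show "\<bar>v * (flat_poly ?p (1 - y / k) - 1)\<bar> \<le> v * (6 * (y / k))"
        using mult_left_mono[OF flat_poly_cutoff_near_1[OF k y], of v] v by (simp add: abs_mult)
      show "\<bar>?q / k\<bar> \<le> 6 / k"
        using flat_poly_cutoff_derivative_bound[of "1 - y / k"] k
        by (simp only: abs_divide abs_of_pos) (rule divide_right_mono, auto)
    qed auto
    also have "\<dots> = 6 * v / k * (y * exp (- (v * y))) + 6 / k * exp (- (v * y))" by (simp add: algebra_simps)
    also have "\<dots> \<le> 6 * v / k * (2 / v * exp (- (v / 2 * y))) + 6 / k * exp (- (v / 2 * y))"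
      using weight[OF y] weight0[OF y] k v by (intro mult_left_mono add_mono) auto
    also have "\<dots> = (18 / k) * exp (- (v / 2 * y))" using v k by (simp add: field_simps)
    also have "\<dots> \<le> ?e * exp (- (v / 2 * y))"
      using v k by (intro mult_right_mono) (auto simp: field_simps)
    finally show ?thesis .
  qed
  have e: "0 \<le> ?e" using v k by simp
  have v2: "0 < v / 2" using v by simp
  have "?e * exp (- (v / 2 * x)) \<le> ?e * 1" using e v x by (intro mult_left_mono) auto
  then show "\<bar>h x\<bar> \<le> ?e" using hb[OF x] by linarith
  have meas [measurable]: "h \<in> borel_measurable borel"
    using h' by (intro borel_measurable_continuous_onI continuous_at_imp_continuous_on)
      (auto intro: DERIV_isCont)
  note A = generator_expression_bound[OF h' hb hb' e v2 x meas]
  have lap: "integrable mu_tilde (\<lambda>\<xi>. exp (- (v * (x + \<xi>))) - exp (- (v * x)))"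
    "(\<integral>\<xi>. (exp (- (v * (x + \<xi>))) - exp (- (v * x))) \<partial>mu_tilde) = - exp (- (v * x)) * sqrt v"
  proof -
    have eq: "(\<lambda>\<xi>. exp (- (v * (x + \<xi>))) - exp (- (v * x))) = (\<lambda>\<xi>. - exp (- (v * x)) * (1 - exp (- (v * \<xi>))))"
    proof
      fix \<xi>
      have "exp (- (v * (x + \<xi>))) = exp (- (v * x)) * exp (- (v * \<xi>))"
        by (simp add: exp_add[symmetric] algebra_simps)
      then show "exp (- (v * (x + \<xi>))) - exp (- (v * x)) = - exp (- (v * x)) * (1 - exp (- (v * \<xi>)))"
        by (simp add: right_diff_distrib)
    qed
    show "integrable mu_tilde (\<lambda>\<xi>. exp (- (v * (x + \<xi>))) - exp (- (v * x)))"
      unfolding eq using integrable_Laplace_exponent(1)[OF v] by (rule integrable_mult_right)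
    show "(\<integral>\<xi>. (exp (- (v * (x + \<xi>))) - exp (- (v * x))) \<partial>mu_tilde) = - exp (- (v * x)) * sqrt v"
      unfolding eq integrable_Laplace_exponent(2)[OF v, symmetric] by (rule integral_mult_right_zero)
  qed
  have "(\<integral>\<xi>. (half_line_fun (extend_to_infinity ?f) (x + \<xi>) - half_line_fun (extend_to_infinity ?f) x) \<partial>mu_tilde)
      = (\<integral>\<xi>. (h (x + \<xi>) - h x) + (exp (- (v * (x + \<xi>))) - exp (- (v * x))) \<partial>mu_tilde)"
  proof (rule integral_cong_AE)
    show "AE \<xi> in mu_tilde. half_line_fun (extend_to_infinity ?f) (x + \<xi>) - half_line_fun (extend_to_infinity ?f) x
       = (h (x + \<xi>) - h x) + (exp (- (v * (x + \<xi>))) - exp (- (v * x)))"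
      using AE_mu_tilde_pos by eventually_elim (use x in \<open>simp add: hl h_def\<close>)
  qed measurable
  also have "\<dots> = (\<integral>\<xi>. (h (x + \<xi>) - h x) \<partial>mu_tilde) - exp (- (v * x)) * sqrt v"
    using A(1) lap by (subst Bochner_Integration.integral_add) auto
  finally have int: "(\<integral>\<xi>. (half_line_fun (extend_to_infinity ?f) (x + \<xi>) - half_line_fun (extend_to_infinity ?f) x) \<partial>mu_tilde)
      = (\<integral>\<xi>. (h (x + \<xi>) - h x) \<partial>mu_tilde) - exp (- (v * x)) * sqrt v" .
  have "vector_derivative (half_line_fun (extend_to_infinity ?f)) (at x within {0..}) = f' x"
  proof (rule vector_derivative_within)
    show "at x within {0..} \<noteq> bot" 
      using at_le[of "{x<..}" "{0..}" x] x trivial_limit_at_right_real[of x] by (fastforce simp: bot_unique)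
    have "(?f has_vector_derivative f' x) (at x within {0..})"
      using has_field_derivative_at_within[OF f'[of x]] by (simp add: has_real_derivative_iff_has_vector_derivative)
    then show "(half_line_fun (extend_to_infinity ?f) has_vector_derivative f' x) (at x within {0..})"
      by (rule has_vector_derivative_transform[rotated 2]) (use x in \<open>auto simp: hl\<close>)
  qed
  then have "A_tilde (extend_to_infinity ?f) x - x * exp (- (v * x)) * (v - sqrt v)
      = - x * h' x + x * (\<integral>\<xi>. (h (x + \<xi>) - h x) \<partial>mu_tilde)"
    unfolding A_tilde_def int h'_def by (simp add: algebra_simps)
  then show "\<bar>A_tilde (extend_to_infinity ?f) x - x * exp (- (v * x)) * (v - sqrt v)\<bar> \<le> 8 / v * ?e"
    using A(2) v by (simp add: mult.commute)
qed

section \<open>Exponentials in the domain of the generator\<close>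

lemma
  assumes "feller_semigroup S"
  shows feller_semigroup_C0: "0 \<le> t \<Longrightarrow> f \<in> C0 \<Longrightarrow> S t f \<in> C0"
    and feller_semigroup_add: "0 \<le> t \<Longrightarrow> f \<in> C0 \<Longrightarrow> g \<in> C0 \<Longrightarrow> S t (f + g) = S t f + S t g"
    and feller_semigroup_scaleR: "0 \<le> t \<Longrightarrow> f \<in> C0 \<Longrightarrow> S t (c *\<^sub>R f) = c *\<^sub>R S t f"
    and feller_semigroup_norm: "0 \<le> t \<Longrightarrow> f \<in> C0 \<Longrightarrow> norm (S t f) \<le> norm f"
    and feller_semigroup_0: "f \<in> C0 \<Longrightarrow> S 0 f = f"
    and feller_semigroup_plus: "0 \<le> s \<Longrightarrow> 0 \<le> t \<Longrightarrow> f \<in> C0 \<Longrightarrow> S (s + t) f = S s (S t f)"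
    and feller_semigroup_tendsto: "f \<in> C0 \<Longrightarrow> ((\<lambda>t. S t f) \<longlongrightarrow> f) (at_right 0)"
  using assms by (simp_all add: feller_semigroup_def)

lemma norm_add_diff_le: "norm (a + b - c) \<le> norm a + norm b + norm c"
  for a b c :: "'a::real_normed_vector"
  using norm_triangle_ineq4[of "a + b" c] norm_triangle_ineq[of a b] by linarith

lemma feller_semigroup_diff:
  assumes "feller_semigroup S" "0 \<le> t" "f \<in> C0" "g \<in> C0"
  shows "S t (f - g) = S t f - S t g"
proof -
  have "S t (f + (- 1) *\<^sub>R g) = S t f + S t ((- 1) *\<^sub>R g)"
    using assms by (intro feller_semigroup_add[OF assms(1)] C0_scaleR)
  also have "S t ((- 1) *\<^sub>R g) = (- 1) *\<^sub>R S t g"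
    using assms by (intro feller_semigroup_scaleR[OF assms(1)])
  finally show ?thesis by simp
qed

lemma feller_semigroup_dist:
  assumes "feller_semigroup S" "0 \<le> t" "f \<in> C0" "g \<in> C0"
  shows "norm (S t f - S t g) \<le> norm (f - g)"
  using feller_semigroup_norm[OF assms(1,2) C0_diff[OF assms(3,4)]] feller_semigroup_diff[OF assms] by simp

lemma generator_C0:
  assumes "feller_semigroup S" "(f, g) \<in> generator S"
  shows "f \<in> C0" "g \<in> C0"
proof -
  show f: "f \<in> C0" using assms(2) by (simp add: generator_def)
  have "\<forall>\<^sub>F t in at_right 0. (S t f - f) /\<^sub>R t \<in> C0"
    unfolding eventually_at_filter
    using f by (intro always_eventually) (auto intro!: C0_scaleR C0_diff feller_semigroup_C0[OF assms(1)])
  then show "g \<in> C0"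
    by (rule C0_limit) (use assms(2) in \<open>auto simp: generator_def\<close>)
qed

text \<open>
  A quantitative form of the identity between \<open>S\<^sub>t f - f\<close> and the integral of \<open>S\<^sub>s g\<close> over
  \<open>s \<in> [0, t]\<close>. Telescoping over \<open>m\<close> steps of length \<open>t / m\<close> gives it with an error that vanishes as
  \<open>m\<close> grows, since \<open>(S\<^sub>\<delta> f - f) / \<delta>\<close> tends to \<open>g\<close>.
\<close>

lemma generator_increment_bound:
  assumes S: "feller_semigroup S" and fg: "(f, g) \<in> generator S" and t: "0 \<le> t"
    and osc: "\<And>s. 0 \<le> s \<Longrightarrow> s \<le> t \<Longrightarrow> norm (S s g - g) \<le> \<eta>"
  shows "norm (S t f - f - t *\<^sub>R g) \<le> t * \<eta>"
proof (cases "t = 0")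
  case True
  then show ?thesis using feller_semigroup_0[OF S generator_C0(1)[OF S fg]] by simp
next
  case False
  then have t: "0 < t" using t by simp
  note f = generator_C0(1)[OF S fg] and g = generator_C0(2)[OF S fg]
  define r where "r \<delta> = (S \<delta> f - f) /\<^sub>R \<delta> - g" for \<delta>
  have r_lim: "(r \<longlongrightarrow> 0) (at_right 0)"
    using fg by (auto simp: generator_def r_def[abs_def] LIM_zero_iff)
  have bound: "norm (S t f - f - t *\<^sub>R g) \<le> t * \<eta> + t * norm (r (t / real (Suc m)))" for m
  proof -
    define N where "N = Suc m"
    define \<delta> where "\<delta> = t / real N"
    have \<delta>: "0 < \<delta>" "real N * \<delta> = t" using t by (auto simp: \<delta>_def N_def)
    have step: "norm (S (real (Suc i) * \<delta>) f - S (real i * \<delta>) f - \<delta> *\<^sub>R g) \<le> \<delta> * \<eta> + \<delta> * norm (r \<delta>)"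
      if "i < N" for i
    proof -
      have i\<delta>: "0 \<le> real i * \<delta>" "real i * \<delta> \<le> t"
        using \<delta> that by (auto simp flip: \<delta>(2) intro!: mult_right_mono)
      have rC0: "r \<delta> \<in> C0" unfolding r_def
        using \<delta> f g by (intro C0_diff C0_scaleR feller_semigroup_C0[OF S]) auto
      have eq: "S \<delta> f = f + \<delta> *\<^sub>R (g + r \<delta>)" using \<delta> by (simp add: r_def)
      have "S (real (Suc i) * \<delta>) f = S (real i * \<delta>) (S \<delta> f)"
        using feller_semigroup_plus[OF S i\<delta>(1) _ f, of \<delta>] \<delta> by (simp add: algebra_simps)
      also have "\<dots> = S (real i * \<delta>) f + \<delta> *\<^sub>R (S (real i * \<delta>) g + S (real i * \<delta>) (r \<delta>))"
        unfolding eq using i\<delta>(1) f g rC0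
        by (simp add: feller_semigroup_add[OF S] feller_semigroup_scaleR[OF S] C0_add C0_scaleR)
      finally have "S (real (Suc i) * \<delta>) f - S (real i * \<delta>) f - \<delta> *\<^sub>R g
          = \<delta> *\<^sub>R (S (real i * \<delta>) g - g) + \<delta> *\<^sub>R S (real i * \<delta>) (r \<delta>)"
        by (simp add: algebra_simps)
      also have "norm \<dots> \<le> norm (\<delta> *\<^sub>R (S (real i * \<delta>) g - g)) + norm (\<delta> *\<^sub>R S (real i * \<delta>) (r \<delta>))"
        by (rule norm_triangle_ineq)
      also have "\<dots> \<le> \<delta> * \<eta> + \<delta> * norm (r \<delta>)"
        using \<delta>(1) osc[OF i\<delta>] feller_semigroup_norm[OF S i\<delta>(1) rC0] by (auto intro!: add_mono mult_left_mono)
      finally show ?thesis .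
    qed
    have "S t f - f - t *\<^sub>R g = (\<Sum>i<N. S (real (Suc i) * \<delta>) f - S (real i * \<delta>) f - \<delta> *\<^sub>R g)"
    proof -
      have "(\<Sum>i<N. S (real (Suc i) * \<delta>) f - S (real i * \<delta>) f) = S (real N * \<delta>) f - S (real 0 * \<delta>) f"
        by (rule sum_lessThan_telescope)
      then show ?thesis using \<delta> feller_semigroup_0[OF S f]
        by (simp add: sum_subtractf sum_constant_scaleR)
    qed
    also have "norm \<dots> \<le> (\<Sum>i<N. \<delta> * \<eta> + \<delta> * norm (r \<delta>))"
      by (rule sum_norm_le) (use step in auto)
    also have "\<dots> = t * \<eta> + t * norm (r \<delta>)"
      by (simp add: \<delta>(2)[symmetric] algebra_simps)
    finally show ?thesis by (simp add: \<delta>_def N_def)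
  qed
  have "filterlim (\<lambda>m. t / real (Suc m)) (at_right 0) sequentially"
    unfolding filterlim_at
    using t LIMSEQ_Suc[OF lim_const_over_n[of t]] by simp
  from filterlim_compose[OF r_lim this]
  have "(\<lambda>m. t * \<eta> + t * norm (r (t / real (Suc m)))) \<longlonglongrightarrow> t * \<eta> + t * norm (0 :: ennreal \<Rightarrow>\<^sub>C real)"
    by (intro tendsto_intros)
  then show ?thesis by (intro LIMSEQ_le_const[where a = "norm (S t f - f - t *\<^sub>R g)"]) (use bound in auto)
qed

text \<open>
  The previous bound is stable under limits in the graph norm. It is how the generator, known only on
  the core, is used on exponentials.
\<close>

lemma generator_closed_increment_bound:
  assumes S: "feller_semigroup S" and fg: "\<And>k. (f k, g k) \<in> generator S"
    and f_lim: "f \<longlonglongrightarrow> f0" and g_lim: "g \<longlonglongrightarrow> g0" and C0: "f0 \<in> C0" "g0 \<in> C0" and t: "0 \<le> t"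
    and osc: "\<And>s. 0 \<le> s \<Longrightarrow> s \<le> t \<Longrightarrow> norm (S s g0 - g0) \<le> \<eta>"
  shows "norm (S t f0 - f0 - t *\<^sub>R g0) \<le> t * \<eta>"
proof -
  have "norm (S t (f k) - f k - t *\<^sub>R g k) \<le> t * (\<eta> + 2 * norm (g k - g0))" for k
  proof (rule generator_increment_bound[OF S fg t])
    fix s assume s: "0 \<le> s" "s \<le> t"
    have "S s (g k) - g k = (S s (g k) - S s g0) + (S s g0 - g0) - (g k - g0)" by simp
    also have "norm \<dots> \<le> norm (S s (g k) - S s g0) + norm (S s g0 - g0) + norm (g k - g0)"
      by (rule norm_add_diff_le)
    also have "\<dots> \<le> norm (g k - g0) + \<eta> + norm (g k - g0)"
      using feller_semigroup_dist[OF S s(1) generator_C0(2)[OF S fg] C0(2)] osc[OF s] by (intro add_mono) auto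
    finally show "norm (S s (g k) - g k) \<le> \<eta> + 2 * norm (g k - g0)" by simp
  qed
  moreover have "(\<lambda>k. norm (S t (f k) - f k - t *\<^sub>R g k)) \<longlonglongrightarrow> norm (S t f0 - f0 - t *\<^sub>R g0)"
  proof (intro tendsto_intros f_lim g_lim)
    have "(\<lambda>k. norm (f k - f0)) \<longlonglongrightarrow> 0" using f_lim by (simp add: tendsto_norm_zero_iff LIM_zero_iff)
    then have "(\<lambda>k. norm (S t (f k) - S t f0)) \<longlonglongrightarrow> 0"
      by (rule Lim_null_comparison[rotated]) (use feller_semigroup_dist[OF S t generator_C0(1)[OF S fg] C0(1)] in auto)
    then show "(\<lambda>k. S t (f k)) \<longlonglongrightarrow> S t f0" by (simp add: tendsto_norm_zero_iff LIM_zero_iff)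
  qed
  moreover have "(\<lambda>k. t * (\<eta> + 2 * norm (g k - g0))) \<longlonglongrightarrow> t * (\<eta> + 2 * 0)"
    using g_lim by (intro tendsto_intros) (simp add: tendsto_norm_zero_iff LIM_zero_iff)
  ultimately show ?thesis by (intro LIMSEQ_le[where X = "\<lambda>k. norm (S t (f k) - f k - t *\<^sub>R g k)"]) auto
qed

text \<open>
  The cutoff exponentials lie in the core, where the generator is given by its formula, and that formula
  converges uniformly.
\<close>

lemma exp_fun_approximated:
  assumes S: "feller_semigroup S" and core: "is_core S Cc_infty"
    and gen: "\<forall>(f, g)\<in>generator S. f \<in> Cc_infty \<longrightarrow> (\<forall>x\<ge>0. half_line_fun g x = A_tilde f x)"
    and v: "0 < v"
  shows "\<exists>f g. (\<forall>k::nat. (f k, g k) \<in> generator S) \<and> f \<longlonglongrightarrow> exp_fun v \<and> g \<longlonglongrightarrow> gen_exp_fun v"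
proof -
  define f where "f k = extend_to_infinity (damped_flat v (real (Suc k)) [:exp 1:])" for k
  have fC: "f k \<in> Cc_infty" for k unfolding f_def by (rule damped_flat_Cc_infty) simp
  then have "\<exists>g. (f k, g) \<in> generator S" for k
    using core fC[of k] unfolding is_core_def by blast
  then obtain g where fg: "\<And>k. (f k, g k) \<in> generator S" by metis
  let ?c = "12 / v + 18"
  have f: "norm (f k - exp_fun v) \<le> ?c / real (Suc k)" for k
  proof (rule norm_C0_le)
    show "f k - exp_fun v \<in> C0"
      using generator_C0(1)[OF S fg] exp_fun_C0[OF v] by (rule C0_diff)
    show "\<bar>half_line_fun (f k - exp_fun v) x\<bar> \<le> ?c / real (Suc k)" if "0 \<le> x" for x
      using A_tilde_cutoff_bound(1)[OF v, of "real (Suc k)" x] that v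
      by (simp add: half_line_fun_diff half_line_exp_fun f_def half_line_fun_extend damped_flat_continuous damped_flat_vanishes)
  qed (use v in simp)
  have g: "norm (g k - gen_exp_fun v) \<le> 8 / v * (?c / real (Suc k))" for k
  proof (rule norm_C0_le)
    show "g k - gen_exp_fun v \<in> C0"
      using generator_C0(2)[OF S fg] gen_exp_fun_C0[OF v] by (rule C0_diff)
    show "\<bar>half_line_fun (g k - gen_exp_fun v) x\<bar> \<le> 8 / v * (?c / real (Suc k))" if x: "0 \<le> x" for x
    proof -
      have "half_line_fun (g k) x = A_tilde (f k) x" using gen fg fC x by blast
      then show ?thesis
        using A_tilde_cutoff_bound(2)[OF v _ x, of "real (Suc k)"] v x
        by (simp only: half_line_fun_diff half_line_gen_exp_fun f_def)
    qed
  qed (use v in simp)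
  have lim: "(\<lambda>k. ?c / real (Suc k)) \<longlonglongrightarrow> 0"
    using LIMSEQ_Suc[OF lim_const_over_n[of ?c]] by simp
  have "f \<longlonglongrightarrow> exp_fun v"
  proof -
    have "(\<lambda>k. f k - exp_fun v) \<longlonglongrightarrow> 0"
      by (rule Lim_null_comparison[OF _ lim]) (use f in auto)
    then show ?thesis by (simp add: LIM_zero_iff)
  qed
  moreover have "g \<longlonglongrightarrow> gen_exp_fun v"
  proof -
    have "(\<lambda>k. g k - gen_exp_fun v) \<longlonglongrightarrow> 0"
      by (rule Lim_null_comparison[OF _ tendsto_mult_right_zero[OF lim, of "8 / v"]]) (use g in auto)
    then show ?thesis by (simp add: LIM_zero_iff)
  qed
  ultimately show ?thesis using fg by blast
qed

section \<open>The Riccati flow of exponentials\<close>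

text \<open>
  The solution of \<open>c' = sqrt c - c\<close> that leaves \<open>0\<close> immediately. Substituting \<open>w = sqrt c\<close> gives the linear
  equation \<open>2 w' = 1 - w\<close>.
\<close>

definition riccati :: "real \<Rightarrow> real" where
  "riccati s = (1 - exp (- s / 2))\<^sup>2"

lemma riccati_pos: "0 < s \<Longrightarrow> 0 < riccati s"
  by (simp add: riccati_def)

lemma riccati_mono: "0 \<le> s \<Longrightarrow> s \<le> t \<Longrightarrow> riccati s \<le> riccati t"
  unfolding riccati_def by (intro power_mono) auto

text \<open>
  As this is \<open>o(s)\<close>, the process cannot jump to infinity.
\<close>

lemma riccati_le: 
  assumes "0 \<le> s"
  shows "riccati s \<le> s\<^sup>2 / 4"
proof -
  have "riccati s \<le> (s / 2)\<^sup>2"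
    unfolding riccati_def using exp_ge_add_one_self[of "- s / 2"] assms by (intro power_mono) auto
  then show ?thesis by (simp add: power_divide)
qed

lemma riccati_tendsto_0: "(riccati \<longlongrightarrow> 0) (at_right 0)"
proof -
  have "isCont riccati 0" unfolding riccati_def[abs_def] by (intro continuous_intros) auto
  then have "(riccati \<longlongrightarrow> riccati 0) (at 0)" by (simp add: isCont_def)
  then show ?thesis by (simp add: riccati_def filterlim_at_split)
qed

lemma riccati_derivative:
  assumes "0 \<le> s"
  shows "(riccati has_real_derivative sqrt (riccati s) - riccati s) (at s)"
proof -
  have "sqrt (riccati s) = 1 - exp (- s / 2)" using assms by (simp add: riccati_def)
  moreover have "(riccati has_real_derivative (1 - exp (- s / 2)) * exp (- s / 2)) (at s)"
    unfolding riccati_def[abs_def] by (auto intro!: derivative_eq_intros)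
  moreover have "(1 - exp (- s / 2)) * exp (- s / 2) = (1 - exp (- s / 2)) - riccati s"
    by (simp add: riccati_def power2_eq_square algebra_simps)
  ultimately show ?thesis by simp
qed

lemma gen_exp_fun_dist:
  assumes a: "0 < a" "a \<le> v" "a \<le> w"
  shows "norm (gen_exp_fun v - gen_exp_fun w)
    \<le> \<bar>v - w\<bar> * (2 / a\<^sup>2) * \<bar>v - sqrt v\<bar> + \<bar>(v - sqrt v) - (w - sqrt w)\<bar> / a"
proof (rule norm_C0_le)
  have v: "0 < v" and w: "0 < w" using a by auto
  show "gen_exp_fun v - gen_exp_fun w \<in> C0" using v w by (intro C0_diff gen_exp_fun_C0)
  show "0 \<le> \<bar>v - w\<bar> * (2 / a\<^sup>2) * \<bar>v - sqrt v\<bar> + \<bar>(v - sqrt v) - (w - sqrt w)\<bar> / a" using a by simp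
  fix x :: real assume x: "0 \<le> x"
  have exp_dist: "\<bar>exp (- (v * x)) - exp (- (w * x))\<bar> \<le> x * exp (- (a * x)) * \<bar>v - w\<bar>"
  proof -
    have "norm ((\<lambda>u. exp (- (u * x))) v - (\<lambda>u. exp (- (u * x))) w) \<le> x * exp (- (a * x)) * norm (v - w)"
    proof (rule field_differentiable_bound[where S = "{a..}" and f' = "\<lambda>u. exp (- (u * x)) * (- x)"])
      show "((\<lambda>u. exp (- (u * x))) has_real_derivative exp (- (u * x)) * (- x)) (at u within {a..})" for u
        by (auto intro!: derivative_eq_intros)
      show "norm (exp (- (u * x)) * (- x)) \<le> x * exp (- (a * x))" if "u \<in> {a..}" for u
        using that x by (auto simp: abs_mult mult.commute intro!: mult_left_mono mult_right_mono)
    qed (use a in auto)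
    then show ?thesis by simp
  qed
  have "half_line_fun (gen_exp_fun v - gen_exp_fun w) x
     = x * (exp (- (v * x)) - exp (- (w * x))) * (v - sqrt v) + x * exp (- (w * x)) * ((v - sqrt v) - (w - sqrt w))"
    using v w x by (simp add: half_line_fun_diff half_line_gen_exp_fun algebra_simps)
  also have "\<bar>\<dots>\<bar> \<le> x * \<bar>exp (- (v * x)) - exp (- (w * x))\<bar> * \<bar>v - sqrt v\<bar>
      + x * exp (- (w * x)) * \<bar>(v - sqrt v) - (w - sqrt w)\<bar>"
    by (rule order_trans[OF abs_triangle_ineq]) (use x in \<open>simp add: abs_mult\<close>)
  also have "\<dots> \<le> \<bar>v - w\<bar> * (2 / a\<^sup>2) * \<bar>v - sqrt v\<bar> + \<bar>(v - sqrt v) - (w - sqrt w)\<bar> / a"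
  proof (rule add_mono)
    have "x * \<bar>exp (- (v * x)) - exp (- (w * x))\<bar> \<le> x * (x * exp (- (a * x)) * \<bar>v - w\<bar>)"
      using exp_dist x by (intro mult_left_mono)
    also have "\<dots> = (x\<^sup>2 * exp (- (a * x))) * \<bar>v - w\<bar>" by (simp add: power2_eq_square)
    also have "\<dots> \<le> (2 / a\<^sup>2) * \<bar>v - w\<bar>"
      using power2_times_exp_le[OF a(1) x] by (intro mult_right_mono) auto
    finally show "x * \<bar>exp (- (v * x)) - exp (- (w * x))\<bar> * \<bar>v - sqrt v\<bar> \<le> \<bar>v - w\<bar> * (2 / a\<^sup>2) * \<bar>v - sqrt v\<bar>"
      by (intro mult_right_mono) (auto simp: mult.commute)
    have "x * exp (- (w * x)) \<le> x * exp (- (a * x))"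
      using a x by (intro mult_left_mono) (auto intro!: mult_right_mono)
    also have "\<dots> \<le> 1 / a" by (rule times_exp_le[OF a(1) x])
    finally have "x * exp (- (w * x)) * \<bar>(v - sqrt v) - (w - sqrt w)\<bar> \<le> 1 / a * \<bar>(v - sqrt v) - (w - sqrt w)\<bar>"
      by (intro mult_right_mono) auto
    then show "x * exp (- (w * x)) * \<bar>(v - sqrt v) - (w - sqrt w)\<bar> \<le> \<bar>(v - sqrt v) - (w - sqrt w)\<bar> / a" by simp
  qed
  finally show "\<bar>half_line_fun (gen_exp_fun v - gen_exp_fun w) x\<bar>
    \<le> \<bar>v - w\<bar> * (2 / a\<^sup>2) * \<bar>v - sqrt v\<bar> + \<bar>(v - sqrt v) - (w - sqrt w)\<bar> / a" .
qed

lemma gen_exp_fun_continuous: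
  assumes "0 < v"
  shows "isCont gen_exp_fun v"
proof -
  let ?b = "\<lambda>w. \<bar>w - v\<bar> * (2 / (v / 2)\<^sup>2) * \<bar>w - sqrt w\<bar> + \<bar>(w - sqrt w) - (v - sqrt v)\<bar> / (v / 2)"
  have "(?b \<longlongrightarrow> ?b v) (at v)" using assms by (intro tendsto_intros) auto
  then have lim: "(?b \<longlongrightarrow> 0) (at v)" by simp
  have "eventually (\<lambda>w. v / 2 \<le> w) (at v)"
    using eventually_at_in_open'[of "{v/2<..}" v] assms by (auto elim!: eventually_mono)
  then have "eventually (\<lambda>w. norm (gen_exp_fun w - gen_exp_fun v) \<le> ?b w) (at v)"
    by eventually_elim (rule gen_exp_fun_dist, use assms in auto)
  from Lim_null_comparison[OF this lim] show ?thesis by (simp add: isCont_def LIM_zero_iff)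
qed

text \<open>
  The parameter derivative of \<open>exp_fun (riccati s)\<close> is \<open>gen_exp_fun (riccati s)\<close>, by the Riccati equation,
  so this is the mean value inequality, applied at each point of the state space.
\<close>

lemma exp_flow_increment:
  assumes ab: "0 < a" "a \<le> b"
    and \<eta>: "\<And>s. a \<le> s \<Longrightarrow> s \<le> b \<Longrightarrow> norm (gen_exp_fun (riccati s) - g) \<le> \<eta>"
  shows "norm (exp_fun (riccati b) - exp_fun (riccati a) - (b - a) *\<^sub>R g) \<le> (b - a) * \<eta>"
proof -
  have pos: "0 < riccati s" if "a \<le> s" for s using that ab by (intro riccati_pos) auto
  have \<eta>0: "0 \<le> \<eta>" using \<eta>[of a] ab norm_ge_zero order_trans by blast
  have "norm (apply_bcontfun (exp_fun (riccati b) - exp_fun (riccati a) - (b - a) *\<^sub>R g) x) \<le> (b - a) * \<eta>" for x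
  proof -
    have "((\<lambda>s. apply_bcontfun (exp_fun (riccati s)) x - s * apply_bcontfun g x) has_real_derivative
        apply_bcontfun (gen_exp_fun (riccati s) - g) x) (at s within {a..b})" if s: "s \<in> {a..b}" for s
    proof (cases x)
      case (real r)
      have "((\<lambda>s. exp (- (riccati s * r)) - s * apply_bcontfun g x) has_real_derivative
         exp (- (riccati s * r)) * (- ((sqrt (riccati s) - riccati s) * r)) - apply_bcontfun g x) (at s within {a..b})"
      proof -
        have "(riccati has_real_derivative sqrt (riccati s) - riccati s) (at s within {a..b})"
          using s ab by (intro has_field_derivative_at_within[OF riccati_derivative]) auto
        then show ?thesis by (auto intro!: derivative_eq_intros)
      qed
      moreover have "apply_bcontfun (gen_exp_fun (riccati s)) x
          = exp (- (riccati s * r)) * (- ((sqrt (riccati s) - riccati s) * r))"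
        using half_line_gen_exp_fun[OF pos, of s r] s real
        by (simp add: half_line_fun_def algebra_simps)
      ultimately have "((\<lambda>s. exp (- (riccati s * r)) - s * apply_bcontfun g x) has_real_derivative
         apply_bcontfun (gen_exp_fun (riccati s) - g) x) (at s within {a..b})"
        by simp
      then show ?thesis
      proof (rule has_field_derivative_transform_within[OF _ zero_less_one s])
        fix s' assume "s' \<in> {a..b}"
        then show "exp (- (riccati s' * r)) - s' * apply_bcontfun g x
            = apply_bcontfun (exp_fun (riccati s')) x - s' * apply_bcontfun g x"
          using half_line_exp_fun[OF pos, of s' r] real by (simp add: half_line_fun_def)
      qed
    next
      case top
      have "((\<lambda>s. - (s * apply_bcontfun g x)) has_real_derivative
         apply_bcontfun (gen_exp_fun (riccati s) - g) x) (at s within {a..b})"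
        using gen_exp_fun_C0[OF pos, of s] s top
        by (auto intro!: derivative_eq_intros simp: C0_def)
      then show ?thesis
      proof (rule has_field_derivative_transform_within[OF _ zero_less_one s])
        fix s' assume "s' \<in> {a..b}"
        then show "- (s' * apply_bcontfun g x)
            = apply_bcontfun (exp_fun (riccati s')) x - s' * apply_bcontfun g x"
          using exp_fun_C0[OF pos, of s'] top by (simp add: C0_def)
      qed
    qed
    moreover have "norm (apply_bcontfun (gen_exp_fun (riccati s) - g) x) \<le> \<eta>" if "s \<in> {a..b}" for s
      using \<eta>[of s] that norm_bounded[of "gen_exp_fun (riccati s) - g" x] by auto
    ultimately have "norm ((apply_bcontfun (exp_fun (riccati b)) x - b * apply_bcontfun g x)
        - (apply_bcontfun (exp_fun (riccati a)) x - a * apply_bcontfun g x)) \<le> \<eta> * norm (b - a)"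
      by (rule field_differentiable_bound[where S = "{a..b}", rotated]) (use ab in auto)
    then show ?thesis using ab by (simp add: algebra_simps)
  qed
  then show ?thesis by (rule norm_bound)
qed

text \<open>
  With \<open>T = t + \<epsilon>\<close>, the curve \<open>s \<mapsto> S\<^bsub>T - s\<^esub> e\<^bsub>c(s)\<^esub>\<close> is constant on \<open>[\<epsilon>, T]\<close>: moving \<open>s\<close> to
  \<open>s + \<delta>\<close> changes \<open>e\<^bsub>c(s)\<^esub>\<close> by \<open>\<delta>\<close> times its image under the generator, up to \<open>o(\<delta>)\<close>, and the
  semigroup over a time \<open>\<delta>\<close> has the same effect. A bisection argument makes
  the increments at most \<open>\<eta>\<close> times the length of the interval, for every \<open>\<eta> > 0\<close>; it asks for this only on
  short intervals around each point. The flow has to start at \<open>\<epsilon> > 0\<close> because the constant \<open>e\<^sub>0 = 1\<close> does not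
  vanish at infinity.
\<close>

theorem feller_semigroup_exp_flow:
  assumes S: "feller_semigroup S" and core: "is_core S Cc_infty"
    and gen: "\<forall>(f, g)\<in>generator S. f \<in> Cc_infty \<longrightarrow> (\<forall>x\<ge>0. half_line_fun g x = A_tilde f x)"
    and \<epsilon>: "0 < \<epsilon>" and t: "0 \<le> t"
  shows "S t (exp_fun (riccati \<epsilon>)) = exp_fun (riccati (t + \<epsilon>))"
proof -
  define T where "T = t + \<epsilon>"
  have T: "\<epsilon> \<le> T" using t by (simp add: T_def)
  let ?E = "\<lambda>s. exp_fun (riccati s)" and ?G = "\<lambda>s. gen_exp_fun (riccati s)"
  have E: "0 < s \<Longrightarrow> ?E s \<in> C0" and G: "0 < s \<Longrightarrow> ?G s \<in> C0" for s
    by (auto intro: exp_fun_C0 gen_exp_fun_C0 riccati_pos)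
  have "norm (S (T - T) (?E T) - S (T - \<epsilon>) (?E \<epsilon>)) \<le> 0"
  proof (rule field_le_epsilon)
    fix e :: real assume "0 < e"
    define \<eta> where "\<eta> = e / (T - \<epsilon> + 1)"
    have \<eta>: "0 < \<eta>" using \<open>0 < e\<close> T by (simp add: \<eta>_def)
    \<comment> \<open>The guards make \<open>R\<close> vacuous for intervals that leave \<open>[\<epsilon>, T]\<close>, which the bisection also asks about.\<close>
    define R where "R a b \<longleftrightarrow> (\<epsilon> \<le> a \<longrightarrow> a \<le> b \<longrightarrow> b \<le> T \<longrightarrow>
      norm (S (T - b) (?E b) - S (T - a) (?E a)) \<le> \<eta> * (b - a))" for a b
    have "R \<epsilon> T"
    proof (induct rule: Bolzano[OF T])
      case (1 a b c)
      show ?case unfolding R_def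
      proof (intro impI)
        assume *: "\<epsilon> \<le> a" "a \<le> c" "c \<le> T"
        have "norm (S (T - c) (?E c) - S (T - a) (?E a))
            \<le> norm (S (T - c) (?E c) - S (T - b) (?E b)) + norm (S (T - b) (?E b) - S (T - a) (?E a))"
          by (rule norm_diff_triangle_le) auto
        also have "\<dots> \<le> \<eta> * (c - b) + \<eta> * (b - a)"
          using 1 * by (intro add_mono) (auto simp: R_def)
        finally show "norm (S (T - c) (?E c) - S (T - a) (?E a)) \<le> \<eta> * (c - a)" by (simp add: algebra_simps)
      qed
    next
      case (2 x)
      have x: "0 < x" using 2 \<epsilon> by simp
      have "eventually (\<lambda>s. dist (S s (?G x)) (?G x) < \<eta> / 8) (at_right 0)"
        using feller_semigroup_tendsto[OF S G[OF x]] \<eta> by (intro tendstoD) auto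
      then obtain d1 where d1: "0 < d1" "\<And>s. 0 < s \<Longrightarrow> s < d1 \<Longrightarrow> norm (S s (?G x) - ?G x) < \<eta> / 8"
        by (auto simp: eventually_at_right_field dist_norm)
      have "isCont ?G x"
        using isCont_o2[OF DERIV_isCont[OF riccati_derivative] gen_exp_fun_continuous[OF riccati_pos[OF x]]] x by simp
      then obtain d2 where d2: "0 < d2" "\<And>s. dist s x < d2 \<Longrightarrow> norm (?G s - ?G x) < \<eta> / 8"
        using \<eta> unfolding continuous_at_eps_delta by (metis dist_norm zero_less_divide_iff zero_less_numeral)
      define d where "d = min d1 d2"
      have "R a b" if ab: "a \<le> x" "x \<le> b" "b - a < d" for a b
        unfolding R_def
      proof (intro impI)
        assume *: "\<epsilon> \<le> a" "a \<le> b" "b \<le> T"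
        have a: "0 < a" and b: "0 < b" using * \<epsilon> by auto
        have Gs: "norm (?G s - ?G x) \<le> \<eta> / 8" if "a \<le> s" "s \<le> b" for s
        proof -
          have "dist s x < d2" using that ab by (simp add: d_def dist_real_def abs_if)
          from less_imp_le[OF d2(2)[OF this]] show ?thesis .
        qed
        have Gs2: "norm (?G s - ?G a) \<le> \<eta> / 4" if "a \<le> s" "s \<le> b" for s
          using norm_diff_triangle_le[OF Gs[OF that], of "?G a" "\<eta> / 8"] Gs[of a] * by (simp add: norm_minus_commute)
        have 1: "norm (?E b - ?E a - (b - a) *\<^sub>R ?G a) \<le> (b - a) * (\<eta> / 4)"
          by (rule exp_flow_increment[OF a *(2) Gs2])
        obtain f g where fg: "\<And>k::nat. (f k, g k) \<in> generator S" "f \<longlonglongrightarrow> ?E a" "g \<longlonglongrightarrow> ?G a"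
          using exp_fun_approximated[OF S core gen riccati_pos[OF a]] by blast
        have 2: "norm (S (b - a) (?E a) - ?E a - (b - a) *\<^sub>R ?G a) \<le> (b - a) * (\<eta> / 2)"
        proof (rule generator_closed_increment_bound[OF S fg E[OF a] G[OF a]])
          fix s assume s: "0 \<le> s" "s \<le> b - a"
          have s1: "norm (S s (?G x) - ?G x) \<le> \<eta> / 8"
          proof (cases "s = 0")
            case True
            then show ?thesis using feller_semigroup_0[OF S G[OF x]] \<eta> by simp
          next
            case False
            then show ?thesis using d1(2)[of s] s ab by (simp add: d_def)
          qed
          have "S s (?G a) - ?G a = (S s (?G a) - S s (?G x)) + (S s (?G x) - ?G x) - (?G a - ?G x)" by simp
          also have "norm \<dots> \<le> norm (S s (?G a) - S s (?G x)) + norm (S s (?G x) - ?G x) + norm (?G a - ?G x)"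
            by (rule norm_add_diff_le)
          also have "\<dots> \<le> \<eta> / 8 + \<eta> / 8 + \<eta> / 8"
            using feller_semigroup_dist[OF S s(1) G[OF a] G[OF x]] s1 Gs[of a] * by (intro add_mono) auto
          finally show "norm (S s (?G a) - ?G a) \<le> \<eta> / 2" using \<eta> by simp
        qed (use * in auto)
        have "S (T - a) (?E a) = S (T - b) (S (b - a) (?E a))"
          using feller_semigroup_plus[OF S _ _ E[OF a], of "T - b" "b - a"] * by simp
        then have "norm (S (T - b) (?E b) - S (T - a) (?E a)) \<le> norm (?E b - S (b - a) (?E a))"
          using * by (auto intro!: feller_semigroup_dist[OF S] E[OF b] feller_semigroup_C0[OF S] E[OF a])
        also have "\<dots> = norm ((?E b - ?E a - (b - a) *\<^sub>R ?G a) - (S (b - a) (?E a) - ?E a - (b - a) *\<^sub>R ?G a))" by simp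
        also have "\<dots> \<le> norm (?E b - ?E a - (b - a) *\<^sub>R ?G a) + norm (S (b - a) (?E a) - ?E a - (b - a) *\<^sub>R ?G a)"
          by (rule norm_triangle_ineq4)
        also have "\<dots> \<le> (b - a) * (\<eta> / 4) + (b - a) * (\<eta> / 2)" using 1 2 by (rule add_mono)
        also have "\<dots> \<le> \<eta> * (b - a)" using \<eta> * by (simp add: field_simps)
        finally show "norm (S (T - b) (?E b) - S (T - a) (?E a)) \<le> \<eta> * (b - a)" .
      qed
      then show ?case using d1 d2 by (intro exI[of _ d]) (auto simp: d_def)
    qed
    then have "norm (S (T - T) (?E T) - S (T - \<epsilon>) (?E \<epsilon>)) \<le> \<eta> * (T - \<epsilon>)" using T by (simp add: R_def)
    also have "\<dots> \<le> e" using \<open>0 < e\<close> T by (simp add: \<eta>_def field_simps)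
    finally show "norm (S (T - T) (?E T) - S (T - \<epsilon>) (?E \<epsilon>)) \<le> 0 + e" by simp
  qed
  moreover have "S (T - T) (?E T) = ?E T"
    using feller_semigroup_0[OF S E[of T]] T \<epsilon> by simp
  ultimately show ?thesis by (simp add: T_def)
qed

section \<open>The process under the two measures\<close>

locale affine_explosion =
  fixes P Q :: "'a measure"
    and F :: "real \<Rightarrow> 'a measure"
    and X :: "real \<Rightarrow> 'a \<Rightarrow> ennreal"
    and S :: "real \<Rightarrow> (ennreal \<Rightarrow>\<^sub>C real) \<Rightarrow> (ennreal \<Rightarrow>\<^sub>C real)"
    and x0 :: real
  assumes prob_P: "prob_space P"
    and usual: "usual_filtration P F"
    and process: "cadlag_feller_process P F S X"
    and x0_pos: "0 < x0"
    and X_0: "\<forall>\<omega>\<in>space P. X 0 \<omega> = ennreal x0"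
    and core: "is_core S Cc_infty"
    and gen: "\<forall>(f, g)\<in>generator S. f \<in> Cc_infty \<longrightarrow> (\<forall>x\<ge>0. half_line_fun g x = A_tilde f x)"
    and sets_Q: "sets Q = sets P"
    and density_Q: "\<forall>t\<ge>0. restr_to_subalg Q (F t) =
           density (restr_to_subalg P (F t)) (\<lambda>\<omega>. ennreal (M_proc X t \<omega>))"
begin

sublocale P: prob_space P by (rule prob_P)

lemma space_Q: "space Q = space P"
  using sets_Q by (rule sets_eq_imp_space_eq)

lemma
  shows usual_subalgebra: "\<forall>t\<ge>0. subalgebra P (F t)"
    and usual_mono: "\<forall>s t. 0 \<le> s \<longrightarrow> s \<le> t \<longrightarrow> sets (F s) \<subseteq> sets (F t)"
    and usual_complete: "complete_measure P"
    and usual_null: "null_sets P \<subseteq> sets (F 0)"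
    and usual_right: "\<forall>t\<ge>0. sets (F t) = (\<Inter>s\<in>{t<..}. sets (F s))"
  using usual unfolding usual_filtration_def by - (elim conjE, assumption)+

lemma subalgebra_P: "0 \<le> t \<Longrightarrow> subalgebra P (F t)"
  using usual_subalgebra by blast

lemma subalgebra_Q: "0 \<le> t \<Longrightarrow> subalgebra Q (F t)"
  using subalgebra_P[of t] sets_Q space_Q by (simp add: subalgebra_def)

lemma space_F: "0 \<le> t \<Longrightarrow> space (F t) = space P"
  using subalgebra_P[of t] by (simp add: subalgebra_def)

lemma sets_F_mono: "0 \<le> s \<Longrightarrow> s \<le> t \<Longrightarrow> A \<in> sets (F s) \<Longrightarrow> A \<in> sets (F t)"
  using usual_mono by blast

lemma subalgebra_F: "0 \<le> s \<Longrightarrow> s \<le> t \<Longrightarrow> subalgebra (F t) (F s)"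
  using sets_F_mono[of s t] by (auto simp: subalgebra_def space_F)

lemma sets_F_P: "0 \<le> t \<Longrightarrow> A \<in> sets (F t) \<Longrightarrow> A \<in> sets P"
  using subalgebra_P[of t] by (auto simp: subalgebra_def)

lemma sets_F_right_continuous:
  assumes "0 \<le> t" "\<And>s. t < s \<Longrightarrow> A \<in> sets (F s)"
  shows "A \<in> sets (F t)"
proof -
  have "sets (F t) = (\<Inter>s\<in>{t<..}. sets (F s))" using usual_right assms(1) by blast
  then show ?thesis using assms(2) by blast
qed

lemma null_set_F:
  assumes "A \<subseteq> B" "B \<in> null_sets P" "0 \<le> t"
  shows "A \<in> sets (F t)" "A \<in> null_sets P"
proof -
  have "A \<in> sets P"
    using complete_measure.complete[OF usual_complete assms(1,2)] .
  then show A: "A \<in> null_sets P" using assms(1,2) by (rule null_sets_subset[rotated])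
  then have "A \<in> sets (F 0)" using usual_null by blast
  then show "A \<in> sets (F t)" using assms(3) by (intro sets_F_mono[of 0 t]) auto
qed

lemma X_measurable_F: "0 \<le> s \<Longrightarrow> s \<le> t \<Longrightarrow> X s \<in> borel_measurable (F t)"
  using process measurable_from_subalg[OF subalgebra_F]
  unfolding cadlag_feller_process_def adapted_def by blast

lemma X_measurable_P: "0 \<le> t \<Longrightarrow> X t \<in> borel_measurable P"
  using X_measurable_F[of t t] measurable_from_subalg[OF subalgebra_P] by blast

lemma X_cadlag: "\<omega> \<in> space P \<Longrightarrow> cadlag (\<lambda>t. X t \<omega>)"
  using process by (simp add: cadlag_feller_process_def)

lemma feller: "feller_semigroup S"
  using process by (simp add: cadlag_feller_process_def)

lemma M_measurable_F:
  assumes "0 \<le> t" 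
  shows "M_proc X t \<in> borel_measurable (F t)"
proof -
  note [measurable] = X_measurable_F[OF assms order_refl] X_measurable_F[of 0 t, OF order_refl assms]
  show ?thesis unfolding M_proc_def[abs_def] by measurable
qed

lemma M_nonneg: "0 \<le> M_proc X t \<omega>"
  by (simp add: M_proc_def)

lemma M_le: "\<omega> \<in> space P \<Longrightarrow> M_proc X t \<omega> \<le> exp (x0 - enn2real (X t \<omega>))"
  using X_0 x0_pos by (simp add: M_proc_def)

text \<open>
  For integrands known at time \<open>t\<close> only the density at time \<open>t\<close> matters.
\<close>

lemma change_of_measure:
  fixes H :: "'a \<Rightarrow> real"
  assumes t: "0 \<le> t" and H: "H \<in> borel_measurable (F t)"
  shows "(\<integral>\<omega>. H \<omega> \<partial>Q) = (\<integral>\<omega>. M_proc X t \<omega> * H \<omega> \<partial>P)"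
    and "integrable P (\<lambda>\<omega>. M_proc X t \<omega> * H \<omega>) \<Longrightarrow> integrable Q H"
proof -
  note [measurable] = H M_measurable_F[OF t]
  have M': "M_proc X t \<in> borel_measurable (restr_to_subalg P (F t))" 
    and H': "H \<in> borel_measurable (restr_to_subalg P (F t))"
    unfolding measurable_cong_sets[OF sets_restr_to_subalg[OF subalgebra_P[OF t]] refl]
    using M_measurable_F[OF t] H by simp_all
  have eq: "restr_to_subalg Q (F t) = density (restr_to_subalg P (F t)) (\<lambda>\<omega>. ennreal (M_proc X t \<omega>))"
    using density_Q t by blast
  have "(\<integral>\<omega>. H \<omega> \<partial>Q) = (\<integral>\<omega>. H \<omega> \<partial>restr_to_subalg Q (F t))"
    using integral_subalgebra2[OF subalgebra_Q[OF t] H] by simp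
  also have "\<dots> = (\<integral>\<omega>. M_proc X t \<omega> * H \<omega> \<partial>restr_to_subalg P (F t))"
    unfolding eq by (subst integral_density) (use M' H' in \<open>auto simp: M_nonneg\<close>)
  also have "\<dots> = (\<integral>\<omega>. M_proc X t \<omega> * H \<omega> \<partial>P)"
    by (rule integral_subalgebra2[OF subalgebra_P[OF t]]) measurable
  finally show "(\<integral>\<omega>. H \<omega> \<partial>Q) = (\<integral>\<omega>. M_proc X t \<omega> * H \<omega> \<partial>P)" .
  assume "integrable P (\<lambda>\<omega>. M_proc X t \<omega> * H \<omega>)"
  then have "integrable (restr_to_subalg P (F t)) (\<lambda>\<omega>. M_proc X t \<omega> * H \<omega>)"
    by (intro integrable_in_subalg[OF subalgebra_P[OF t]]) measurable
  then have "integrable (restr_to_subalg Q (F t)) H"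
    unfolding eq by (subst integrable_density) (use M' H' in \<open>auto simp: M_nonneg\<close>)
  then show "integrable Q H" by (rule integrable_from_subalg[OF subalgebra_Q[OF t]])
qed

text \<open>
  The density at time \<open>0\<close> is constantly \<open>1\<close>.
\<close>

lemma prob_space_Q: "prob_space Q"
proof
  have eq: "restr_to_subalg Q (F 0) = density (restr_to_subalg P (F 0)) (\<lambda>\<omega>. ennreal (M_proc X 0 \<omega>))"
    using density_Q by blast
  have "emeasure Q (space Q) = emeasure (restr_to_subalg Q (F 0)) (space Q)"
    using subalgebra_Q[of 0] sets.top[of "F 0"]
    by (subst emeasure_restr_to_subalg) (auto simp: space_Q space_F)
  also have "\<dots> = emeasure (restr_to_subalg P (F 0)) (space P)"
  proof -
    have "emeasure (density (restr_to_subalg P (F 0)) (\<lambda>\<omega>. ennreal (M_proc X 0 \<omega>))) (space P)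
       = (\<integral>\<^sup>+\<omega>. ennreal (M_proc X 0 \<omega>) * indicator (space P) \<omega> \<partial>restr_to_subalg P (F 0))"
    proof (rule emeasure_density)
      show "(\<lambda>\<omega>. ennreal (M_proc X 0 \<omega>)) \<in> borel_measurable (restr_to_subalg P (F 0))"
        using M_measurable_F[of 0]
        unfolding measurable_cong_sets[OF sets_restr_to_subalg[OF subalgebra_P[OF order_refl]] refl] by simp
      show "space P \<in> sets (restr_to_subalg P (F 0))"
        using sets.top[of "F 0"] by (simp add: sets_restr_to_subalg[OF subalgebra_P] space_F)
    qed
    also have "\<dots> = (\<integral>\<^sup>+\<omega>. indicator (space P) \<omega> \<partial>restr_to_subalg P (F 0))"
      by (intro nn_integral_cong) (use X_0 in \<open>auto simp: M_proc_def space_restr_to_subalg\<close>)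
    also have "\<dots> = emeasure (restr_to_subalg P (F 0)) (space P)"
      using sets.top[of "F 0"] by (intro nn_integral_indicator) (simp add: sets_restr_to_subalg[OF subalgebra_P] space_F)
    finally show ?thesis by (simp add: eq space_Q)
  qed
  also have "\<dots> = emeasure P (space P)"
    using subalgebra_P[of 0] sets.top[of "F 0"] by (subst emeasure_restr_to_subalg) (auto simp: space_F)
  finally show "emeasure Q (space Q) = 1" using P.emeasure_space_1 by simp
qed

sublocale Q: prob_space Q by (rule prob_space_Q)

lemma measure_Q:
  assumes t: "0 \<le> t" and A: "A \<in> sets (F t)"
  shows "measure Q A = (\<integral>\<omega>. M_proc X t \<omega> * indicator A \<omega> \<partial>P)"
proof -
  have "A \<in> sets Q" using sets_F_P[OF t A] sets_Q by simp
  then have "measure Q A = (\<integral>\<omega>. indicator A \<omega> \<partial>Q)" by simp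
  also have "\<dots> = (\<integral>\<omega>. M_proc X t \<omega> * indicator A \<omega> \<partial>P)"
    using A by (intro change_of_measure(1)[OF t] borel_measurable_indicator)
  finally show ?thesis .
qed

text \<open>
  \<open>M\<^sub>t\<close> is zero only where \<open>X\<^sub>t\<close> is infinite, so \<open>P\<close> and \<open>Q\<close> have the same null events at time \<open>t\<close>
  inside \<open>X\<^sub>t < \<infinity>\<close>.
\<close>

lemma Q_null_imp_exploded:
  assumes t: "0 \<le> t" and A: "A \<in> sets (F t)" and "measure Q A = 0"
  shows "AE \<omega> in P. \<omega> \<in> A \<longrightarrow> X t \<omega> = \<infinity>"
proof -
  note [measurable] = measurable_from_subalg[OF subalgebra_P[OF t] M_measurable_F[OF t]] sets_F_P[OF t A]
  have "integrable P (\<lambda>\<omega>. M_proc X t \<omega> * indicator A \<omega>)"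
  proof (rule P.integrable_const_bound[where B = "exp x0"])
    show "AE \<omega> in P. norm (M_proc X t \<omega> * indicator A \<omega>) \<le> exp x0"
    proof (rule AE_I2)
      fix \<omega> assume "\<omega> \<in> space P"
      from M_le[OF this, of t] have "M_proc X t \<omega> \<le> exp x0"
        by (rule order_trans) simp
      then show "norm (M_proc X t \<omega> * indicator A \<omega>) \<le> exp x0"
        using M_nonneg[of t \<omega>] by (auto simp: indicator_def)
    qed
  qed measurable
  moreover have "(\<integral>\<omega>. M_proc X t \<omega> * indicator A \<omega> \<partial>P) = 0"
    using measure_Q[OF t A] assms(3) by simp
  ultimately have "AE \<omega> in P. M_proc X t \<omega> * indicator A \<omega> = 0"
    by (subst (asm) integral_nonneg_eq_0_iff_AE) (auto simp: M_nonneg)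
  then show ?thesis by eventually_elim (auto simp: M_proc_def indicator_def split: if_splits)
qed

section \<open>Explosion probabilities\<close>

lemma exp_fun_apply:
  assumes "0 < v"
  shows "apply_bcontfun (exp_fun v) x = (if x = \<infinity> then 0 else exp (- (v * enn2real x)))"
  using half_line_exp_fun[OF assms, of "enn2real x"] exp_fun_C0[OF assms]
  by (cases x) (auto simp: half_line_fun_def C0_def)

lemma apply_bcontfun_X_measurable:
  assumes "0 \<le> s" "s \<le> t"
  shows "(\<lambda>\<omega>. apply_bcontfun f (X s \<omega>)) \<in> borel_measurable (F t)"
  by (rule measurable_compose[OF X_measurable_F[OF assms] borel_measurable_continuous_onI]) simp

lemma apply_bcontfun_X_integrable:
  fixes f :: "ennreal \<Rightarrow>\<^sub>C real"
  assumes "0 \<le> t"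
  shows "integrable P (\<lambda>\<omega>. apply_bcontfun f (X t \<omega>))"
proof (rule P.integrable_const_bound[where B = "norm f"])
  show "(\<lambda>\<omega>. apply_bcontfun f (X t \<omega>)) \<in> borel_measurable P"
    using apply_bcontfun_X_measurable[OF assms order_refl] measurable_from_subalg[OF subalgebra_P[OF assms]] by blast
qed (use norm_bounded[of f] in simp)

lemma Laplace_transform_increment:
  assumes s: "0 \<le> s" and h: "0 \<le> h" and \<epsilon>: "0 < \<epsilon>" and A: "A \<in> sets (F s)"
  shows "(\<integral>\<omega>. indicator A \<omega> * apply_bcontfun (exp_fun (riccati \<epsilon>)) (X (s + h) \<omega>) \<partial>P)
    = (\<integral>\<omega>. indicator A \<omega> * apply_bcontfun (exp_fun (riccati (h + \<epsilon>))) (X s \<omega>) \<partial>P)"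
proof -
  interpret sub: finite_measure_subalgebra P "F s"
    by unfold_locales (rule subalgebra_P[OF s])
  let ?f = "exp_fun (riccati \<epsilon>)"
  have C0: "?f \<in> C0" using \<epsilon> by (intro exp_fun_C0 riccati_pos)
  have int: "integrable P (\<lambda>\<omega>. apply_bcontfun f (X (s + h) \<omega>))" for f :: "ennreal \<Rightarrow>\<^sub>C real"
    using s h by (intro apply_bcontfun_X_integrable) auto
  have flow: "S h ?f = exp_fun (riccati (h + \<epsilon>))"
    by (rule feller_semigroup_exp_flow[OF feller core gen \<epsilon> h])
  have markov: "AE \<omega> in P. real_cond_exp P (F s) (\<lambda>\<omega>'. apply_bcontfun ?f (X (s + h) \<omega>')) \<omega>
          = apply_bcontfun (exp_fun (riccati (h + \<epsilon>))) (X s \<omega>)"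
  proof -
    have "AE \<omega> in P. real_cond_exp P (F s) (\<lambda>\<omega>'. apply_bcontfun ?f (X (s + h) \<omega>')) \<omega>
          = apply_bcontfun (S h ?f) (X s \<omega>)"
      using process s h C0 unfolding cadlag_feller_process_def by blast
    then show ?thesis by (simp only: flow)
  qed
  note [measurable] = sets_F_P[OF s A]
    measurable_from_subalg[OF subalgebra_P[OF s] apply_bcontfun_X_measurable[OF s order_refl]]
  have "(\<integral>\<omega>. indicator A \<omega> * apply_bcontfun ?f (X (s + h) \<omega>) \<partial>P)
     = (\<integral>\<omega>. indicator A \<omega> * real_cond_exp P (F s) (\<lambda>\<omega>'. apply_bcontfun ?f (X (s + h) \<omega>')) \<omega> \<partial>P)"
    using sub.real_cond_exp_intA[OF int A] by (simp add: set_lebesgue_integral_def)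
  also have "\<dots> = (\<integral>\<omega>. indicator A \<omega> * apply_bcontfun (exp_fun (riccati (h + \<epsilon>))) (X s \<omega>) \<partial>P)"
    by (rule integral_cong_AE) (use markov in \<open>auto elim!: eventually_mono\<close>)
  finally show ?thesis .
qed

text \<open>
  At \<open>\<infinity>\<close> the function \<open>1 - e\<^bsub>c(h)\<^esub>\<close> equals \<open>1\<close>, so its conditional expectation
  \<open>1 - exp (- c(2 h) X\<^sub>s)\<close> dominates the conditional probability of being at \<open>\<infinity>\<close> after time \<open>h\<close>. It is at most
  \<open>c(2 h) n\<close>, hence at most \<open>n h\<^sup>2\<close>, on \<open>X\<^sub>s \<le> n\<close>. Taking \<open>\<epsilon> = h\<close> in the flow instead of a limit \<open>\<epsilon> \<rightarrow> 0\<close>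
  costs only a constant factor.
\<close>

lemma prob_jump_to_infinity_le:
  assumes s: "0 \<le> s" and h: "0 < h"
  shows "measure P {\<omega> \<in> space P. X s \<omega> \<le> of_nat n \<and> X (s + h) \<omega> = \<infinity>} \<le> real n * h\<^sup>2"
proof -
  have sh: "0 \<le> s + h" using s h by simp
  note [measurable] = X_measurable_P[OF s] X_measurable_P[OF sh] X_measurable_F[OF s order_refl]
  define A where "A = {\<omega> \<in> space P. X s \<omega> \<le> of_nat n}"
  have A: "A \<in> sets (F s)"
  proof -
    have "{\<omega> \<in> space (F s). X s \<omega> \<le> of_nat n} \<in> sets (F s)" by measurable
    then show ?thesis by (simp add: A_def space_F[OF s])
  qed
  note [measurable] = sets_F_P[OF s A]
  let ?e = "\<lambda>r. apply_bcontfun (exp_fun (riccati r))"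
  have c: "0 < riccati h" "0 < riccati (h + h)" using h by (auto intro: riccati_pos)
  have int1: "integrable P (\<lambda>\<omega>. indicator A \<omega> * ?e h (X (s + h) \<omega>))"
    using integrable_mult_indicator[OF sets_F_P[OF s A] apply_bcontfun_X_integrable[OF sh, of "exp_fun (riccati h)"]] by simp
  have int2: "integrable P (\<lambda>\<omega>. indicator A \<omega> * ?e (h + h) (X s \<omega>))"
    using integrable_mult_indicator[OF sets_F_P[OF s A] apply_bcontfun_X_integrable[OF s, of "exp_fun (riccati (h + h))"]] by simp
  have intA: "integrable P (indicator A :: 'a \<Rightarrow> real)"
    using sets_F_P[OF s A] by (auto simp: P.emeasure_eq_measure)
  have "measure P {\<omega> \<in> space P. X s \<omega> \<le> of_nat n \<and> X (s + h) \<omega> = \<infinity>}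
      = (\<integral>\<omega>. indicator {\<omega> \<in> space P. X s \<omega> \<le> of_nat n \<and> X (s + h) \<omega> = \<infinity>} \<omega> \<partial>P)" by simp
  also have "\<dots> \<le> (\<integral>\<omega>. indicator A \<omega> - indicator A \<omega> * ?e h (X (s + h) \<omega>) \<partial>P)"
  proof (rule integral_mono)
    show "integrable P (\<lambda>\<omega>. indicator A \<omega> - indicator A \<omega> * ?e h (X (s + h) \<omega>))"
      using intA int1 by (rule Bochner_Integration.integrable_diff)
    show "integrable P (indicator {\<omega> \<in> space P. X s \<omega> \<le> of_nat n \<and> X (s + h) \<omega> = \<infinity>} :: 'a \<Rightarrow> real)"
      by (auto simp: P.emeasure_eq_measure)
    show "indicator {\<omega> \<in> space P. X s \<omega> \<le> of_nat n \<and> X (s + h) \<omega> = \<infinity>} \<omega>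
        \<le> indicator A \<omega> - indicator A \<omega> * ?e h (X (s + h) \<omega>)" if "\<omega> \<in> space P" for \<omega>
      using c by (auto simp: indicator_def A_def exp_fun_apply)
  qed
  also have "\<dots> = (\<integral>\<omega>. indicator A \<omega> \<partial>P) - (\<integral>\<omega>. indicator A \<omega> * ?e h (X (s + h) \<omega>) \<partial>P)"
    using intA int1 by (rule Bochner_Integration.integral_diff)
  also have "(\<integral>\<omega>. indicator A \<omega> * ?e h (X (s + h) \<omega>) \<partial>P) = (\<integral>\<omega>. indicator A \<omega> * ?e (h + h) (X s \<omega>) \<partial>P)"
    using Laplace_transform_increment[OF s _ h A, of h] h by simp
  also have "(\<integral>\<omega>. indicator A \<omega> \<partial>P) - (\<integral>\<omega>. indicator A \<omega> * ?e (h + h) (X s \<omega>) \<partial>P)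
      = (\<integral>\<omega>. indicator A \<omega> - indicator A \<omega> * ?e (h + h) (X s \<omega>) \<partial>P)"
    using intA int2 by (rule Bochner_Integration.integral_diff[symmetric])
  also have "\<dots> \<le> (\<integral>\<omega>. real n * h\<^sup>2 \<partial>P)"
  proof (rule integral_mono)
    show "integrable P (\<lambda>\<omega>. indicator A \<omega> - indicator A \<omega> * ?e (h + h) (X s \<omega>))"
      using intA int2 by (rule Bochner_Integration.integrable_diff)
    show "indicator A \<omega> - indicator A \<omega> * ?e (h + h) (X s \<omega>) \<le> real n * h\<^sup>2" if "\<omega> \<in> space P" for \<omega>
    proof (cases "\<omega> \<in> A")
      case True
      then have le: "X s \<omega> \<le> ennreal (real n)" by (simp add: A_def ennreal_of_nat_eq_real_of_nat)
      then obtain r where r: "X s \<omega> = ennreal r" "0 \<le> r" "r \<le> real n"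
        by (cases "X s \<omega>") (auto simp: top_unique)
      have "1 - exp (- (riccati (h + h) * r)) \<le> riccati (h + h) * r"
        using exp_ge_add_one_self[of "- (riccati (h + h) * r)"] by linarith
      also have "\<dots> \<le> ((h + h)\<^sup>2 / 4) * real n"
        using riccati_le[of "h + h"] h r by (intro mult_mono) auto
      also have "\<dots> = real n * h\<^sup>2" by (simp add: power2_eq_square algebra_simps)
      finally show ?thesis using True r c by (simp add: exp_fun_apply)
    qed simp
  qed simp
  finally show ?thesis by (simp add: P.prob_space)
qed

text \<open>
  As \<open>\<epsilon>\<close> decreases to \<open>0\<close>, the functions \<open>e\<^bsub>c(\<epsilon>)\<^esub>\<close> tend to the indicator of \<open>[0, \<infinity>)\<close>, while their
  expectations \<open>exp (- c(1 + \<epsilon>) x\<^sub>0)\<close> stay below \<open>exp (- c(1) x\<^sub>0) < 1\<close>.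
\<close>

lemma explodes_with_positive_probability:
  "measure P {\<omega> \<in> space P. X 1 \<omega> < \<infinity>} < 1"
proof -
  let ?e = "\<lambda>r. apply_bcontfun (exp_fun (riccati r))"
  define r where "r k = 1 / real (Suc k)" for k
  have r_pos: "0 < r k" for k by (simp add: r_def)
  note [measurable] = X_measurable_P[OF zero_le_one]
  have r_lim: "filterlim r (at_right 0) sequentially"
    unfolding filterlim_at r_def[abs_def] using LIMSEQ_Suc[OF lim_1_over_n] by simp
  have [measurable]: "(\<lambda>\<omega>. ?e r (X 1 \<omega>)) \<in> borel_measurable P" for r
    using apply_bcontfun_X_measurable[OF zero_le_one order_refl] measurable_from_subalg[OF subalgebra_P[OF zero_le_one]] by blast
  have "(\<lambda>k. \<integral>\<omega>. ?e (r k) (X 1 \<omega>) \<partial>P) \<longlonglongrightarrow> (\<integral>\<omega>. indicator {\<omega> \<in> space P. X 1 \<omega> < \<infinity>} \<omega> \<partial>P)"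
  proof (rule integral_dominated_convergence[where w = "\<lambda>_. 1"])
    show "AE \<omega> in P. (\<lambda>k. ?e (r k) (X 1 \<omega>)) \<longlonglongrightarrow> indicator {\<omega> \<in> space P. X 1 \<omega> < \<infinity>} \<omega>"
    proof (rule AE_I2)
      fix \<omega> assume \<omega>: "\<omega> \<in> space P"
      have pos: "0 < riccati (r k)" for k by (intro riccati_pos r_pos)
      show "(\<lambda>k. ?e (r k) (X 1 \<omega>)) \<longlonglongrightarrow> indicator {\<omega> \<in> space P. X 1 \<omega> < \<infinity>} \<omega>"
      proof (cases "X 1 \<omega> = \<infinity>")
        case False
        have "(\<lambda>k. exp (- (riccati (r k) * enn2real (X 1 \<omega>)))) \<longlonglongrightarrow> exp (- (0 * enn2real (X 1 \<omega>)))"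
          by (intro tendsto_intros filterlim_compose[OF riccati_tendsto_0 r_lim])
        then show ?thesis using False \<omega> by (simp add: exp_fun_apply[OF pos] less_top[symmetric])
      qed (simp add: exp_fun_apply[OF pos])
    qed
    show "AE \<omega> in P. norm (?e (r k) (X 1 \<omega>)) \<le> 1" for k
    proof (rule AE_I2)
      fix \<omega>
      have pos: "0 < riccati (r k)" by (intro riccati_pos r_pos)
      show "norm (?e (r k) (X 1 \<omega>)) \<le> 1" using pos by (simp add: exp_fun_apply[OF pos])
    qed
  qed auto
  moreover have "(\<integral>\<omega>. ?e (r k) (X 1 \<omega>) \<partial>P) \<le> exp (- (riccati 1 * x0))" for k
  proof -
    have "(\<integral>\<omega>. ?e (r k) (X 1 \<omega>) \<partial>P) = (\<integral>\<omega>. indicator (space P) \<omega> * ?e (r k) (X (0 + 1) \<omega>) \<partial>P)"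
      by (intro Bochner_Integration.integral_cong) auto
    also have "\<dots> = (\<integral>\<omega>. indicator (space P) \<omega> * ?e (1 + r k) (X 0 \<omega>) \<partial>P)"
      using sets.top[of "F 0"] by (intro Laplace_transform_increment r_pos) (auto simp: space_F)
    also have "\<dots> = (\<integral>\<omega>. exp (- (riccati (1 + r k) * x0)) \<partial>P)"
    proof (intro Bochner_Integration.integral_cong refl)
      fix \<omega> assume "\<omega> \<in> space P"
      moreover have "0 < riccati (1 + r k)" by (intro riccati_pos) (simp add: add_pos_pos r_pos)
      ultimately show "indicator (space P) \<omega> * ?e (1 + r k) (X 0 \<omega>) = exp (- (riccati (1 + r k) * x0))"
        using X_0 x0_pos by (simp add: exp_fun_apply)
    qed
    also have "\<dots> = exp (- (riccati (1 + r k) * x0))" by (simp add: P.prob_space)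
    also have "\<dots> \<le> exp (- (riccati 1 * x0))"
      using riccati_mono[of 1 "1 + r k"] r_pos[of k] x0_pos by simp
    finally show ?thesis .
  qed
  ultimately have "(\<integral>\<omega>. indicator {\<omega> \<in> space P. X 1 \<omega> < \<infinity>} \<omega> \<partial>P) \<le> exp (- (riccati 1 * x0))"
    by (intro LIMSEQ_le_const2) auto
  then have "measure P {\<omega> \<in> space P. X 1 \<omega> < \<infinity>} \<le> exp (- (riccati 1 * x0))"
    by simp
  also have "\<dots> < 1" using riccati_pos[of 1] x0_pos by simp
  finally show ?thesis .
qed

section \<open>Non-explosion under the changed measure\<close>

text \<open>
  Split the event according to the first \<open>t \<in> D\<close> with \<open>X\<^sub>t > n\<close>; each piece is known at time \<open>t\<close>, and
  there the density \<open>M\<^sub>t\<close> is at most \<open>exp (x\<^sub>0 - n)\<close>.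
\<close>

lemma Q_maximal_inequality_finite:
  assumes D: "finite D" "\<And>t. t \<in> D \<Longrightarrow> 0 \<le> t"
  shows "measure Q {\<omega> \<in> space P. \<exists>t\<in>D. of_nat n < X t \<omega>} \<le> exp (x0 - real n)"
proof -
  define A where "A t = {\<omega> \<in> space P. of_nat n < X t \<omega> \<and> (\<forall>s\<in>D. s < t \<longrightarrow> X s \<omega> \<le> of_nat n)}" for t
  have A_F: "A t \<in> sets (F t)" if t: "t \<in> D" for t
  proof -
    have "{\<omega> \<in> space (F t). X s \<omega> \<le> of_nat n} \<in> sets (F t)" if "s \<in> D" "s < t" for s
    proof -
      note [measurable] = X_measurable_F[OF D(2)[OF that(1)] less_imp_le[OF that(2)]]
      show ?thesis by measurable
    qed
    then have "{\<omega> \<in> space (F t). \<forall>s\<in>{s \<in> D. s < t}. X s \<omega> \<le> of_nat n} \<in> sets (F t)"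
      using D(1) by (intro sets.sets_Collect_finite_All) auto
    moreover have "{\<omega> \<in> space (F t). of_nat n < X t \<omega>} \<in> sets (F t)"
    proof -
      note [measurable] = X_measurable_F[OF D(2)[OF t] order_refl]
      show ?thesis by measurable
    qed
    ultimately have "{\<omega> \<in> space (F t). of_nat n < X t \<omega>} \<inter> {\<omega> \<in> space (F t). \<forall>s\<in>{s \<in> D. s < t}. X s \<omega> \<le> of_nat n} \<in> sets (F t)"
      by (intro sets.Int)
    moreover have "A t = {\<omega> \<in> space (F t). of_nat n < X t \<omega>} \<inter> {\<omega> \<in> space (F t). \<forall>s\<in>{s \<in> D. s < t}. X s \<omega> \<le> of_nat n}"
      using D(2)[OF t] by (auto simp: A_def space_F)
    ultimately show ?thesis by simp
  qed
  have A_P: "A t \<in> sets P" if "t \<in> D" for t using A_F[OF that] sets_F_P[OF D(2)[OF that]] by blast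
  have disj: "disjoint_family_on A D"
    unfolding disjoint_family_on_def A_def by (auto, metis linorder_neqE_linordered_idom not_le)
  have union: "{\<omega> \<in> space P. \<exists>t\<in>D. of_nat n < X t \<omega>} = (\<Union>t\<in>D. A t)"
  proof (intro subset_antisym subsetI)
    fix \<omega> assume \<omega>: "\<omega> \<in> {\<omega> \<in> space P. \<exists>t\<in>D. of_nat n < X t \<omega>}"
    let ?I = "{t \<in> D. of_nat n < X t \<omega>}"
    have I: "finite ?I" "?I \<noteq> {}" using D \<omega> by auto
    have "Min ?I \<in> ?I" using I by (rule Min_in)
    moreover have "X s \<omega> \<le> of_nat n" if "s \<in> D" "s < Min ?I" for s
      using Min_le[OF I(1), of s] that by (auto simp: not_le[symmetric])
    ultimately show "\<omega> \<in> (\<Union>t\<in>D. A t)" using \<omega> by (auto simp: A_def)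
  qed (auto simp: A_def)
  have A_le: "measure Q (A t) \<le> exp (x0 - real n) * measure P (A t)" if t: "t \<in> D" for t
  proof -
    have "measure Q (A t) = (\<integral>\<omega>. M_proc X t \<omega> * indicator (A t) \<omega> \<partial>P)"
      by (rule measure_Q[OF D(2)[OF t] A_F[OF t]])
    also have "\<dots> \<le> (\<integral>\<omega>. exp (x0 - real n) * indicator (A t) \<omega> \<partial>P)"
    proof (rule Bochner_Integration.integral_mono')
      show "integrable P (\<lambda>\<omega>. exp (x0 - real n) * indicator (A t) \<omega>)"
        using A_P[OF t] by (auto simp: P.emeasure_eq_measure)
      fix \<omega> assume \<omega>: "\<omega> \<in> space P"
      show "0 \<le> exp (x0 - real n) * indicator (A t) \<omega>" by simp
      show "M_proc X t \<omega> * indicator (A t) \<omega> \<le> exp (x0 - real n) * indicator (A t) \<omega>"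
      proof (cases "\<omega> \<in> A t \<and> X t \<omega> \<noteq> \<infinity>")
        case True
        then have "ennreal (real n) < X t \<omega>" by (simp add: A_def ennreal_of_nat_eq_real_of_nat)
        then have "real n \<le> enn2real (X t \<omega>)"
          using True by (cases "X t \<omega>") (auto simp: ennreal_less_iff)
        then show ?thesis using M_le[OF \<omega>, of t] True
          by (auto intro: order_trans[OF M_le[OF \<omega>]])
      qed (auto simp: M_proc_def)
    qed
    also have "\<dots> = exp (x0 - real n) * measure P (A t)" using A_P[OF t] by simp
    finally show ?thesis .
  qed
  have "measure Q (\<Union>t\<in>D. A t) = (\<Sum>t\<in>D. measure Q (A t))"
    using D(1) A_P disj by (intro Q.finite_measure_finite_Union) (auto simp: sets_Q)
  also have "\<dots> \<le> (\<Sum>t\<in>D. exp (x0 - real n) * measure P (A t))" by (rule sum_mono) (rule A_le)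
  also have "\<dots> = exp (x0 - real n) * measure P (\<Union>t\<in>D. A t)"
    using D(1) A_P disj by (subst P.finite_measure_finite_Union) (auto simp: sum_distrib_left)
  also have "\<dots> \<le> exp (x0 - real n) * 1" by (intro mult_left_mono) auto
  finally show ?thesis by (simp add: union)
qed

text \<open>
  By right-continuity, the values at rational times determine the behaviour on \<open>[0, t)\<close> but not at the
  end point, which is therefore added.
\<close>

definition test_times :: "real \<Rightarrow> real set" where
  "test_times t = insert t ({0..t} \<inter> \<rat>)"

text \<open>
  Whether explosion up to time \<open>t\<close> is an event is not clear a priori. This is an event at time \<open>t\<close> that
  contains it and still has \<open>Q\<close>-probability zero.
\<close>

definition unbounded_before :: "real \<Rightarrow> 'a set" where
  "unbounded_before t = {\<omega> \<in> space P. \<forall>n::nat. \<exists>q\<in>test_times t. of_nat n < X q \<omega>}"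

lemma countable_test_times: "countable (test_times t)"
  unfolding test_times_def using countable_rat by (auto intro: countable_subset)

lemma test_times_bounds: "0 \<le> t \<Longrightarrow> q \<in> test_times t \<Longrightarrow> 0 \<le> q \<and> q \<le> t"
  by (auto simp: test_times_def)

lemma exceed_measurable:
  assumes t: "0 \<le> t"
  shows "{\<omega> \<in> space P. \<exists>q\<in>test_times t. of_nat n < X q \<omega>} \<in> sets (F t)"
proof -
  have "{\<omega> \<in> space (F t). of_nat n < X q \<omega>} \<in> sets (F t)" if "q \<in> test_times t" for q
  proof -
    note [measurable] = X_measurable_F[of q t, OF conjunct1[OF test_times_bounds[OF t that]] conjunct2[OF test_times_bounds[OF t that]]]
    show ?thesis by measurable
  qed
  then have "{\<omega> \<in> space (F t). \<exists>q\<in>test_times t. of_nat n < X q \<omega>} \<in> sets (F t)"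
    using countable_test_times by (intro sets.sets_Collect_countable_Ex') auto
  then show ?thesis by (simp add: space_F[OF t])
qed

lemma unbounded_before_measurable:
  assumes t: "0 \<le> t"
  shows "unbounded_before t \<in> sets (F t)"
proof -
  have "unbounded_before t = (\<Inter>n. {\<omega> \<in> space P. \<exists>q\<in>test_times t. of_nat n < X q \<omega>})"
    by (auto simp: unbounded_before_def)
  also have "\<dots> \<in> sets (F t)" using exceed_measurable[OF t] by (intro sets.countable_INT') auto
  finally show ?thesis .
qed

lemma Q_maximal_inequality:
  assumes t: "0 \<le> t"
  shows "measure Q {\<omega> \<in> space P. \<exists>q\<in>test_times t. of_nat n < X q \<omega>} \<le> exp (x0 - real n)"
proof -
  let ?D = "\<lambda>k. from_nat_into (test_times t) ` {..<k}"
  let ?B = "\<lambda>k. {\<omega> \<in> space P. \<exists>q\<in>?D k. of_nat n < X q \<omega>}"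
  have ne: "test_times t \<noteq> {}" by (simp add: test_times_def)
  have sub: "?D k \<subseteq> test_times t" for k using from_nat_into[OF ne] by auto
  have D: "0 \<le> q" if "q \<in> ?D k" for q k using sub that test_times_bounds[OF t] by blast
  have meas: "?B k \<in> sets Q" for k
  proof -
    have "{\<omega> \<in> space P. of_nat n < X q \<omega>} \<in> sets P" if "q \<in> ?D k" for q
    proof -
      note [measurable] = X_measurable_P[OF D[OF that]]
      show ?thesis by measurable
    qed
    then have "?B k \<in> sets P" by (intro sets.sets_Collect_finite_Ex) auto
    then show ?thesis by (simp add: sets_Q)
  qed
  have "(\<lambda>k. measure Q (?B k)) \<longlonglongrightarrow> measure Q (\<Union>k. ?B k)"
    using meas by (intro Q.finite_Lim_measure_incseq) (auto simp: incseq_def)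
  moreover have "(\<Union>k. ?B k) = {\<omega> \<in> space P. \<exists>q\<in>test_times t. of_nat n < X q \<omega>}"
  proof (intro subset_antisym subsetI)
    fix \<omega> assume "\<omega> \<in> {\<omega> \<in> space P. \<exists>q\<in>test_times t. of_nat n < X q \<omega>}"
    then obtain q where q: "\<omega> \<in> space P" "q \<in> test_times t" "of_nat n < X q \<omega>" by auto
    then obtain i where "q = from_nat_into (test_times t) i"
      using from_nat_into_surj[OF countable_test_times] by metis
    then have "q \<in> ?D (Suc i)" by auto
    then show "\<omega> \<in> (\<Union>k. ?B k)" using q by blast
  qed (use sub in blast)
  moreover have "measure Q (?B k) \<le> exp (x0 - real n)" for k
    by (rule Q_maximal_inequality_finite[OF _ D]) auto
  ultimately show ?thesis
    by (intro LIMSEQ_le_const2[where X = "\<lambda>k. measure Q (?B k)"]) auto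
qed

lemma Q_unbounded_before:
  assumes t: "0 \<le> t"
  shows "measure Q (unbounded_before t) = 0"
proof -
  have "measure Q (unbounded_before t) \<le> exp (x0 - real n)" for n
  proof -
    have "measure Q (unbounded_before t) \<le> measure Q {\<omega> \<in> space P. \<exists>q\<in>test_times t. of_nat n < X q \<omega>}"
      using sets_F_P[OF t exceed_measurable[OF t]] by (intro Q.finite_measure_mono) (auto simp: unbounded_before_def sets_Q)
    also have "\<dots> \<le> exp (x0 - real n)" by (rule Q_maximal_inequality[OF t])
    finally show ?thesis .
  qed
  moreover have "(\<lambda>n. exp (x0 - real n)) \<longlonglongrightarrow> 0"
  proof -
    have "(\<lambda>n. exp x0 * exp (- 1) ^ n) \<longlonglongrightarrow> exp x0 * (0 :: real)"
      by (intro tendsto_intros LIMSEQ_power_zero) simp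
    moreover have "exp (x0 - real n) = exp x0 * exp (- 1) ^ n" for n
      by (simp add: exp_of_nat_mult[symmetric] exp_add[symmetric])
    ultimately show ?thesis by simp
  qed
  ultimately have "measure Q (unbounded_before t) \<le> 0" by (intro LIMSEQ_le_const) auto
  then show ?thesis by (simp add: measure_le_0_iff)
qed

end

section \<open>Sampling at first-passage times\<close>

definition grid_point :: "real \<Rightarrow> real \<Rightarrow> nat \<Rightarrow> nat \<Rightarrow> real" where
  "grid_point s t N j = s + (t - s) * real j / real N"

text \<open>
  Points \<open>r \<in> [s, t]\<close> are approximated by grid points strictly above them, so that right-continuity
  applies and \<open>grid_index s t N r = j\<close> is decided by comparing \<open>r\<close> with points up to the \<open>j\<close>-th one. The
  last point \<open>t\<close> has none above it and takes index \<open>N\<close>.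
\<close>

definition grid_index :: "real \<Rightarrow> real \<Rightarrow> nat \<Rightarrow> real \<Rightarrow> nat" where
  "grid_index s t N r = (LEAST j. j = N \<or> r < grid_point s t N j)"

lemma grid_index_eq_iff:
  "grid_index s t N r = j \<longleftrightarrow> (j = N \<or> r < grid_point s t N j) \<and> (\<forall>i<j. i \<noteq> N \<and> grid_point s t N i \<le> r)"
proof
  assume eq: "grid_index s t N r = j"
  have "j = N \<or> r < grid_point s t N j"
    unfolding eq[symmetric] grid_index_def by (rule LeastI[of _ N]) simp
  moreover have "i \<noteq> N \<and> grid_point s t N i \<le> r" if "i < j" for i
    using not_less_Least[of i "\<lambda>j. j = N \<or> r < grid_point s t N j"] that
    unfolding eq[symmetric] grid_index_def by auto
  ultimately show "(j = N \<or> r < grid_point s t N j) \<and> (\<forall>i<j. i \<noteq> N \<and> grid_point s t N i \<le> r)" by blast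
next
  assume *: "(j = N \<or> r < grid_point s t N j) \<and> (\<forall>i<j. i \<noteq> N \<and> grid_point s t N i \<le> r)"
  show "grid_index s t N r = j" unfolding grid_index_def
  proof (rule Least_equality)
    show "j = N \<or> r < grid_point s t N j" using * by blast
    show "j \<le> i" if "i = N \<or> r < grid_point s t N i" for i
      using * that by (metis not_le)
  qed
qed

lemma grid_index_le: "grid_index s t N r \<le> N"
  unfolding grid_index_def by (rule Least_le) simp

lemma grid_point_bounds:
  assumes "s \<le> t" "j \<le> N" "0 < N"
  shows "s \<le> grid_point s t N j" "grid_point s t N j \<le> t"
proof -
  have j: "real j / real N \<le> 1" using assms by simp
  have "(t - s) * (real j / real N) \<le> (t - s) * 1" using assms j by (intro mult_left_mono) auto
  moreover have "0 \<le> (t - s) * (real j / real N)" using assms by (intro mult_nonneg_nonneg) auto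
  ultimately show "s \<le> grid_point s t N j" "grid_point s t N j \<le> t" by (auto simp: grid_point_def)
qed

lemma grid_point_index_bounds:
  assumes "s \<le> r" "r \<le> t" "0 < N"
  shows "r \<le> grid_point s t N (grid_index s t N r)"
    and "grid_point s t N (grid_index s t N r) \<le> r + (t - s) / real N"
proof -
  let ?j = "grid_index s t N r"
  have j: "?j = N \<or> r < grid_point s t N ?j" "\<And>i. i < ?j \<Longrightarrow> grid_point s t N i \<le> r"
    using grid_index_eq_iff[of s t N r ?j] by auto
  have N: "grid_point s t N N = t" using assms(3) by (simp add: grid_point_def)
  show "r \<le> grid_point s t N ?j" using j(1) N assms(2) by auto
  show "grid_point s t N ?j \<le> r + (t - s) / real N"
  proof (cases ?j)
    case 0
    have "0 \<le> (t - s) / real N" using assms by simp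
    moreover have "grid_point s t N 0 = s" by (simp add: grid_point_def)
    ultimately show ?thesis unfolding 0 using assms(1) by linarith
  next
    case (Suc i)
    have "grid_point s t N (Suc i) = grid_point s t N i + (t - s) / real N"
      using assms(3) by (simp add: grid_point_def field_simps)
    then show ?thesis using j(2)[of i] Suc by simp
  qed
qed

lemma grid_point_index_lim:
  assumes "s \<le> r" "r \<le> t"
  shows "(\<lambda>k. grid_point s t (Suc k) (grid_index s t (Suc k) r)) \<longlonglongrightarrow> r"
proof (rule tendsto_sandwich)
  show "\<forall>\<^sub>F k in sequentially. r \<le> grid_point s t (Suc k) (grid_index s t (Suc k) r)"
    using grid_point_index_bounds(1)[OF assms] by simp
  show "\<forall>\<^sub>F k in sequentially. grid_point s t (Suc k) (grid_index s t (Suc k) r) \<le> r + (t - s) / real (Suc k)"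
    using grid_point_index_bounds(2)[OF assms] by (intro always_eventually allI) blast
  show "(\<lambda>k. r + (t - s) / real (Suc k)) \<longlonglongrightarrow> r"
    using tendsto_add[OF tendsto_const LIMSEQ_Suc[OF lim_const_over_n[of "t - s"]], of r] by simp
qed simp

definition passage_time :: "(real \<Rightarrow> 'a \<Rightarrow> ennreal) \<Rightarrow> nat \<Rightarrow> 'a \<Rightarrow> ennreal" where
  "passage_time X n \<omega> = Inf {ennreal t |t. 0 \<le> t \<and> of_nat n < X t \<omega>}"

lemma passage_time_mono: "incseq (\<lambda>n. passage_time X n \<omega>)"
proof (rule incseq_SucI)
  fix n
  have "(of_nat n :: ennreal) \<le> of_nat (Suc n)" by (intro of_nat_mono) simp
  then show "passage_time X n \<omega> \<le> passage_time X (Suc n) \<omega>"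
    unfolding passage_time_def by (intro Inf_superset_mono Collect_mono) (blast intro: le_less_trans)
qed

lemma passage_time_le_explosion_time: "passage_time X n \<omega> \<le> explosion_time X \<omega>"
  unfolding passage_time_def explosion_time_def by (intro Inf_superset_mono) (auto simp: of_nat_less_top)

lemma before_passage_time: "0 \<le> t \<Longrightarrow> ennreal t < passage_time X n \<omega> \<Longrightarrow> X t \<omega> \<le> of_nat n"
  unfolding passage_time_def by (metis (mono_tags, lifting) Inf_lower mem_Collect_eq not_le)

lemma explosion_time_le: "0 \<le> t \<Longrightarrow> X t \<omega> = \<infinity> \<Longrightarrow> explosion_time X \<omega> \<le> ennreal t"
  unfolding explosion_time_def by (intro Inf_lower) auto

definition passage_clock :: "(real \<Rightarrow> 'a \<Rightarrow> ennreal) \<Rightarrow> nat \<Rightarrow> real \<Rightarrow> 'a \<Rightarrow> real" where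
  "passage_clock X n t \<omega> = enn2real (min (ennreal t) (passage_time X n \<omega>))"

lemma passage_clock:
  assumes "0 \<le> t"
  shows "ennreal (passage_clock X n t \<omega>) = min (ennreal t) (passage_time X n \<omega>)"
    and "0 \<le> passage_clock X n t \<omega>" and "passage_clock X n t \<omega> \<le> t"
proof -
  have "min (ennreal t) (passage_time X n \<omega>) < top" by (simp add: min_less_iff_disj)
  then show *: "ennreal (passage_clock X n t \<omega>) = min (ennreal t) (passage_time X n \<omega>)"
    by (simp add: passage_clock_def)
  show "0 \<le> passage_clock X n t \<omega>" by (simp add: passage_clock_def)
  have "ennreal (passage_clock X n t \<omega>) \<le> ennreal t" unfolding * by simp
  then show "passage_clock X n t \<omega> \<le> t" using assms by (simp add: ennreal_le_iff)
qed

lemma passage_clock_less_iff: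
  assumes "0 \<le> t" "u \<le> t" "0 \<le> u"
  shows "passage_clock X n t \<omega> < u \<longleftrightarrow> passage_time X n \<omega> < ennreal u"
proof -
  have "passage_clock X n t \<omega> < u \<longleftrightarrow> ennreal (passage_clock X n t \<omega>) < ennreal u"
    using passage_clock(2)[OF assms(1), of X n \<omega>] by (simp add: ennreal_less_iff)
  also have "\<dots> \<longleftrightarrow> min (ennreal t) (passage_time X n \<omega>) < ennreal u"
    by (simp only: passage_clock(1)[OF assms(1)])
  also have "\<dots> \<longleftrightarrow> passage_time X n \<omega> < ennreal u"
    using assms by (simp add: min_less_iff_disj ennreal_less_iff)
  finally show ?thesis .
qed

text \<open>
  The value of \<open>1 / M\<close> in terms of the state, with \<open>0\<close> at \<open>\<infinity>\<close>, as in the definition of \<open>L\<close>.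
\<close>

definition growth :: "real \<Rightarrow> ennreal \<Rightarrow> real" where
  "growth x0 x = (if x = \<infinity> then 0 else exp (enn2real x - x0))"

lemma growth_nonneg: "0 \<le> growth x0 x"
  by (simp add: growth_def)

lemma growth_measurable [measurable]: "growth x0 \<in> borel_measurable borel"
  unfolding growth_def[abs_def] by measurable

definition cut :: "nat \<Rightarrow> real \<Rightarrow> real" where
  "cut K x = max 0 (min 1 (real K + 1 - x))"

lemma cut_bounds: "0 \<le> cut K x" "cut K x \<le> 1" "K \<le> L \<Longrightarrow> cut K x \<le> cut L x" "x \<le> real K \<Longrightarrow> cut K x = 1"
  by (auto simp: cut_def)

lemma cut_continuous: "continuous_on A (cut K)"
  unfolding cut_def[abs_def] by (intro continuous_intros)

lemma cut_eventually_0: "eventually (\<lambda>x. cut K x = 0) at_top"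
  by (rule eventually_at_top_linorderI[of "real K + 1"]) (auto simp: cut_def)

context affine_explosion
begin

lemma X_right_nearby:
  assumes \<omega>: "\<omega> \<in> space P" and r: "0 \<le> r" and U: "open U" "X r \<omega> \<in> U"
  shows "\<exists>b>r. \<forall>y. r \<le> y \<longrightarrow> y < b \<longrightarrow> X y \<omega> \<in> U"
proof -
  have "((\<lambda>t. X t \<omega>) \<longlongrightarrow> X r \<omega>) (at_right r)"
    using X_cadlag[OF \<omega>] r by (simp add: cadlag_def)
  from topological_tendstoD[OF this U] obtain b where "r < b" "\<forall>y>r. y < b \<longrightarrow> X y \<omega> \<in> U"
    by (auto simp: eventually_at_right_field)
  then show ?thesis using U(2) by (metis le_less)
qed

lemma explosion_time_attained:
  assumes \<omega>: "\<omega> \<in> space P" and t: "0 \<le> t" and le: "explosion_time X \<omega> \<le> ennreal t"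
  shows "\<exists>r. 0 \<le> r \<and> r \<le> t \<and> explosion_time X \<omega> = ennreal r \<and> X r \<omega> = \<infinity>"
proof -
  define r where "r = enn2real (explosion_time X \<omega>)"
  have "explosion_time X \<omega> < top" using le by (rule le_less_trans) simp
  then have r: "explosion_time X \<omega> = ennreal r" "0 \<le> r" by (auto simp: r_def)
  have "r \<le> t" using le r t by (simp add: ennreal_le_iff)
  moreover have "X r \<omega> = \<infinity>"
  proof (rule ccontr)
    assume "X r \<omega> \<noteq> \<infinity>"
    then obtain b where b: "r < b" "\<And>y. r \<le> y \<Longrightarrow> y < b \<Longrightarrow> X y \<omega> < \<infinity>"
      using X_right_nearby[OF \<omega> r(2), of "{..<\<infinity>}"] by (auto simp: less_top)
    have "ennreal b \<le> explosion_time X \<omega>"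
      unfolding explosion_time_def
    proof (rule Inf_greatest)
      fix z assume "z \<in> {ennreal t |t. 0 \<le> t \<and> X t \<omega> = \<infinity>}"
      then obtain y where y: "z = ennreal y" "0 \<le> y" "X y \<omega> = \<infinity>" by auto
      have "r \<le> y" using explosion_time_le[of y X \<omega>] y r by (simp add: ennreal_le_iff)
      then have "b \<le> y" using b(2)[of y] y(3) by (cases "y < b") auto
      then show "ennreal b \<le> z" using y by (simp add: ennreal_leI)
    qed
    then show False using r b(1) by (simp add: ennreal_le_iff)
  qed
  ultimately show ?thesis using r by blast
qed

lemma exceed_at_rational:
  assumes \<omega>: "\<omega> \<in> space P" and r: "0 \<le> r" "r < u" and n: "of_nat n < X r \<omega>"
  shows "\<exists>q\<in>\<rat>. r < q \<and> q < u \<and> of_nat n < X q \<omega>"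
proof -
  obtain b where b: "r < b" "\<And>y. r \<le> y \<Longrightarrow> y < b \<Longrightarrow> of_nat n < X y \<omega>"
    using X_right_nearby[OF \<omega> r(1), of "{of_nat n<..}"] n by auto
  obtain q where "q \<in> \<rat>" "r < q" "q < min b u"
    using Rats_dense_in_real[of r "min b u"] b r by auto
  then show ?thesis using b by auto
qed

lemma bounded_outside_unbounded_before:
  assumes \<omega>: "\<omega> \<in> space P" "\<omega> \<notin> unbounded_before t"
  shows "\<exists>n::nat. \<forall>r. 0 \<le> r \<longrightarrow> r \<le> t \<longrightarrow> X r \<omega> \<le> of_nat n"
proof -
  obtain n :: nat where n: "\<And>q. q \<in> test_times t \<Longrightarrow> X q \<omega> \<le> of_nat n"
    using \<omega> by (auto simp: unbounded_before_def not_less)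
  have "X r \<omega> \<le> of_nat n" if r: "0 \<le> r" "r \<le> t" for r
  proof (rule ccontr)
    assume "\<not> X r \<omega> \<le> of_nat n"
    then have gt: "of_nat n < X r \<omega>" by simp
    have "r \<noteq> t" using n[of t] gt by (auto simp: test_times_def)
    then have "r < t" using r by simp
    then obtain q where "q \<in> \<rat>" "r < q" "q < t" "of_nat n < X q \<omega>"
      using exceed_at_rational[OF \<omega>(1) r(1) _ gt] by blast
    then show False using n[of q] r by (auto simp: test_times_def)
  qed
  then show ?thesis by blast
qed

text \<open>
  Explosion up to time \<open>t\<close> puts the path into \<open>unbounded_before t\<close>, which is a \<open>Q\<close>-null event, and where
  \<open>X\<^sub>t\<close> is finite, such an event is \<open>P\<close>-null as well. The explosion time is not known to be measurable
  here; completeness of \<open>P\<close> turns the subset of a null event into a null event.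
\<close>

lemma stays_at_infinity:
  assumes t: "0 \<le> t"
  shows "{\<omega> \<in> space P. explosion_time X \<omega> \<le> ennreal t \<and> X t \<omega> \<noteq> \<infinity>} \<in> null_sets P"
proof -
  let ?N = "{\<omega> \<in> space P. \<omega> \<in> unbounded_before t \<and> X t \<omega> \<noteq> \<infinity>}"
  note [measurable] = X_measurable_P[OF t] sets_F_P[OF t unbounded_before_measurable[OF t]]
  have "AE \<omega> in P. \<not> (\<omega> \<in> unbounded_before t \<and> X t \<omega> \<noteq> \<infinity>)"
    using Q_null_imp_exploded[OF t unbounded_before_measurable[OF t] Q_unbounded_before[OF t]]
    by eventually_elim auto
  then have "AE \<omega> in P. \<omega> \<notin> ?N" by eventually_elim auto
  then have N: "?N \<in> null_sets P" by (subst AE_iff_null_sets) auto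
  show ?thesis
  proof (rule null_set_F(2)[OF _ N t])
    show "{\<omega> \<in> space P. explosion_time X \<omega> \<le> ennreal t \<and> X t \<omega> \<noteq> \<infinity>} \<subseteq> ?N"
    proof
      fix \<omega> assume "\<omega> \<in> {\<omega> \<in> space P. explosion_time X \<omega> \<le> ennreal t \<and> X t \<omega> \<noteq> \<infinity>}"
      then have \<omega>: "\<omega> \<in> space P" "explosion_time X \<omega> \<le> ennreal t" "X t \<omega> \<noteq> \<infinity>" by auto
      obtain r where r: "0 \<le> r" "r \<le> t" "X r \<omega> = \<infinity>"
        using explosion_time_attained[OF \<omega>(1) t \<omega>(2)] by blast
      have "\<omega> \<in> unbounded_before t"
      proof (rule ccontr)
        assume "\<omega> \<notin> unbounded_before t"
        then obtain n :: nat where "X r \<omega> \<le> of_nat n"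
          using bounded_outside_unbounded_before[OF \<omega>(1)] r by blast
        then show False using r(3) by (simp add: top_unique)
      qed
      then show "\<omega> \<in> ?N" using \<omega> by blast
    qed
  qed
qed

lemma passage_time_less_iff:
  assumes \<omega>: "\<omega> \<in> space P" and u: "0 \<le> u"
  shows "passage_time X n \<omega> < ennreal u \<longleftrightarrow> (\<exists>q\<in>\<rat> \<inter> {0..<u}. of_nat n < X q \<omega>)"
proof
  assume "passage_time X n \<omega> < ennreal u"
  then obtain r where r: "0 \<le> r" "of_nat n < X r \<omega>" "ennreal r < ennreal u"
    by (auto simp: passage_time_def Inf_less_iff)
  then have "r < u" by (simp add: ennreal_less_iff)
  from exceed_at_rational[OF \<omega> r(1) this r(2)] r(1)
  show "\<exists>q\<in>\<rat> \<inter> {0..<u}. of_nat n < X q \<omega>" by force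
next
  assume "\<exists>q\<in>\<rat> \<inter> {0..<u}. of_nat n < X q \<omega>"
  then obtain q where q: "0 \<le> q" "q < u" "of_nat n < X q \<omega>" by auto
  then have "passage_time X n \<omega> \<le> ennreal q" unfolding passage_time_def by (intro Inf_lower) auto
  also have "\<dots> < ennreal u" using q by (simp add: ennreal_less_iff)
  finally show "passage_time X n \<omega> < ennreal u" .
qed

lemma passage_time_less_measurable:
  assumes u: "0 \<le> u"
  shows "{\<omega> \<in> space P. passage_time X n \<omega> < ennreal u} \<in> sets (F u)"
proof -
  have "{\<omega> \<in> space (F u). of_nat n < X q \<omega>} \<in> sets (F u)" if "q \<in> \<rat> \<inter> {0..<u}" for q
  proof -
    have "0 \<le> q" "q \<le> u" using that by auto
    note [measurable] = X_measurable_F[OF this]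
    show ?thesis by measurable
  qed
  moreover have "countable (\<rat> \<inter> {0..<u})" using countable_rat by (auto intro: countable_subset)
  ultimately have "{\<omega> \<in> space (F u). \<exists>q\<in>\<rat> \<inter> {0..<u}. of_nat n < X q \<omega>} \<in> sets (F u)"
    by (intro sets.sets_Collect_countable_Ex') auto
  also have "{\<omega> \<in> space (F u). \<exists>q\<in>\<rat> \<inter> {0..<u}. of_nat n < X q \<omega>} = {\<omega> \<in> space P. passage_time X n \<omega> < ennreal u}"
    using passage_time_less_iff[OF _ u] by (auto simp: space_F[OF u])
  finally show ?thesis .
qed

lemma passage_time_le_measurable:
  assumes t: "0 \<le> t"
  shows "{\<omega> \<in> space P. passage_time X n \<omega> \<le> ennreal t} \<in> sets (F t)"
proof (rule sets_F_right_continuous[OF t])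
  fix s assume s: "t < s"
  let ?u = "\<lambda>k. t + (s - t) / real (Suc k)"
  have u: "0 \<le> ?u k" "t < ?u k" "?u k \<le> s" for k
  proof -
    show "t < ?u k" using s by simp
    then show "0 \<le> ?u k" using t by linarith
    have "(s - t) / real (Suc k) \<le> (s - t) / 1" using s by (intro divide_left_mono) auto
    then show "?u k \<le> s" by simp
  qed
  have "{\<omega> \<in> space P. passage_time X n \<omega> \<le> ennreal t} = (\<Inter>k. {\<omega> \<in> space P. passage_time X n \<omega> < ennreal (?u k)})"
  proof (intro subset_antisym subsetI)
    fix \<omega> assume "\<omega> \<in> {\<omega> \<in> space P. passage_time X n \<omega> \<le> ennreal t}"
    then have "\<omega> \<in> space P" "passage_time X n \<omega> \<le> ennreal t" by auto
    moreover have "ennreal t < ennreal (?u k)" for k using u(2)[of k] t by (simp only: ennreal_less_iff)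
    ultimately show "\<omega> \<in> (\<Inter>k. {\<omega> \<in> space P. passage_time X n \<omega> < ennreal (?u k)})"
      by (auto intro: le_less_trans)
  next
    fix \<omega> assume \<omega>: "\<omega> \<in> (\<Inter>k. {\<omega> \<in> space P. passage_time X n \<omega> < ennreal (?u k)})"
    have "(\<lambda>k. ennreal (?u k)) \<longlonglongrightarrow> ennreal (t + 0)"
      using LIMSEQ_Suc[OF lim_const_over_n[of "s - t"]] by (intro tendsto_ennrealI tendsto_add tendsto_const) simp
    then have "passage_time X n \<omega> \<le> ennreal (t + 0)"
      by (rule LIMSEQ_le_const) (use \<omega> in \<open>auto intro: less_imp_le\<close>)
    then show "\<omega> \<in> {\<omega> \<in> space P. passage_time X n \<omega> \<le> ennreal t}" using \<omega> by simp
  qed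
  also have "\<dots> \<in> sets (F s)"
    using sets_F_mono[OF u(1) u(3) passage_time_less_measurable[OF u(1)]] by (intro sets.countable_INT') auto
  finally show "{\<omega> \<in> space P. passage_time X n \<omega> \<le> ennreal t} \<in> sets (F s)" .
qed

lemma passage_time_stopping: "ext_stopping_time F (passage_time X n)"
  unfolding ext_stopping_time_def
proof (intro allI impI)
  fix t :: real assume t: "0 \<le> t"
  have "{\<omega> \<in> space (F t). passage_time X n \<omega> \<le> ennreal t} \<in> sets (F t)"
    using passage_time_le_measurable[OF t] by (simp add: space_F[OF t])
  then show "Measurable.pred (F t) (\<lambda>\<omega>. passage_time X n \<omega> \<le> ennreal t)" by (simp add: pred_def)
qed

text \<open>
  This holds on every path, also on the exceptional ones that return from \<open>\<infinity>\<close>: the passage time does not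
  exceed the explosion time, so at \<open>min t \<sigma>\<^sub>n\<close> the path is at \<open>\<infinity>\<close> exactly if it explodes at that
  moment.
\<close>

lemma stopped_L:
  assumes \<omega>: "\<omega> \<in> space P" and t: "0 \<le> t"
  shows "stopped (L_proc X) (passage_time X n) t \<omega> = growth x0 (X (passage_clock X n t \<omega>) \<omega>)"
proof -
  let ?c = "passage_clock X n t \<omega>"
  note c = passage_clock[OF t, of X n \<omega>]
  have le: "ennreal ?c \<le> explosion_time X \<omega>"
    unfolding c(1) using passage_time_le_explosion_time[of X n \<omega>] by (auto simp: min_le_iff_disj)
  have "ennreal ?c < explosion_time X \<omega> \<longleftrightarrow> X ?c \<omega> \<noteq> \<infinity>"
  proof
    assume "ennreal ?c < explosion_time X \<omega>"
    then show "X ?c \<omega> \<noteq> \<infinity>" using explosion_time_le[OF c(2), of X \<omega>] by (auto simp: not_le[symmetric])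
  next
    assume fin: "X ?c \<omega> \<noteq> \<infinity>"
    show "ennreal ?c < explosion_time X \<omega>"
    proof (rule ccontr)
      assume "\<not> ennreal ?c < explosion_time X \<omega>"
      then have eq: "explosion_time X \<omega> = ennreal ?c" using le by simp
      then obtain r where "0 \<le> r" "explosion_time X \<omega> = ennreal r" "X r \<omega> = \<infinity>"
        using explosion_time_attained[OF \<omega> c(2)] by auto
      then show False using eq fin c(2) by simp
    qed
  qed
  then show ?thesis
    using X_0 \<omega> x0_pos
    by (auto simp: stopped_def passage_clock_def[symmetric] L_proc_def M_proc_def growth_def exp_minus[symmetric] divide_inverse)
qed

lemma sampled_lim:
  assumes \<omega>: "\<omega> \<in> space P" and s: "0 \<le> s" and r: "s \<le> r" "r \<le> t"
  shows "(\<lambda>k. X (grid_point s t (Suc k) (grid_index s t (Suc k) r)) \<omega>) \<longlonglongrightarrow> X r \<omega>"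
proof (rule topological_tendstoI)
  fix U assume "open U" "X r \<omega> \<in> U"
  then obtain b where b: "r < b" "\<And>y. r \<le> y \<Longrightarrow> y < b \<Longrightarrow> X y \<omega> \<in> U"
    using X_right_nearby[OF \<omega>, of r U] s r by auto
  have "eventually (\<lambda>k. grid_point s t (Suc k) (grid_index s t (Suc k) r) < b) sequentially"
    using order_tendstoD(2)[OF grid_point_index_lim[OF r] b(1)] .
  then show "eventually (\<lambda>k. X (grid_point s t (Suc k) (grid_index s t (Suc k) r)) \<omega> \<in> U) sequentially"
    by eventually_elim (use grid_point_index_bounds(1)[OF r] b(2) in auto)
qed

lemma grid_index_measurable:
  assumes s: "0 \<le> s" "s < t" and \<rho>: "\<And>\<omega>. \<omega> \<in> space P \<Longrightarrow> s \<le> \<rho> \<omega> \<and> \<rho> \<omega> \<le> t"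
    and meas: "\<And>u. s < u \<Longrightarrow> u \<le> t \<Longrightarrow> {\<omega> \<in> space P. \<rho> \<omega> < u} \<in> sets (F u)"
    and N: "0 < N" and j: "j \<le> N"
  shows "{\<omega> \<in> space P. grid_index s t N (\<rho> \<omega>) = j} \<in> sets (F (grid_point s t N j))"
proof -
  let ?g = "grid_point s t N"
  have st: "s \<le> t" using s by simp
  have g0: "0 \<le> ?g i" if "i \<le> N" for i using grid_point_bounds(1)[OF st that N] s by simp
  have mono: "?g i \<le> ?g j" if "i \<le> j" for i
    using that st N by (auto simp: grid_point_def intro!: divide_right_mono mult_left_mono)
  have sp: "space (F (?g j)) = space P" by (rule space_F[OF g0[OF j]])
  have less: "{\<omega> \<in> space (F (?g j)). \<rho> \<omega> < ?g i} \<in> sets (F (?g j))" if i: "i \<le> j" for i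
  proof (cases "i = 0")
    case True
    have "{\<omega> \<in> space (F (?g j)). \<rho> \<omega> < ?g i} = {}"
      unfolding sp using True \<rho> by (auto simp: grid_point_def not_less)
    then show ?thesis by (simp only: sets.empty_sets)
  next
    case False
    have iN: "i \<le> N" using i j by simp
    have "s < ?g i" using False s N by (simp add: grid_point_def)
    from meas[OF this grid_point_bounds(2)[OF st iN N]]
    have "{\<omega> \<in> space P. \<rho> \<omega> < ?g i} \<in> sets (F (?g j))"
      by (rule sets_F_mono[OF g0[OF iN] mono[OF i]])
    then show ?thesis by (simp add: space_F[OF g0[OF j]])
  qed
  have "{\<omega> \<in> space (F (?g j)). (j = N \<or> \<rho> \<omega> < ?g j) \<and> (\<forall>i\<in>{..<j}. \<not> \<rho> \<omega> < ?g i)} \<in> sets (F (?g j))"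
    using less by (intro sets.sets_Collect_conj sets.sets_Collect_disj sets.sets_Collect_finite_All sets.sets_Collect_neg) auto
  also have "{\<omega> \<in> space (F (?g j)). (j = N \<or> \<rho> \<omega> < ?g j) \<and> (\<forall>i\<in>{..<j}. \<not> \<rho> \<omega> < ?g i)}
      = {\<omega> \<in> space P. grid_index s t N (\<rho> \<omega>) = j}"
    using j by (auto simp: space_F[OF g0[OF j]] grid_index_eq_iff not_less)
  finally show ?thesis .
qed

context
  fixes s t :: real and \<rho> :: "'a \<Rightarrow> real"
  assumes s: "0 \<le> s" "s < t" and \<rho>: "\<And>\<omega>. \<omega> \<in> space P \<Longrightarrow> s \<le> \<rho> \<omega> \<and> \<rho> \<omega> \<le> t"
    and \<rho>_meas: "\<And>u. s < u \<Longrightarrow> u \<le> t \<Longrightarrow> {\<omega> \<in> space P. \<rho> \<omega> < u} \<in> sets (F u)"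
begin

private lemma st: "s \<le> t" "0 \<le> t" using s by auto

lemma grid_sampled_measurable:
  assumes N: "0 < N"
  shows "(\<lambda>\<omega>. X (grid_point s t N (grid_index s t N (\<rho> \<omega>))) \<omega>) \<in> borel_measurable (F t)"
proof (rule measurable_compose_countable'[where I = "{..N}"])
  have gp: "0 \<le> grid_point s t N i" "grid_point s t N i \<le> t" if "i \<le> N" for i
    using grid_point_bounds[OF st(1) that N] s by auto
  show "(\<lambda>\<omega>. X (grid_point s t N i) \<omega>) \<in> borel_measurable (F t)" if "i \<in> {..N}" for i
    using X_measurable_F[OF gp] that by auto
  show "(\<lambda>\<omega>. grid_index s t N (\<rho> \<omega>)) \<in> measurable (F t) (count_space {..N})"
  proof (subst measurable_count_space_eq2[OF finite_atMost], intro conjI ballI)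
    show "(\<lambda>\<omega>. grid_index s t N (\<rho> \<omega>)) \<in> space (F t) \<rightarrow> {..N}" by (auto simp: grid_index_le)
    fix j assume "j \<in> {..N}"
    then have j: "j \<le> N" by simp
    have "{\<omega> \<in> space P. grid_index s t N (\<rho> \<omega>) = j} \<in> sets (F t)"
      by (rule sets_F_mono[OF gp[OF j] grid_index_measurable[OF s \<rho> \<rho>_meas N j]])
    also have "{\<omega> \<in> space P. grid_index s t N (\<rho> \<omega>) = j} = (\<lambda>\<omega>. grid_index s t N (\<rho> \<omega>)) -` {j} \<inter> space (F t)"
      by (auto simp: space_F[OF st(2)])
    finally show "(\<lambda>\<omega>. grid_index s t N (\<rho> \<omega>)) -` {j} \<inter> space (F t) \<in> sets (F t)" .
  qed
qed (simp add: countable_finite)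

lemma sampled_measurable: "(\<lambda>\<omega>. X (\<rho> \<omega>) \<omega>) \<in> borel_measurable (F t)"
proof (rule borel_measurable_LIMSEQ_order)
  show "(\<lambda>\<omega>. X (grid_point s t (Suc k) (grid_index s t (Suc k) (\<rho> \<omega>))) \<omega>) \<in> borel_measurable (F t)" for k
    by (rule grid_sampled_measurable) simp
  fix \<omega> assume "\<omega> \<in> space (F t)"
  then have \<omega>: "\<omega> \<in> space P" by (simp add: space_F[OF st(2)])
  show "(\<lambda>k. X (grid_point s t (Suc k) (grid_index s t (Suc k) (\<rho> \<omega>))) \<omega>) \<longlonglongrightarrow> X (\<rho> \<omega>) \<omega>"
    using sampled_lim[OF \<omega> s(1)] \<rho>[OF \<omega>] by blast
qed

text \<open>
  A change of measure at the random time \<open>\<rho>\<close>. On a grid it is a finite sum of changes of measure at fixed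
  times, one for each event that \<open>\<rho>\<close> is rounded up to a given grid point; refining the grid gives the
  claim by right-continuity and bounded convergence.
\<close>

lemma change_of_measure_sampled:
  fixes \<psi> g :: "ennreal \<Rightarrow>\<^sub>C real"
  assumes A: "A \<in> sets (F s)"
    and g: "\<And>x. apply_bcontfun g x = (if x = \<infinity> then 0 else exp (- (enn2real x - x0)) * apply_bcontfun \<psi> x)"
  shows "(\<integral>\<omega>. indicator A \<omega> * apply_bcontfun \<psi> (X (\<rho> \<omega>) \<omega>) \<partial>Q)
    = (\<integral>\<omega>. indicator A \<omega> * apply_bcontfun g (X (\<rho> \<omega>) \<omega>) \<partial>P)"
proof -
  define Y where "Y k \<omega> = X (grid_point s t (Suc k) (grid_index s t (Suc k) (\<rho> \<omega>))) \<omega>" for k \<omega>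
  have A_P: "A \<in> sets P" by (rule sets_F_P[OF s(1) A])
  have A_Q: "A \<in> sets Q" using A_P sets_Q by simp
  have meas: "(\<lambda>\<omega>. indicator A \<omega> * apply_bcontfun f (Z \<omega>)) \<in> borel_measurable M"
    if "Z \<in> borel_measurable (F t)" "subalgebra M (F t)" "A \<in> sets M" for f :: "ennreal \<Rightarrow>\<^sub>C real" and Z M
  proof -
    have "(\<lambda>\<omega>. apply_bcontfun f (Z \<omega>)) \<in> borel_measurable M"
      by (rule measurable_compose[OF measurable_from_subalg[OF that(2,1)] borel_measurable_continuous_onI]) simp
    then show ?thesis using that(3) by measurable
  qed
  have Y_meas: "Y k \<in> borel_measurable (F t)" for k
    unfolding Y_def[abs_def] by (rule grid_sampled_measurable) simp
  have lim: "(\<lambda>k. \<integral>\<omega>. indicator A \<omega> * apply_bcontfun f (Y k \<omega>) \<partial>M)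
      \<longlonglongrightarrow> (\<integral>\<omega>. indicator A \<omega> * apply_bcontfun f (X (\<rho> \<omega>) \<omega>) \<partial>M)"
    if M: "subalgebra M (F t)" "A \<in> sets M" "finite_measure M" "space M = space P"
    for f :: "ennreal \<Rightarrow>\<^sub>C real" and M
  proof (rule integral_dominated_convergence[where w = "\<lambda>_. norm f"])
    interpret finite_measure M by (rule M(3))
    show "integrable M (\<lambda>_. norm f)" by simp
    show "AE \<omega> in M. (\<lambda>k. indicator A \<omega> * apply_bcontfun f (Y k \<omega>)) \<longlonglongrightarrow> indicator A \<omega> * apply_bcontfun f (X (\<rho> \<omega>) \<omega>)"
    proof (rule AE_I2)
      fix \<omega> assume "\<omega> \<in> space M"
      then have \<omega>: "\<omega> \<in> space P" by (simp add: M(4))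
      have "isCont (apply_bcontfun f) (X (\<rho> \<omega>) \<omega>)"
        using iffD1[OF continuous_on_eq_continuous_at[OF open_UNIV] continuous_on_apply_bcontfun[of UNIV f]] by blast
      moreover have "(\<lambda>k. Y k \<omega>) \<longlonglongrightarrow> X (\<rho> \<omega>) \<omega>"
        unfolding Y_def using sampled_lim[OF \<omega> s(1)] \<rho>[OF \<omega>] by blast
      ultimately show "(\<lambda>k. indicator A \<omega> * apply_bcontfun f (Y k \<omega>)) \<longlonglongrightarrow> indicator A \<omega> * apply_bcontfun f (X (\<rho> \<omega>) \<omega>)"
        by (intro tendsto_mult[OF tendsto_const] isCont_tendsto_compose[of _ "apply_bcontfun f"])
    qed
    show "AE \<omega> in M. norm (indicator A \<omega> * apply_bcontfun f (Y k \<omega>)) \<le> norm f" for k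
      using norm_bounded[of f] by (intro AE_I2) (auto simp: indicator_def)
    show "(\<lambda>\<omega>. indicator A \<omega> * apply_bcontfun f (X (\<rho> \<omega>) \<omega>)) \<in> borel_measurable M"
      by (rule meas[OF sampled_measurable M(1,2)])
    show "(\<lambda>\<omega>. indicator A \<omega> * apply_bcontfun f (Y k \<omega>)) \<in> borel_measurable M" for k
      by (rule meas[OF Y_meas M(1,2)])
  qed
  have eq: "(\<integral>\<omega>. indicator A \<omega> * apply_bcontfun \<psi> (Y k \<omega>) \<partial>Q) = (\<integral>\<omega>. indicator A \<omega> * apply_bcontfun g (Y k \<omega>) \<partial>P)" for k
  proof -
    define N where "N = Suc k"
    have N: "0 < N" by (simp add: N_def)
    let ?g = "grid_point s t N"
    define B where "B j = {\<omega> \<in> space P. grid_index s t N (\<rho> \<omega>) = j}" for j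
    have gp: "0 \<le> ?g i" "s \<le> ?g i" if "i \<le> N" for i
      using grid_point_bounds[OF st(1) that N] s by auto
    have AB: "A \<inter> B j \<in> sets (F (?g j))" if "j \<le> N" for j
      unfolding B_def
      using sets_F_mono[OF s(1) gp(2)[OF that] A] grid_index_measurable[OF s \<rho> \<rho>_meas N that]
      by (intro sets.Int) auto
    have decomp: "indicator A \<omega> * apply_bcontfun f (Y k \<omega>)
        = (\<Sum>j\<le>N. indicator (A \<inter> B j) \<omega> * apply_bcontfun f (X (?g j) \<omega>))"
      if \<omega>: "\<omega> \<in> space P" for \<omega> and f :: "ennreal \<Rightarrow>\<^sub>C real"
    proof -
      let ?i = "grid_index s t N (\<rho> \<omega>)"
      have "(\<Sum>j\<le>N. indicator (A \<inter> B j) \<omega> * apply_bcontfun f (X (?g j) \<omega>))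
          = (\<Sum>j\<le>N. if j = ?i then indicator A \<omega> * apply_bcontfun f (X (?g j) \<omega>) else 0)"
        by (intro sum.cong refl) (use \<omega> in \<open>auto simp: B_def indicator_def\<close>)
      also have "\<dots> = indicator A \<omega> * apply_bcontfun f (X (?g ?i) \<omega>)"
        using grid_index_le by (subst sum.delta) auto
      finally show ?thesis by (simp add: Y_def N_def)
    qed
    have AB_P: "A \<inter> B j \<in> sets P" if "j \<le> N" for j by (rule sets_F_P[OF gp(1)[OF that] AB[OF that]])
    have int: "integrable M (\<lambda>\<omega>. indicator (A \<inter> B j) \<omega> * apply_bcontfun f (X (?g j) \<omega>))"
      if "j \<le> N" "finite_measure M" "sets M = sets P" for j M and f :: "ennreal \<Rightarrow>\<^sub>C real"
    proof -
      interpret finite_measure M by (rule that(2))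
      have "X (?g j) \<in> borel_measurable M"
        using X_measurable_P[OF gp(1)[OF that(1)]] by (simp add: measurable_cong_sets[OF that(3) refl])
      then have [measurable]: "(\<lambda>\<omega>. apply_bcontfun f (X (?g j) \<omega>)) \<in> borel_measurable M"
        by (rule measurable_compose[OF _ borel_measurable_continuous_onI]) simp
      have [measurable]: "A \<inter> B j \<in> sets M" using AB_P[OF that(1)] that(3) by simp
      show ?thesis
      proof (rule integrable_const_bound[where B = "norm f"])
        show "AE \<omega> in M. norm (indicator (A \<inter> B j) \<omega> * apply_bcontfun f (X (?g j) \<omega>)) \<le> norm f"
          using norm_bounded[of f] by (intro AE_I2) (auto simp: indicator_def)
      qed measurable
    qed
    have "(\<integral>\<omega>. indicator A \<omega> * apply_bcontfun \<psi> (Y k \<omega>) \<partial>Q)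
        = (\<integral>\<omega>. (\<Sum>j\<le>N. indicator (A \<inter> B j) \<omega> * apply_bcontfun \<psi> (X (?g j) \<omega>)) \<partial>Q)"
      by (intro Bochner_Integration.integral_cong refl decomp) (simp add: space_Q)
    also have "\<dots> = (\<Sum>j\<le>N. \<integral>\<omega>. indicator (A \<inter> B j) \<omega> * apply_bcontfun \<psi> (X (?g j) \<omega>) \<partial>Q)"
      by (intro Bochner_Integration.integral_sum int) (auto simp: sets_Q Q.finite_measure_axioms)
    also have "\<dots> = (\<Sum>j\<le>N. \<integral>\<omega>. indicator (A \<inter> B j) \<omega> * apply_bcontfun g (X (?g j) \<omega>) \<partial>P)"
    proof (intro sum.cong refl)
      fix j assume "j \<in> {..N}"
      then have j: "j \<le> N" by simp
      note [measurable] = apply_bcontfun_X_measurable[OF gp(1)[OF j] order_refl] AB[OF j]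
      have "(\<integral>\<omega>. indicator (A \<inter> B j) \<omega> * apply_bcontfun \<psi> (X (?g j) \<omega>) \<partial>Q)
          = (\<integral>\<omega>. M_proc X (?g j) \<omega> * (indicator (A \<inter> B j) \<omega> * apply_bcontfun \<psi> (X (?g j) \<omega>)) \<partial>P)"
        by (rule change_of_measure(1)[OF gp(1)[OF j]]) measurable
      also have "\<dots> = (\<integral>\<omega>. indicator (A \<inter> B j) \<omega> * apply_bcontfun g (X (?g j) \<omega>) \<partial>P)"
        by (intro Bochner_Integration.integral_cong refl) (use X_0 x0_pos in \<open>auto simp: g M_proc_def\<close>)
      finally show "(\<integral>\<omega>. indicator (A \<inter> B j) \<omega> * apply_bcontfun \<psi> (X (?g j) \<omega>) \<partial>Q)
          = (\<integral>\<omega>. indicator (A \<inter> B j) \<omega> * apply_bcontfun g (X (?g j) \<omega>) \<partial>P)" .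
    qed
    also have "\<dots> = (\<integral>\<omega>. (\<Sum>j\<le>N. indicator (A \<inter> B j) \<omega> * apply_bcontfun g (X (?g j) \<omega>)) \<partial>P)"
      by (intro Bochner_Integration.integral_sum[symmetric] int) (auto simp: P.finite_measure_axioms)
    also have "\<dots> = (\<integral>\<omega>. indicator A \<omega> * apply_bcontfun g (Y k \<omega>) \<partial>P)"
      by (intro Bochner_Integration.integral_cong refl decomp[symmetric])
    finally show ?thesis .
  qed
  have "(\<lambda>k. \<integral>\<omega>. indicator A \<omega> * apply_bcontfun \<psi> (Y k \<omega>) \<partial>Q)
      \<longlonglongrightarrow> (\<integral>\<omega>. indicator A \<omega> * apply_bcontfun \<psi> (X (\<rho> \<omega>) \<omega>) \<partial>Q)"
    by (rule lim[OF subalgebra_Q[OF st(2)] A_Q Q.finite_measure_axioms space_Q])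
  moreover have "(\<lambda>k. \<integral>\<omega>. indicator A \<omega> * apply_bcontfun g (Y k \<omega>) \<partial>P)
      \<longlonglongrightarrow> (\<integral>\<omega>. indicator A \<omega> * apply_bcontfun g (X (\<rho> \<omega>) \<omega>) \<partial>P)"
    by (rule lim[OF subalgebra_P[OF st(2)] A_P P.finite_measure_axioms refl])
  ultimately show ?thesis unfolding eq by (rule LIMSEQ_unique)
qed

text \<open>
  \<open>growth x\<^sub>0\<close> is unbounded, and \<open>X\<close> may overshoot the passage level by a jump of any size. It is the
  increasing limit of its products with the cutoffs \<open>cut K\<close>, which are covered by the previous lemma.
\<close>

lemma growth_sampled:
  assumes A: "A \<in> sets (F s)"
  shows "integrable Q (\<lambda>\<omega>. indicator A \<omega> * growth x0 (X (\<rho> \<omega>) \<omega>))"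
    and "(\<integral>\<omega>. indicator A \<omega> * growth x0 (X (\<rho> \<omega>) \<omega>) \<partial>Q) = measure P {\<omega> \<in> A. X (\<rho> \<omega>) \<omega> < \<infinity>}"
proof -
  have A_P: "A \<in> sets P" by (rule sets_F_P[OF s(1) A])
  have X\<rho>: "(\<lambda>\<omega>. X (\<rho> \<omega>) \<omega>) \<in> borel_measurable P" "(\<lambda>\<omega>. X (\<rho> \<omega>) \<omega>) \<in> borel_measurable Q"
    using measurable_from_subalg[OF subalgebra_P[OF st(2)] sampled_measurable]
      measurable_from_subalg[OF subalgebra_Q[OF st(2)] sampled_measurable] by auto
  note [measurable] = A_P X\<rho>
  have [measurable]: "A \<in> sets Q" using A_P sets_Q by simp
  define g where "g K = extend_to_infinity (cut K)" for K
  define \<psi> where "\<psi> K = extend_to_infinity (\<lambda>x. exp (x - x0) * cut K x)" for K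
  have cut_lim: "(cut K \<longlongrightarrow> 0) at_top" "((\<lambda>x. exp (x - x0) * cut K x) \<longlongrightarrow> 0) at_top" for K
    using cut_eventually_0[of K] by (auto intro!: tendsto_eventually elim: eventually_mono)
  have g: "apply_bcontfun (g K) x = (if x = \<infinity> then 0 else cut K (enn2real x))" for K x
    unfolding g_def by (subst extend_to_infinity_apply) (auto intro: cut_continuous cut_lim)
  have \<psi>: "apply_bcontfun (\<psi> K) x = growth x0 x * apply_bcontfun (g K) x" for K x
    unfolding \<psi>_def g by (subst extend_to_infinity_apply)
      (auto intro!: continuous_intros cut_continuous cut_lim simp: growth_def)
  have g_lim: "(\<lambda>K. apply_bcontfun (g K) x) \<longlonglongrightarrow> indicator {..<\<infinity>} x" for x
  proof (cases "x = \<infinity>")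
    case False
    have "eventually (\<lambda>K. apply_bcontfun (g K) x = 1) sequentially"
    proof -
      obtain K0 :: nat where "enn2real x \<le> real K0" using real_arch_simple by blast
      then show ?thesis
        using False by (intro eventually_sequentiallyI[of K0]) (auto simp: g intro!: cut_bounds(4))
    qed
    then show ?thesis using False by (intro tendsto_eventually) (auto simp: less_top[symmetric])
  qed (simp add: g)
  have eq: "(\<integral>\<omega>. indicator A \<omega> * apply_bcontfun (\<psi> K) (X (\<rho> \<omega>) \<omega>) \<partial>Q)
      = (\<integral>\<omega>. indicator A \<omega> * apply_bcontfun (g K) (X (\<rho> \<omega>) \<omega>) \<partial>P)" for K
    by (rule change_of_measure_sampled[OF A]) (simp add: \<psi> growth_def g mult.assoc[symmetric] exp_add[symmetric])
  have meas_b [measurable]: "(\<lambda>\<omega>. apply_bcontfun f (X (\<rho> \<omega>) \<omega>)) \<in> borel_measurable P"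
      "(\<lambda>\<omega>. apply_bcontfun f (X (\<rho> \<omega>) \<omega>)) \<in> borel_measurable Q" for f :: "ennreal \<Rightarrow>\<^sub>C real"
    by (rule measurable_compose[OF X\<rho>(1) borel_measurable_continuous_onI], simp,
        rule measurable_compose[OF X\<rho>(2) borel_measurable_continuous_onI], simp)
  have limP: "(\<lambda>K. \<integral>\<omega>. indicator A \<omega> * apply_bcontfun (g K) (X (\<rho> \<omega>) \<omega>) \<partial>P)
      \<longlonglongrightarrow> (\<integral>\<omega>. indicator A \<omega> * indicator {..<\<infinity>} (X (\<rho> \<omega>) \<omega>) \<partial>P)"
  proof (rule integral_dominated_convergence[where w = "\<lambda>_. 1"])
    show "AE \<omega> in P. (\<lambda>K. indicator A \<omega> * apply_bcontfun (g K) (X (\<rho> \<omega>) \<omega>))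
        \<longlonglongrightarrow> indicator A \<omega> * indicator {..<\<infinity>} (X (\<rho> \<omega>) \<omega>)"
      by (intro AE_I2 tendsto_mult tendsto_const g_lim)
    show "AE \<omega> in P. norm (indicator A \<omega> * apply_bcontfun (g K) (X (\<rho> \<omega>) \<omega>)) \<le> 1" for K
      by (intro AE_I2) (auto simp: g indicator_def cut_bounds)
  qed auto
  have "(\<integral>\<omega>. indicator A \<omega> * indicator {..<\<infinity>} (X (\<rho> \<omega>) \<omega>) \<partial>P)
      = (\<integral>\<omega>. (indicator :: _ \<Rightarrow> _ \<Rightarrow> real) {\<omega> \<in> A. X (\<rho> \<omega>) \<omega> < \<infinity>} \<omega> \<partial>P)"
    by (intro Bochner_Integration.integral_cong) (auto simp: indicator_def)
  also have "\<dots> = measure P ({\<omega> \<in> A. X (\<rho> \<omega>) \<omega> < \<infinity>} \<inter> space P)"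
    by simp
  also have "{\<omega> \<in> A. X (\<rho> \<omega>) \<omega> < \<infinity>} \<inter> space P = {\<omega> \<in> A. X (\<rho> \<omega>) \<omega> < \<infinity>}"
    using sets.sets_into_space[OF A_P] by auto
  finally have P_eq: "(\<integral>\<omega>. (indicator :: _ \<Rightarrow> _ \<Rightarrow> real) A \<omega> * indicator {..<\<infinity>} (X (\<rho> \<omega>) \<omega>) \<partial>P) = measure P {\<omega> \<in> A. X (\<rho> \<omega>) \<omega> < \<infinity>}" .
  have int: "integrable Q (\<lambda>\<omega>. indicator A \<omega> * apply_bcontfun (\<psi> K) (X (\<rho> \<omega>) \<omega>))" for K
    by (rule Q.integrable_const_bound[where B = "norm (\<psi> K)"])
       (use norm_bounded[of "\<psi> K"] in \<open>auto simp: indicator_def\<close>)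
  have mono: "AE \<omega> in Q. mono (\<lambda>K. indicator A \<omega> * apply_bcontfun (\<psi> K) (X (\<rho> \<omega>) \<omega>))"
    by (intro AE_I2 monoI mult_left_mono) (auto simp: \<psi> g growth_nonneg intro!: mult_left_mono cut_bounds)
  have pos: "AE \<omega> in Q. 0 \<le> indicator A \<omega> * apply_bcontfun (\<psi> K) (X (\<rho> \<omega>) \<omega>)" for K
    by (intro AE_I2 mult_nonneg_nonneg) (auto simp: \<psi> g growth_nonneg cut_bounds)
  have lim: "AE \<omega> in Q. (\<lambda>K. indicator A \<omega> * apply_bcontfun (\<psi> K) (X (\<rho> \<omega>) \<omega>))
      \<longlonglongrightarrow> indicator A \<omega> * growth x0 (X (\<rho> \<omega>) \<omega>)"
  proof (rule AE_I2)
    fix \<omega>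
    have "(\<lambda>K. indicator A \<omega> * (growth x0 (X (\<rho> \<omega>) \<omega>) * apply_bcontfun (g K) (X (\<rho> \<omega>) \<omega>)))
      \<longlonglongrightarrow> indicator A \<omega> * (growth x0 (X (\<rho> \<omega>) \<omega>) * indicator {..<\<infinity>} (X (\<rho> \<omega>) \<omega>))"
      by (intro tendsto_mult tendsto_const g_lim)
    moreover have "growth x0 (X (\<rho> \<omega>) \<omega>) * indicator {..<\<infinity>} (X (\<rho> \<omega>) \<omega>) = growth x0 (X (\<rho> \<omega>) \<omega>)"
      by (auto simp: growth_def indicator_def less_top[symmetric])
    ultimately show "(\<lambda>K. indicator A \<omega> * apply_bcontfun (\<psi> K) (X (\<rho> \<omega>) \<omega>))
      \<longlonglongrightarrow> indicator A \<omega> * growth x0 (X (\<rho> \<omega>) \<omega>)" by (simp only: \<psi>)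
  qed
  have ilim: "(\<lambda>K. \<integral>\<omega>. indicator A \<omega> * apply_bcontfun (\<psi> K) (X (\<rho> \<omega>) \<omega>) \<partial>Q) \<longlonglongrightarrow> measure P {\<omega> \<in> A. X (\<rho> \<omega>) \<omega> < \<infinity>}"
    using limP unfolding eq P_eq .
  have meas: "(\<lambda>\<omega>. indicator A \<omega> * growth x0 (X (\<rho> \<omega>) \<omega>)) \<in> borel_measurable Q" by measurable
  show "integrable Q (\<lambda>\<omega>. indicator A \<omega> * growth x0 (X (\<rho> \<omega>) \<omega>))"
    "(\<integral>\<omega>. indicator A \<omega> * growth x0 (X (\<rho> \<omega>) \<omega>) \<partial>Q) = measure P {\<omega> \<in> A. X (\<rho> \<omega>) \<omega> < \<infinity>}"
    using integral_monotone_convergence_nonneg[OF int mono pos lim ilim meas] by auto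
qed

end

section \<open>The local martingale property\<close>

lemma passage_clock_less_measurable:
  assumes "0 \<le> s" "s < u" "u \<le> t"
  shows "{\<omega> \<in> space P. max s (passage_clock X n t \<omega>) < u} \<in> sets (F u)"
proof -
  have "{\<omega> \<in> space P. max s (passage_clock X n t \<omega>) < u} = {\<omega> \<in> space P. passage_time X n \<omega> < ennreal u}"
    using assms passage_clock_less_iff[of t u X n] by auto
  then show ?thesis using passage_time_less_measurable[of u n] assms by simp
qed

lemma sampled_at_passage:
  assumes s: "0 \<le> s" "s < t" and A: "A \<in> sets (F s)"
  shows "integrable Q (\<lambda>\<omega>. indicator A \<omega> * growth x0 (X (max s (passage_clock X n t \<omega>)) \<omega>))"
    and "(\<integral>\<omega>. indicator A \<omega> * growth x0 (X (max s (passage_clock X n t \<omega>)) \<omega>) \<partial>Q)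
      = measure P {\<omega> \<in> A. X (max s (passage_clock X n t \<omega>)) \<omega> < \<infinity>}"
    and "(\<lambda>\<omega>. X (max s (passage_clock X n t \<omega>)) \<omega>) \<in> borel_measurable (F t)"
proof -
  have t: "0 \<le> t" using s by simp
  have bounds: "s \<le> max s (passage_clock X n t \<omega>) \<and> max s (passage_clock X n t \<omega>) \<le> t" for \<omega>
    using passage_clock(3)[OF t, of X n \<omega>] s by simp
  note * = s bounds passage_clock_less_measurable[OF s(1)]
  show "integrable Q (\<lambda>\<omega>. indicator A \<omega> * growth x0 (X (max s (passage_clock X n t \<omega>)) \<omega>))"
    by (rule growth_sampled(1)[OF * A])
  show "(\<integral>\<omega>. indicator A \<omega> * growth x0 (X (max s (passage_clock X n t \<omega>)) \<omega>) \<partial>Q)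
      = measure P {\<omega> \<in> A. X (max s (passage_clock X n t \<omega>)) \<omega> < \<infinity>}"
    by (rule growth_sampled(2)[OF * A])
  show "(\<lambda>\<omega>. X (max s (passage_clock X n t \<omega>)) \<omega>) \<in> borel_measurable (F t)"
    by (rule sampled_measurable[OF *])
qed

lemma X_clock_measurable:
  assumes t: "0 \<le> t"
  shows "(\<lambda>\<omega>. X (passage_clock X n t \<omega>) \<omega>) \<in> borel_measurable (F t)"
proof (cases "t = 0")
  case True
  have "passage_clock X n t \<omega> = 0" for \<omega>
    using passage_clock(2,3)[OF t, of X n \<omega>] True by simp
  then show ?thesis using X_measurable_F[of 0 t] t by simp
next
  case False
  have "max 0 (passage_clock X n t \<omega>) = passage_clock X n t \<omega>" for \<omega>
    using passage_clock(2)[OF t, of X n \<omega>] by simp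
  then show ?thesis using sampled_at_passage(3)[of 0 t "{}" n] t False by simp
qed

text \<open>
  If \<open>X\<close> is at \<open>\<infinity>\<close> at time \<open>min t \<sigma>\<^sub>n\<close>, this is the explosion time, and before it \<open>X\<close> is at most \<open>n\<close>.
  So on every grid some step leads from \<open>[0, n]\<close> to \<open>\<infinity>\<close>, where \<open>X\<close> almost surely still is at the end of the
  step. With \<open>N\<close> steps of length \<open>t / N\<close> this has probability at most \<open>N n (t / N)\<^sup>2\<close>.
\<close>

lemma no_jump_to_infinity:
  assumes t: "0 < t"
  shows "measure P {\<omega> \<in> space P. X (passage_clock X n t \<omega>) \<omega> = \<infinity>} = 0"
proof -
  let ?E = "{\<omega> \<in> space P. X (passage_clock X n t \<omega>) \<omega> = \<infinity>}"
  have t0: "0 \<le> t" using t by simp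
  have bound: "measure P ?E \<le> real n * t\<^sup>2 / real (Suc m)" for m
  proof -
    define N where "N = Suc m"
    have N: "0 < N" by (simp add: N_def)
    define h where "h = t / real N"
    have h: "0 < h" "real N * h = t" using t N by (auto simp: h_def)
    let ?u = "\<lambda>i. real i * h"
    have u: "0 \<le> ?u i" for i using h by simp
    \<comment> \<open>\<open>J i\<close>: a jump to infinity in the \<open>i\<close>-th step; \<open>Z i\<close>: a path that has returned from infinity by the
      end of this step\<close>
    define J where "J i = {\<omega> \<in> space P. X (?u i) \<omega> \<le> of_nat n \<and> X (?u i + h) \<omega> = \<infinity>}" for i
    define Z where "Z i = {\<omega> \<in> space P. explosion_time X \<omega> \<le> ennreal (?u (Suc i)) \<and> X (?u (Suc i)) \<omega> \<noteq> \<infinity>}" for i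
    have J_P: "J i \<in> sets P" for i
    proof -
      have uh: "0 \<le> ?u i + h" using u[of i] h by simp
      note [measurable] = X_measurable_P[OF u[of i]] X_measurable_P[OF uh]
      show ?thesis unfolding J_def by measurable
    qed
    have Z_null: "Z i \<in> null_sets P" for i
      unfolding Z_def by (rule stays_at_infinity[OF u])
    have sub: "?E \<subseteq> (\<Union>i<N. J i) \<union> (\<Union>i<N. Z i)"
    proof
      fix \<omega> assume "\<omega> \<in> ?E"
      then have \<omega>: "\<omega> \<in> space P" and inf: "X (passage_clock X n t \<omega>) \<omega> = \<infinity>" by auto
      let ?c = "passage_clock X n t \<omega>"
      note c = passage_clock[OF t0, of X n \<omega>]
      have c_pos: "0 < ?c" using inf X_0 \<omega> c(2) by (cases "?c = 0") auto
      have expl: "explosion_time X \<omega> \<le> ennreal ?c" using c(2) inf by (rule explosion_time_le[of "?c" X \<omega>])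
      have "\<exists>j. ?c \<le> ?u j" using h c(3) by metis
      define k where "k = (LEAST j. ?c \<le> ?u j)"
      have k: "?c \<le> ?u k" unfolding k_def using \<open>\<exists>j. ?c \<le> ?u j\<close> by (rule LeastI_ex)
      have k_le: "k \<le> N" unfolding k_def using h c(3) by (intro Least_le) simp
      have "k \<noteq> 0" using k c_pos by (cases k) auto
      then obtain i where i: "k = Suc i" by (cases k) auto
      have ui: "?u i < ?c" using not_less_Least[of i "\<lambda>j. ?c \<le> ?u j"] i k_def by auto
      have "ennreal (?u i) < passage_time X n \<omega>"
      proof -
        have "ennreal (?u i) < ennreal ?c" using ui u by (simp only: ennreal_less_iff)
        also have "\<dots> \<le> passage_time X n \<omega>" unfolding c(1) by simp
        finally show ?thesis .
      qed
      then have le_n: "X (?u i) \<omega> \<le> of_nat n" by (rule before_passage_time[of "?u i" X n \<omega>, OF u])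
      have "explosion_time X \<omega> \<le> ennreal (?u (Suc i))"
        using expl k i by (metis ennreal_leI order_trans)
      moreover have "?u i + h = ?u (Suc i)" by (simp add: algebra_simps)
      ultimately have "\<omega> \<in> J i \<or> \<omega> \<in> Z i" using \<omega> le_n by (auto simp: J_def Z_def)
      then show "\<omega> \<in> (\<Union>i<N. J i) \<union> (\<Union>i<N. Z i)" using i k_le by auto
    qed
    have Z_null': "(\<Union>i<N. Z i) \<in> null_sets P" using Z_null by (intro null_sets_UN') auto
    have "measure P ?E \<le> measure P ((\<Union>i<N. J i) \<union> (\<Union>i<N. Z i))"
      using sub J_P Z_null by (intro P.finite_measure_mono sets.Un sets.finite_UN) auto
    also have "\<dots> = measure P (\<Union>i<N. J i)"
      using J_P Z_null' by (intro measure_Un_null_set sets.finite_UN) auto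
    also have "\<dots> \<le> (\<Sum>i<N. measure P (J i))"
      using J_P by (intro P.finite_measure_subadditive_finite) auto
    also have "\<dots> \<le> (\<Sum>i<N. real n * h\<^sup>2)"
      unfolding J_def by (intro sum_mono prob_jump_to_infinity_le u h)
    also have "\<dots> = real n * t\<^sup>2 / real N"
      using N by (simp add: h_def power2_eq_square)
    finally show ?thesis by (simp add: N_def)
  qed
  have "(\<lambda>m. real n * t\<^sup>2 / real (Suc m)) \<longlonglongrightarrow> 0"
    using LIMSEQ_Suc[OF lim_const_over_n] by simp
  then have "measure P ?E \<le> 0" by (rule LIMSEQ_le_const) (use bound in blast)
  then show ?thesis by (simp add: measure_le_0_iff)
qed

lemma stopped_L_integral_after:
  assumes s: "0 \<le> s" "s < t" and A: "A \<in> sets (F s)"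
    and after: "\<And>\<omega>. \<omega> \<in> A \<Longrightarrow> ennreal s < passage_time X n \<omega>"
  shows "integrable Q (\<lambda>\<omega>. indicator A \<omega> * growth x0 (X (passage_clock X n t \<omega>) \<omega>))"
    and "(\<integral>\<omega>. indicator A \<omega> * growth x0 (X (passage_clock X n t \<omega>) \<omega>) \<partial>Q) = measure P A"
proof -
  have t: "0 \<le> t" "0 < t" using s by auto
  have A_sub: "A \<subseteq> space P" using sets.sets_into_space[OF sets_F_P[OF s(1) A]] .
  have clock: "max s (passage_clock X n t \<omega>) = passage_clock X n t \<omega>" if "\<omega> \<in> A" for \<omega>
    using passage_clock_less_iff[of t s X n \<omega>] after[OF that] s by (auto simp: max_def not_less not_le)
  then have eq: "(\<lambda>\<omega>. indicator A \<omega> * growth x0 (X (max s (passage_clock X n t \<omega>)) \<omega>))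
      = (\<lambda>\<omega>. indicator A \<omega> * growth x0 (X (passage_clock X n t \<omega>) \<omega>))"
    by (auto simp: indicator_def fun_eq_iff)
  show "integrable Q (\<lambda>\<omega>. indicator A \<omega> * growth x0 (X (passage_clock X n t \<omega>) \<omega>))"
    using sampled_at_passage(1)[OF s A, of n] unfolding eq .
  let ?E = "{\<omega> \<in> space P. X (passage_clock X n t \<omega>) \<omega> = \<infinity>}"
  note [measurable] = measurable_from_subalg[OF subalgebra_P[OF t(1)] X_clock_measurable[OF t(1)]]
    sets_F_P[OF s(1) A]
  have E: "?E \<in> null_sets P"
    using no_jump_to_infinity[OF t(2), of n] by (intro null_setsI) (auto simp: P.emeasure_eq_measure)
  have "(\<integral>\<omega>. indicator A \<omega> * growth x0 (X (passage_clock X n t \<omega>) \<omega>) \<partial>Q)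
      = measure P {\<omega> \<in> A. X (max s (passage_clock X n t \<omega>)) \<omega> < \<infinity>}"
    using sampled_at_passage(2)[OF s A, of n] unfolding eq .
  also have "{\<omega> \<in> A. X (max s (passage_clock X n t \<omega>)) \<omega> < \<infinity>} = A - ?E"
    using clock A_sub by (auto simp: less_top)
  also have "measure P (A - ?E) = measure P A"
    using sets_F_P[OF s(1) A] E by (intro measure_Diff_null_set) auto
  finally show "(\<integral>\<omega>. indicator A \<omega> * growth x0 (X (passage_clock X n t \<omega>) \<omega>) \<partial>Q) = measure P A" .
qed

lemma finite_before_passage:
  assumes "0 \<le> s" "ennreal s < passage_time X n \<omega>"
  shows "X s \<omega> < \<infinity>"
  using before_passage_time[OF assms] by (rule le_less_trans) (simp add: of_nat_less_top)

lemma growth_0: "\<omega> \<in> space P \<Longrightarrow> growth x0 (X 0 \<omega>) = 1"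
  using X_0 x0_pos by (simp add: growth_def)

lemma clock_at_passage:
  assumes s: "0 \<le> s" "s \<le> t" and le: "passage_time X n \<omega> \<le> ennreal s"
  shows "passage_clock X n t \<omega> = passage_clock X n s \<omega>"
proof -
  have "passage_time X n \<omega> \<le> ennreal t" using le ennreal_leI[OF s(2)] by (rule order_trans)
  then show ?thesis using le by (simp add: passage_clock_def min_absorb2)
qed

lemma after_passage_measurable:
  assumes s: "0 \<le> s"
  shows "{\<omega> \<in> space P. ennreal s < passage_time X n \<omega>} \<in> sets (F s)"
proof -
  have "{\<omega> \<in> space P. ennreal s < passage_time X n \<omega>} = space (F s) - {\<omega> \<in> space P. passage_time X n \<omega> \<le> ennreal s}"
    by (auto simp: space_F[OF s])
  then show ?thesis using passage_time_le_measurable[OF s, of n] by auto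
qed

lemma stopped_growth_integrable:
  assumes t: "0 \<le> t"
  shows "integrable Q (\<lambda>\<omega>. growth x0 (X (passage_clock X n t \<omega>) \<omega>))"
proof (cases "t = 0")
  case True
  have "passage_clock X n t \<omega> = 0" for \<omega>
    using passage_clock(2,3)[OF t, of X n \<omega>] True by simp
  then have "integrable Q (\<lambda>\<omega>. growth x0 (X (passage_clock X n t \<omega>) \<omega>)) \<longleftrightarrow> integrable Q (\<lambda>_. 1 :: real)"
    by (intro Bochner_Integration.integrable_cong refl) (auto simp: growth_0 space_Q)
  then show ?thesis by simp
next
  case False
  let ?A = "{\<omega> \<in> space P. ennreal 0 < passage_time X n \<omega>}"
  have A: "?A \<in> sets (F 0)" using after_passage_measurable[of 0 n] by simp
  have "integrable Q (\<lambda>\<omega>. indicator ?A \<omega> * growth x0 (X (passage_clock X n t \<omega>) \<omega>) + indicator (space P - ?A) \<omega>)"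
  proof (rule Bochner_Integration.integrable_add)
    show "integrable Q (\<lambda>\<omega>. indicator ?A \<omega> * growth x0 (X (passage_clock X n t \<omega>) \<omega>))"
      using False t A by (intro stopped_L_integral_after(1)[of 0]) auto
    have "space P - ?A \<in> sets Q" using sets_F_P[OF order_refl A] sets_Q by auto
    then show "integrable Q (indicator (space P - ?A) :: 'a \<Rightarrow> real)"
      by (auto simp: Q.emeasure_eq_measure)
  qed
  moreover have "integrable Q (\<lambda>\<omega>. indicator ?A \<omega> * growth x0 (X (passage_clock X n t \<omega>) \<omega>) + indicator (space P - ?A) \<omega>)
      \<longleftrightarrow> integrable Q (\<lambda>\<omega>. growth x0 (X (passage_clock X n t \<omega>) \<omega>))"
  proof (intro Bochner_Integration.integrable_cong refl)
    fix \<omega> assume "\<omega> \<in> space Q"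
    then have \<omega>: "\<omega> \<in> space P" by (simp add: space_Q)
    show "indicator ?A \<omega> * growth x0 (X (passage_clock X n t \<omega>) \<omega>) + indicator (space P - ?A) \<omega>
        = growth x0 (X (passage_clock X n t \<omega>) \<omega>)"
    proof (cases "\<omega> \<in> ?A")
      case False
      then have "passage_time X n \<omega> = 0" using \<omega> by simp
      then have "passage_clock X n t \<omega> = 0" by (simp add: passage_clock_def min_absorb2)
      then show ?thesis using False \<omega> growth_0[OF \<omega>] by simp
    qed simp
  qed
  ultimately show ?thesis by blast
qed

text \<open>
  Split \<open>A\<close> at time \<open>s\<close>. Where \<open>X\<close> has already passed \<open>n\<close>, the stopped process no longer changes. On
  the remaining part \<open>B\<close> its integral is \<open>P(B)\<close> at time \<open>t\<close>, and also at time \<open>s\<close>, where \<open>M\<^sub>s L\<^sub>s = 1\<close> as \<open>X\<^sub>s\<close> is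
  still at most \<open>n\<close>.
\<close>

lemma stopped_L_martingale: "martingale Q F (stopped (L_proc X) (passage_time X n))"
  unfolding martingale_def
proof (intro conjI allI impI)
  let ?Z = "\<lambda>t \<omega>. growth x0 (X (passage_clock X n t \<omega>) \<omega>)"
  have Z_F: "?Z t \<in> borel_measurable (F t)" if "0 \<le> t" for t
    by (rule measurable_compose[OF X_clock_measurable[OF that] growth_measurable])
  have stopped_F: "stopped (L_proc X) (passage_time X n) t \<in> borel_measurable (F t)" if t: "0 \<le> t" for t
    using Z_F[OF t] by (rule measurable_cong[THEN iffD1, rotated]) (simp add: space_F[OF t] stopped_L[OF _ t])
  then show "adapted F (stopped (L_proc X) (passage_time X n))" by (simp add: adapted_def)
  have int: "integrable Q (stopped (L_proc X) (passage_time X n) t)" if t: "0 \<le> t" for t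
    using stopped_growth_integrable[OF t, of n]
    by (rule Bochner_Integration.integrable_cong[THEN iffD1, OF refl, rotated]) (simp add: space_Q stopped_L[OF _ t])
  then show "integrable Q (stopped (L_proc X) (passage_time X n) t)" if "0 \<le> t" for t using that .
  fix s t :: real assume s: "0 \<le> s" "s \<le> t"
  then have t: "0 \<le> t" by simp
  interpret sub: finite_measure_subalgebra Q "F s"
    by unfold_locales (rule subalgebra_Q[OF s(1)])
  show "AE \<omega> in Q. real_cond_exp Q (F s) (stopped (L_proc X) (passage_time X n) t) \<omega>
      = stopped (L_proc X) (passage_time X n) s \<omega>"
  proof (rule sub.real_cond_exp_charact)
    fix A assume A: "A \<in> sets (F s)"
    let ?B = "A \<inter> {\<omega> \<in> space P. ennreal s < passage_time X n \<omega>}"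
    let ?C = "A - ?B"
    have B: "?B \<in> sets (F s)" using A after_passage_measurable[OF s(1)] by auto
    then have C: "?C \<in> sets (F s)" using A by auto
    have A_sub: "A \<subseteq> space P" using sets.sets_into_space[OF A] by (simp add: space_F[OF s(1)])
    have split: "(\<integral>\<omega>\<in>A. stopped (L_proc X) (passage_time X n) u \<omega> \<partial>Q)
        = (\<integral>\<omega>. indicator ?B \<omega> * ?Z u \<omega> \<partial>Q) + (\<integral>\<omega>. indicator ?C \<omega> * ?Z u \<omega> \<partial>Q)" if u: "0 \<le> u" for u
    proof -
      have BC: "?B \<in> sets Q" "?C \<in> sets Q"
        using sets_F_P[OF s(1) B] sets_F_P[OF s(1) C] sets_Q by auto
      have int: "integrable Q (\<lambda>\<omega>. indicator D \<omega> * ?Z u \<omega>)" if "D \<in> sets Q" for D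
        using integrable_mult_indicator[OF that stopped_growth_integrable[OF u, of n]] by simp
      have "(\<integral>\<omega>\<in>A. stopped (L_proc X) (passage_time X n) u \<omega> \<partial>Q)
          = (\<integral>\<omega>. indicator ?B \<omega> * ?Z u \<omega> + indicator ?C \<omega> * ?Z u \<omega> \<partial>Q)"
        unfolding set_lebesgue_integral_def
        by (intro Bochner_Integration.integral_cong refl)
           (use stopped_L[OF _ u, of _ n] A_sub in \<open>auto simp: indicator_def\<close>)
      also have "\<dots> = (\<integral>\<omega>. indicator ?B \<omega> * ?Z u \<omega> \<partial>Q) + (\<integral>\<omega>. indicator ?C \<omega> * ?Z u \<omega> \<partial>Q)"
        by (rule Bochner_Integration.integral_add[OF int[OF BC(1)] int[OF BC(2)]])
      finally show ?thesis .
    qed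
    have after: "(\<integral>\<omega>. indicator ?B \<omega> * ?Z t \<omega> \<partial>Q) = (\<integral>\<omega>. indicator ?B \<omega> * ?Z s \<omega> \<partial>Q)"
    proof (cases "s = t")
      case False
      then have "s < t" using s by simp
      then have "(\<integral>\<omega>. indicator ?B \<omega> * ?Z t \<omega> \<partial>Q) = measure P ?B"
        by (intro stopped_L_integral_after(2)[OF s(1) _ B]) auto
      also have "\<dots> = (\<integral>\<omega>. indicator ?B \<omega> \<partial>P)" using sets_F_P[OF s(1) B] by simp
      also have "\<dots> = (\<integral>\<omega>. M_proc X s \<omega> * (indicator ?B \<omega> * ?Z s \<omega>) \<partial>P)"
      proof (intro Bochner_Integration.integral_cong refl)
        fix \<omega> assume \<omega>: "\<omega> \<in> space P"
        show "indicator ?B \<omega> = M_proc X s \<omega> * (indicator ?B \<omega> * ?Z s \<omega>)"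
        proof (cases "\<omega> \<in> ?B")
          case True
          then have lt: "ennreal s < passage_time X n \<omega>" by auto
          then have "passage_clock X n s \<omega> = s"
            using s(1) by (simp add: passage_clock_def min_absorb1 less_imp_le)
          then show ?thesis
            using True finite_before_passage[OF s(1) lt] X_0 \<omega> x0_pos
            by (simp add: M_proc_def growth_def exp_add[symmetric])
        qed simp
      qed
      also have "\<dots> = (\<integral>\<omega>. indicator ?B \<omega> * ?Z s \<omega> \<partial>Q)"
        using Z_F[OF s(1)] B
        by (intro change_of_measure(1)[OF s(1), symmetric] borel_measurable_times borel_measurable_indicator)
      finally show ?thesis .
    qed simp
    have before: "(\<integral>\<omega>. indicator ?C \<omega> * ?Z t \<omega> \<partial>Q) = (\<integral>\<omega>. indicator ?C \<omega> * ?Z s \<omega> \<partial>Q)"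
    proof (intro Bochner_Integration.integral_cong refl)
      fix \<omega>
      show "indicator ?C \<omega> * ?Z t \<omega> = indicator ?C \<omega> * ?Z s \<omega>"
      proof (cases "\<omega> \<in> ?C")
        case True
        then have "passage_time X n \<omega> \<le> ennreal s" using A_sub by auto
        then show ?thesis using clock_at_passage[OF s, of n \<omega>] by simp
      qed simp
    qed
    show "(\<integral>\<omega>\<in>A. stopped (L_proc X) (passage_time X n) t \<omega> \<partial>Q)
        = (\<integral>\<omega>\<in>A. stopped (L_proc X) (passage_time X n) s \<omega> \<partial>Q)"
      by (simp only: split[OF t] split[OF s(1)] after before)
  qed (use int[OF t] int[OF s(1)] stopped_F[OF s(1)] in auto)
qed

text \<open>
  \<open>L\<^sub>t\<close> is \<open>growth x\<^sub>0 (X\<^sub>t)\<close> except on paths that have returned from \<open>\<infinity>\<close> by time \<open>t\<close>. These form a null set,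
  which belongs to the completed filtration.
\<close>

lemma L_adapted: "adapted F (L_proc X)"
  unfolding adapted_def
proof (intro allI impI)
  fix t :: real assume t: "0 \<le> t"
  let ?N = "{\<omega> \<in> space P. explosion_time X \<omega> \<le> ennreal t \<and> X t \<omega> \<noteq> \<infinity>}"
  have N [measurable]: "?N \<in> sets (F t)" by (rule null_set_F(1)[OF order_refl stays_at_infinity[OF t] t])
  note [measurable] = X_measurable_F[OF t order_refl]
  have "(\<lambda>\<omega>. if \<omega> \<in> ?N then 0 else growth x0 (X t \<omega>)) \<in> borel_measurable (F t)" by measurable
  then show "L_proc X t \<in> borel_measurable (F t)"
  proof (rule measurable_cong[THEN iffD1, rotated])
    fix \<omega> assume "\<omega> \<in> space (F t)"
    then have \<omega>: "\<omega> \<in> space P" by (simp add: space_F[OF t])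
    have "X t \<omega> \<noteq> \<infinity>" if "ennreal t < explosion_time X \<omega>"
      using explosion_time_le[OF t, of X \<omega>] that by (auto simp: not_le[symmetric])
    then show "(if \<omega> \<in> ?N then 0 else growth x0 (X t \<omega>)) = L_proc X t \<omega>"
      using X_0 x0_pos \<omega>
      by (auto simp: L_proc_def M_proc_def growth_def exp_minus[symmetric] divide_inverse not_less)
  qed
qed

lemma Q_locally_bounded:
  "AE \<omega> in Q. \<omega> \<in> space P \<and> (\<forall>t\<ge>0. \<exists>n::nat. \<forall>r. 0 \<le> r \<longrightarrow> r \<le> t \<longrightarrow> X r \<omega> \<le> of_nat n)"
proof -
  have "unbounded_before (real k) \<in> null_sets Q" for k
    using Q_unbounded_before[of "real k"] sets_F_P[OF _ unbounded_before_measurable, of "real k"]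
    by (intro null_setsI) (auto simp: Q.emeasure_eq_measure sets_Q)
  then have "AE \<omega> in Q. \<omega> \<notin> unbounded_before (real k)" for k by (rule AE_not_in)
  then have "AE \<omega> in Q. \<forall>k. \<omega> \<notin> unbounded_before (real k)" by (simp add: AE_all_countable)
  then show ?thesis
  proof (rule AE_mp, intro AE_I2 impI conjI allI)
    fix \<omega> assume "\<omega> \<in> space Q" and *: "\<forall>k. \<omega> \<notin> unbounded_before (real k)"
    then show \<omega>: "\<omega> \<in> space P" by (simp add: space_Q)
    fix t :: real
    obtain k :: nat where k: "t \<le> real k" using real_arch_simple by blast
    show "\<exists>n::nat. \<forall>r. 0 \<le> r \<longrightarrow> r \<le> t \<longrightarrow> X r \<omega> \<le> of_nat n"
      using bounded_outside_unbounded_before[OF \<omega>, of "real k"] * k by (meson order_trans)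
  qed
qed

lemma L_cadlag:
  assumes \<omega>: "\<omega> \<in> space P"
    and bdd: "\<forall>t\<ge>0. \<exists>n::nat. \<forall>r. 0 \<le> r \<longrightarrow> r \<le> t \<longrightarrow> X r \<omega> \<le> of_nat n"
  shows "cadlag (\<lambda>t. L_proc X t \<omega>)"
proof -
  have fin: "X t \<omega> < \<infinity>" if t: "0 \<le> t" for t
  proof -
    obtain n :: nat where "\<forall>r. 0 \<le> r \<longrightarrow> r \<le> t \<longrightarrow> X r \<omega> \<le> of_nat n" using bdd t by blast
    then have "X t \<omega> \<le> of_nat n" using t by simp
    then show ?thesis by (rule le_less_trans) (simp add: of_nat_less_top)
  qed
  then have empty: "{ennreal t |t. 0 \<le> t \<and> X t \<omega> = \<infinity>} = {}" by fastforce
  have "explosion_time X \<omega> = top" unfolding explosion_time_def empty by simp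
  then have L: "L_proc X t \<omega> = exp (enn2real (X t \<omega>) - x0)" if "0 \<le> t" for t
    using fin[OF that] X_0 x0_pos \<omega> by (simp add: L_proc_def M_proc_def exp_minus[symmetric] divide_inverse less_top)
  have conv: "((\<lambda>t. exp (enn2real (X t \<omega>) - x0)) \<longlongrightarrow> exp (enn2real l - x0)) G"
    if "((\<lambda>t. X t \<omega>) \<longlongrightarrow> l) G" "l < \<infinity>" for l and G :: "real filter"
  proof -
    have "((\<lambda>t. enn2real (X t \<omega>)) \<longlongrightarrow> enn2real l) G"
      using that by (intro tendsto_enn2real) (auto simp: less_top)
    then show ?thesis by (intro tendsto_exp tendsto_diff tendsto_const)
  qed
  show ?thesis unfolding cadlag_def
  proof (intro conjI allI impI)
    fix t :: real assume t: "0 \<le> t"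
    have "((\<lambda>t. X t \<omega>) \<longlongrightarrow> X t \<omega>) (at_right t)" using X_cadlag[OF \<omega>] t by (simp add: cadlag_def)
    from conv[OF this fin[OF t]]
    have "((\<lambda>t. exp (enn2real (X t \<omega>) - x0)) \<longlongrightarrow> L_proc X t \<omega>) (at_right t)" by (simp add: L[OF t])
    then show "((\<lambda>t. L_proc X t \<omega>) \<longlongrightarrow> L_proc X t \<omega>) (at_right t)"
      by (rule Lim_transform_eventually) (use t in \<open>auto simp: eventually_at_filter L intro!: always_eventually\<close>)
  next
    fix t :: real assume t: "0 < t"
    obtain l where l: "((\<lambda>t. X t \<omega>) \<longlongrightarrow> l) (at_left t)" using X_cadlag[OF \<omega>] t by (auto simp: cadlag_def)
    obtain n :: nat where n: "\<And>r. 0 \<le> r \<Longrightarrow> r \<le> t \<Longrightarrow> X r \<omega> \<le> of_nat n" using bdd[rule_format, of t] t by auto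
    have ev: "eventually (\<lambda>r. 0 \<le> r \<and> r \<le> t) (at_left t)"
      using eventually_at_left_real[OF t] by eventually_elim auto
    have "l \<le> of_nat n"
      by (rule tendsto_upperbound[OF l]) (use ev n in \<open>auto elim: eventually_mono\<close>)
    then have "l < \<infinity>" by (rule le_less_trans) (simp add: of_nat_less_top)
    from conv[OF l this]
    have "((\<lambda>t. L_proc X t \<omega>) \<longlongrightarrow> exp (enn2real l - x0)) (at_left t)"
      by (rule Lim_transform_eventually) (use ev in \<open>eventually_elim, simp add: L\<close>)
    then show "\<exists>l. ((\<lambda>t. L_proc X t \<omega>) \<longlongrightarrow> l) (at_left t)" by blast
  qed
qed

lemma passage_time_tendsto:
  assumes bdd: "\<forall>t\<ge>0. \<exists>n::nat. \<forall>r. 0 \<le> r \<longrightarrow> r \<le> t \<longrightarrow> X r \<omega> \<le> of_nat n"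
  shows "(\<lambda>n. passage_time X n \<omega>) \<longlonglongrightarrow> \<infinity>"
proof -
  have "eventually (\<lambda>n. a < passage_time X n \<omega>) sequentially" if a: "a < \<infinity>" for a
  proof -
    obtain r where r: "a = ennreal r" "0 \<le> r" using a by (cases a) auto
    obtain n :: nat where n: "\<And>q. 0 \<le> q \<Longrightarrow> q \<le> r + 1 \<Longrightarrow> X q \<omega> \<le> of_nat n"
      using bdd[rule_format, of "r + 1"] r by auto
    have "ennreal (r + 1) \<le> passage_time X n \<omega>"
      unfolding passage_time_def
    proof (rule Inf_greatest)
      fix z assume "z \<in> {ennreal t |t. 0 \<le> t \<and> of_nat n < X t \<omega>}"
      then obtain q where q: "z = ennreal q" "0 \<le> q" "of_nat n < X q \<omega>" by auto
      then have "r + 1 \<le> q" using n[of q] by (cases "q \<le> r + 1") auto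
      then show "ennreal (r + 1) \<le> z" using q by (simp only: ennreal_leI)
    qed
    moreover have "ennreal r < ennreal (r + 1)" using r by (simp only: ennreal_less_iff)
    ultimately have "a < passage_time X n \<omega>" unfolding r(1) by (rule less_le_trans[rotated])
    then show ?thesis
      by (intro eventually_sequentiallyI[of n]) (auto intro: less_le_trans incseqD[OF passage_time_mono])
  qed
  then show ?thesis by (intro order_tendstoI) (auto simp: not_less_iff_gr_or_eq)
qed

lemma L_local_martingale: "local_martingale Q F (L_proc X)"
  unfolding local_martingale_def
proof (intro conjI exI[of _ "passage_time X"] allI)
  show "adapted F (L_proc X)" by (rule L_adapted)
  show "AE \<omega> in Q. cadlag (\<lambda>t. L_proc X t \<omega>)"
    using Q_locally_bounded by eventually_elim (use L_cadlag in blast)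
  show "ext_stopping_time F (passage_time X n)" for n by (rule passage_time_stopping)
  show "AE \<omega> in Q. incseq (\<lambda>n. passage_time X n \<omega>)" by (intro AE_I2 passage_time_mono)
  show "AE \<omega> in Q. (\<lambda>n. passage_time X n \<omega>) \<longlonglongrightarrow> \<infinity>"
    using Q_locally_bounded by eventually_elim (use passage_time_tendsto in blast)
  show "martingale Q F (stopped (L_proc X) (passage_time X n))" for n by (rule stopped_L_martingale)
qed

section \<open>Loss of mass\<close>

text \<open>
  A martingale would keep its \<open>Q\<close>-expectation \<open>L\<^sub>0 = 1\<close>. At time \<open>1\<close> the expectation is that of \<open>M\<^sub>1 L\<^sub>1\<close> under
  \<open>P\<close>, and this product is at most \<open>1\<close> and zero where \<open>X\<^sub>1\<close> is infinite.
\<close>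

lemma L_not_martingale: "\<not> martingale Q F (L_proc X)"
proof
  assume mart: "martingale Q F (L_proc X)"
  interpret sub: finite_measure_subalgebra Q "F 0"
    by unfold_locales (rule subalgebra_Q[OF order_refl])
  have int: "integrable Q (L_proc X 1)" using mart by (simp add: martingale_def)
  have L_F: "L_proc X 1 \<in> borel_measurable (F 1)" using L_adapted by (simp add: adapted_def)
  have "AE \<omega> in Q. real_cond_exp Q (F 0) (L_proc X 1) \<omega> = L_proc X 0 \<omega>"
    using mart by (simp add: martingale_def)
  then have "AE \<omega> in Q. real_cond_exp Q (F 0) (L_proc X 1) \<omega> = 1"
  proof (rule AE_mp, intro AE_I2 impI)
    fix \<omega> assume "\<omega> \<in> space Q" and eq: "real_cond_exp Q (F 0) (L_proc X 1) \<omega> = L_proc X 0 \<omega>"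
    then have \<omega>: "\<omega> \<in> space P" by (simp add: space_Q)
    have "0 < explosion_time X \<omega>"
    proof (rule ccontr)
      assume "\<not> 0 < explosion_time X \<omega>"
      then have "explosion_time X \<omega> \<le> ennreal 0" by simp
      from explosion_time_attained[OF \<omega> order_refl this] have "X 0 \<omega> = \<infinity>" by auto
      then show False using X_0 \<omega> by simp
    qed
    then show "real_cond_exp Q (F 0) (L_proc X 1) \<omega> = 1"
      using eq X_0 \<omega> by (simp add: L_proc_def M_proc_def)
  qed
  then have "(\<integral>\<omega>. real_cond_exp Q (F 0) (L_proc X 1) \<omega> \<partial>Q) = (\<integral>\<omega>. 1 \<partial>Q)"
    by (intro integral_cong_AE) auto
  then have "1 = (\<integral>\<omega>. L_proc X 1 \<omega> \<partial>Q)"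
    using sub.real_cond_exp_int(2)[OF int] Q.prob_space by simp
  also have "\<dots> = (\<integral>\<omega>. M_proc X 1 \<omega> * L_proc X 1 \<omega> \<partial>P)"
    by (rule change_of_measure(1)[OF zero_le_one L_F])
  also have "\<dots> \<le> (\<integral>\<omega>. indicator {\<omega> \<in> space P. X 1 \<omega> < \<infinity>} \<omega> \<partial>P)"
  proof (rule Bochner_Integration.integral_mono')
    note [measurable] = X_measurable_P[OF zero_le_one]
    show "integrable P (indicator {\<omega> \<in> space P. X 1 \<omega> < \<infinity>} :: 'a \<Rightarrow> real)"
      by (auto simp: P.emeasure_eq_measure)
    show "M_proc X 1 \<omega> * L_proc X 1 \<omega> \<le> indicator {\<omega> \<in> space P. X 1 \<omega> < \<infinity>} \<omega>" if "\<omega> \<in> space P" for \<omega>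
      using that by (auto simp: M_proc_def L_proc_def indicator_def less_top)
  qed simp
  also have "\<dots> = measure P {\<omega> \<in> space P. X 1 \<omega> < \<infinity>}"
    using X_measurable_P[OF zero_le_one] by simp
  finally show False using explodes_with_positive_probability by simp
qed

theorem L_strict_local_martingale: "strict_local_martingale Q F (L_proc X)"
  using L_local_martingale L_not_martingale by (simp add: strict_local_martingale_def)

end

theorem theorem4:
  fixes P Q :: "'a measure"
    and F :: "real \<Rightarrow> 'a measure"
    and X :: "real \<Rightarrow> 'a \<Rightarrow> ennreal"
    and S :: "real \<Rightarrow> (ennreal \<Rightarrow>\<^sub>C real) \<Rightarrow> (ennreal \<Rightarrow>\<^sub>C real)"
    and x0 :: real
  assumes "prob_space P"
    and "usual_filtration P F"
    and "cadlag_feller_process P F S X"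
    and "0 < x0"
    and "\<forall>\<omega>\<in>space P. X 0 \<omega> = ennreal x0"
    and "is_core S Cc_infty"
    and "\<forall>(f, g)\<in>generator S. f \<in> Cc_infty \<longrightarrow> (\<forall>x\<ge>0. half_line_fun g x = A_tilde f x)"
    and "sets Q = sets P"
    and "absolutely_continuous P Q"
    and "\<forall>t\<ge>0. restr_to_subalg Q (F t) =
           density (restr_to_subalg P (F t)) (\<lambda>\<omega>. ennreal (M_proc X t \<omega>))"
  shows "strict_local_martingale Q F (L_proc X)"
proof -
  interpret affine_explosion P Q F X S x0
    by (intro affine_explosion.intro) (fact assms)+
  show ?thesis by (rule L_strict_local_martingale)
qed

end
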